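(* Let $d$ be a positive integer and let $\Gamma,\Gamma'$ be finite subgroups of $\mathrm{O}(d+1)$. If $S^d/\Gamma$ and $S^d/\Gamma'$ are isospectral and $|\Gamma|=|\Gamma'|\leq 7$, then $\Gamma$ and $\Gamma'$ are conjugate in $\mathrm{O}(d+1)$, and consequently the spherical orbifolds $S^d/\Gamma$ and $S^d/\Gamma'$ are isometric.
   Context: $S^d$ is the $d$-dimensional unit sphere in $\mathbb{R}^{d+1}$ with the round metric of constant sectional curvature $1$. For a finite subgroup $\Gamma$ of $\mathrm{O}(d+1)$ (possibly with fixed points on $S^d$), the quotient $S^d/\Gamma$, endowed with the Riemannian (orbifold) metric induced by the round metric, is called a spherical orbifold. The spectrum $\operatorname{Spec}(S^d/\Gamma)$ is the multiset of eigenvalues of the Laplace--Beltrami operator acting on functions on $S^d/\Gamma$ (i.e. on $\Gamma$-invariant functions on $S^d$). Explicitly, it consists of the numbers $\lambda_k=k(k+d-1)$, $k\geq 0$, each with multiplicity $\dim\mathcal{H}_k^\Gamma$, where $\mathcal{H}_k$ is the space of complex harmonic homogeneous polynomials of degree $k$ in $d+1$ variables, with $\mathrm{O}(d+1)$ acting by $(a\cdot P)(z)=P(a^{-1}z)$, and $\mathcal{H}_k^\Gamma$ is its subspace of $\Gamma$-invariant elements. Two spherical orbifolds are isospectral if their spectra coincide as multisets; for $S^d/\Gamma$ and $S^d/\Gamma'$ of the same dimension $d$ this is equivalent to $\dim\mathcal{H}_k^{\Gamma}=\dim\mathcal{H}_k^{\Gamma'}$ for all $k\geq 0$. *)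

theory Defs
  imports "HOL-Analysis.Analysis" "HOL-Algebra.Coset" "HOL-Library.Function_Algebras"
begin

text \<open>The group \<open>O(n)\<close>, where \<open>n = CARD('n)\<close>.\<close>

definition orthogonal_group :: "(real^'n^'n) monoid" where
  "orthogonal_group =
     \<lparr>carrier = {A. orthogonal_matrix A}, monoid.mult = (**), one = mat 1\<rparr>"

lemma group_orthogonal_group: "group (orthogonal_group :: (real^'n^'n) monoid)"
proof (rule groupI)
  fix A :: "real^'n^'n"
  assume "A \<in> carrier orthogonal_group"
  then show "\<exists>B\<in>carrier orthogonal_group. B \<otimes>\<^bsub>orthogonal_group\<^esub> A = \<one>\<^bsub>orthogonal_group\<^esub>"
    by (intro bexI[of _ "transpose A"])
       (auto simp: orthogonal_group_def orthogonal_matrix_def)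
qed (auto simp: orthogonal_group_def orthogonal_matrix_mul orthogonal_matrix_id
      matrix_mul_assoc)

definition conjugate_in_orthogonal_group :: "(real^'n^'n) set \<Rightarrow> (real^'n^'n) set \<Rightarrow> bool" where
  "conjugate_in_orthogonal_group G G' \<longleftrightarrow>
     (\<exists>a\<in>carrier orthogonal_group.
        G' = (\<lambda>g. a \<otimes>\<^bsub>orthogonal_group\<^esub> g \<otimes>\<^bsub>orthogonal_group\<^esub> inv\<^bsub>orthogonal_group\<^esub> a) ` G)"


section \<open>Smooth functions and the Laplace--Beltrami operator on the round sphere\<close>

definition partial_deriv :: "'a::euclidean_space \<Rightarrow> ('a \<Rightarrow> complex) \<Rightarrow> 'a \<Rightarrow> complex" where
  "partial_deriv b F x = frechet_derivative F (at x) b"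

text \<open>\<open>C_k_on k U F\<close> is the usual notion of a \<open>C\<^sup>k\<close> function only for open \<open>U\<close>.\<close>

primrec C_k_on :: "nat \<Rightarrow> 'a::euclidean_space set \<Rightarrow> ('a \<Rightarrow> complex) \<Rightarrow> bool" where
  "C_k_on 0 U F \<longleftrightarrow> continuous_on U F"
| "C_k_on (Suc k) U F \<longleftrightarrow> F differentiable_on U \<and> (\<forall>b\<in>Basis. C_k_on k U (partial_deriv b F))"

definition laplacian :: "('a::euclidean_space \<Rightarrow> complex) \<Rightarrow> 'a \<Rightarrow> complex" where
  "laplacian F x = (\<Sum>b\<in>Basis. partial_deriv b (partial_deriv b F) x)"

text \<open>The extension of a function on the unit sphere that is constant along rays. It is smooth
  away from the origin iff the function is smooth on the sphere.\<close>

definition radial_extension :: "('a::euclidean_space \<Rightarrow> complex) \<Rightarrow> 'a \<Rightarrow> complex" where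
  "radial_extension f x = f (x /\<^sub>R norm x)"

text \<open>A function on the sphere is represented by a function on the ambient space that vanishes off
  the sphere, so that distinct representatives are distinct functions on the sphere.\<close>

definition smooth_on_sphere :: "('a::euclidean_space \<Rightarrow> complex) \<Rightarrow> bool" where
  "smooth_on_sphere f \<longleftrightarrow>
     (\<forall>x. x \<notin> sphere 0 1 \<longrightarrow> f x = 0) \<and> (\<forall>k. C_k_on k (- {0}) (radial_extension f))"

text \<open>The Laplace--Beltrami operator \<open>- div grad\<close> of the round metric (with nonnegative spectrum):
  as the extension does not depend on the radius \<open>r\<close>, the radial terms of the Euclidean Laplacian
  \<open>\<partial>\<^sub>r\<^sup>2 + (n - 1) / r \<partial>\<^sub>r + \<Delta>\<^sub>S / r\<^sup>2\<close> vanish, and \<open>r = 1\<close> on the sphere.\<close>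

definition laplace_beltrami :: "('a::euclidean_space \<Rightarrow> complex) \<Rightarrow> 'a \<Rightarrow> complex" where
  "laplace_beltrami f x = - laplacian (radial_extension f) x"


section \<open>The spectrum of a spherical orbifold\<close>

definition invariant_functions :: "(real^'n^'n) set \<Rightarrow> (real^'n \<Rightarrow> complex) set" where
  "invariant_functions G =
     {f. smooth_on_sphere f \<and> (\<forall>g\<in>G. \<forall>x\<in>sphere 0 1. f (g *v x) = f x)}"

definition eigenspace :: "(real^'n^'n) set \<Rightarrow> real \<Rightarrow> (real^'n \<Rightarrow> complex) set" where
  "eigenspace G l =
     {f \<in> invariant_functions G. \<forall>x\<in>sphere 0 1. laplace_beltrami f x = of_real l * f x}"

definition scale_fun :: "complex \<Rightarrow> ('a \<Rightarrow> complex) \<Rightarrow> 'a \<Rightarrow> complex" where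
  "scale_fun c f = (\<lambda>x. c * f x)"

lemma vector_space_scale_fun: "vector_space (scale_fun :: complex \<Rightarrow> ('a \<Rightarrow> complex) \<Rightarrow> _)"
  by unfold_locales (auto simp: scale_fun_def algebra_simps fun_eq_iff)

text \<open>The spectrum is an infinite multiset with finite multiplicities, so it is given by its
  multiplicity function rather than by an element of the type of finite multisets. The multiplicity
  of \<open>l\<close> is the complex dimension of its eigenspace, which is \<open>0\<close> iff \<open>l\<close> is not an eigenvalue.\<close>

definition orbifold_spectrum :: "(real^'n^'n) set \<Rightarrow> real \<Rightarrow> nat" where
  "orbifold_spectrum G l = vector_space.dim scale_fun (eigenspace G l)"

definition isospectral :: "(real^'n^'n) set \<Rightarrow> (real^'n^'n) set \<Rightarrow> bool" where
  "isospectral G G' \<longleftrightarrow> orbifold_spectrum G = orbifold_spectrum G'"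


section \<open>Isometries of spherical orbifolds\<close>

definition orbit_of :: "(real^'n^'n) set \<Rightarrow> real^'n \<Rightarrow> (real^'n) set" where
  "orbit_of G x = (\<lambda>g. g *v x) ` G"

definition spherical_orbifold :: "(real^'n^'n) set \<Rightarrow> (real^'n) set set" where
  "spherical_orbifold G = orbit_of G ` sphere 0 1"

text \<open>The Riemannian distance of the round unit sphere, and the distance it induces on orbits.\<close>

definition sphere_dist :: "real^'n \<Rightarrow> real^'n \<Rightarrow> real" where
  "sphere_dist x y = arccos (x \<bullet> y)"

definition orbit_dist :: "(real^'n) set \<Rightarrow> (real^'n) set \<Rightarrow> real" where
  "orbit_dist X Y = Inf {sphere_dist x y | x y. x \<in> X \<and> y \<in> Y}"

text \<open>An isometry of Riemannian orbifolds: a bijection of the underlying spaces that preserves the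
  distance and that lifts, near every point of the sphere, to an isometry between the orbifold
  charts. Such local lifts are isometries onto open subsets of the sphere, so their local inverses
  lift the inverse map.\<close>

definition orbifold_isometry ::
  "(real^'n^'n) set \<Rightarrow> (real^'n^'n) set \<Rightarrow> ((real^'n) set \<Rightarrow> (real^'n) set) \<Rightarrow> bool" where
  "orbifold_isometry G G' \<phi> \<longleftrightarrow>
     bij_betw \<phi> (spherical_orbifold G) (spherical_orbifold G') \<and>
     (\<forall>X\<in>spherical_orbifold G. \<forall>Y\<in>spherical_orbifold G.
        orbit_dist (\<phi> X) (\<phi> Y) = orbit_dist X Y) \<and>
     (\<forall>x\<in>sphere 0 1. \<exists>U f. openin (top_of_set (sphere 0 1)) U \<and> x \<in> U \<and>
        f ` U \<subseteq> sphere 0 1 \<and>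
        (\<forall>u\<in>U. \<forall>v\<in>U. sphere_dist (f u) (f v) = sphere_dist u v) \<and>
        (\<forall>u\<in>U. \<phi> (orbit_of G u) = orbit_of G' (f u)))"

definition isometric_orbifolds :: "(real^'n^'n) set \<Rightarrow> (real^'n^'n) set \<Rightarrow> bool" where
  "isometric_orbifolds G G' \<longleftrightarrow> (\<exists>\<phi>. orbifold_isometry G G' \<phi>)"

end

theory Submission
  imports Defs "HOL-Computational_Algebra.Polynomial_FPS"
begin

text \<open>Restricted to the sphere, a \<open>\<Gamma>\<close>-invariant harmonic polynomial of degree \<open>k\<close> is an eigenfunction;
  conversely, an eigenfunction times \<open>r\<^sup>k\<close> is harmonic and homogeneous off the origin, hence a
  polynomial. So the spectrum determines the dimensions of the spaces of invariant harmonic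
  polynomials, and, since \<open>\<Delta> \<circ> r\<^sup>2\<close> is invertible, those of all spaces of invariant polynomials,
  i.e. the averages \<open>\<Sum>g\<in>\<Gamma>. h\<^sub>k(g)\<close> of complete symmetric functions of eigenvalues (Molien).
  For \<open>|\<Gamma>| \<le> 7\<close> the averages with \<open>k \<le> 4\<close>, and for \<open>|\<Gamma>| = 6\<close> also the order of the pole of the
  Molien series at a primitive cube root of unity, suffice to find a trace-preserving isomorphism
  \<open>\<Gamma> \<rightarrow> \<Gamma>'\<close>. Orthogonal representations with equal characters are orthogonally conjugate: an
  averaged intertwiner \<open>T\<close> is an isometry up to scale on the top eigenspace of \<open>T\<^sup>T T\<close>, which splits off.\<close>

text \<open>No group element is ever diagonalised. Newton's identities for the characters on
  polynomials come from moving a coordinate factor round a trace, and multiplicities of eigenvalues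
  are traces of averaged projections; so the Molien series is handled through the numbers tr(g^j)
  alone. What is needed beyond these depends on what a change of generator can repair. In orders 2,
  3 and 5 the unordered traces suffice. In order 7 other generators only rotate the traces of g,
  g^2, g^4; degrees up to 3 are symmetric in them, and their cyclic order first shows in degree 4.
  In order 4 the equations of degree at most 3 are solved over the reals, and spurious solutions are
  excluded by tr(g^2) < n. In order 6 both the cyclic group and \<open>S\<^sub>3\<close> have
  exactly two elements of order 3, and the pole at a primitive cube root of unity tells how often
  these have that root as an eigenvalue; with this number known, degrees 1 to 3 suffice. The
  obstacle is that in the cyclic case elements of order 6 may contribute to the same pole, so
  cancellation has to be ruled out.\<close>

section \<open>Equal characters imply conjugacy\<close>

definition orthogonal_proj_matrix :: "real^'n^'n \<Rightarrow> bool" where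
  "orthogonal_proj_matrix P \<longleftrightarrow> transpose P = P \<and> P ** P = P"

lemma trace_transpose_mult_self: "trace (transpose A ** A) = (\<Sum>i\<in>UNIV. \<Sum>j\<in>UNIV. (A$j$i)\<^sup>2)"
  for A :: "real^'n^'m"
  by (simp add: trace_def matrix_matrix_mult_def transpose_def power2_eq_square)

lemma trace_transpose_mult_self_nonneg: "0 \<le> trace (transpose A ** A)" for A :: "real^'n^'m"
  by (simp add: trace_transpose_mult_self sum_nonneg)

lemma trace_transpose_mult_self_eq_0: "trace (transpose A ** A) = 0 \<longleftrightarrow> A = 0" for A :: "real^'n^'m"
proof
  assume "trace (transpose A ** A) = 0"
  then have "\<forall>i j. A$j$i = 0"
    by (simp add: trace_transpose_mult_self sum_nonneg sum_nonneg_eq_0_iff)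
  then show "A = 0" by (simp add: vec_eq_iff)
qed (simp add: trace_def)

lemma trace_transpose: "trace (transpose A) = trace A"
  by (simp add: trace_def transpose_def)

lemma trace_proj: "orthogonal_proj_matrix P \<Longrightarrow> trace P = trace (transpose P ** P)"
  by (simp add: orthogonal_proj_matrix_def)

lemma transpose_add: "transpose (A + B) = transpose A + transpose B" for A :: "real^'n^'m"
  by (simp add: transpose_def vec_eq_iff)

lemma transpose_diff: "transpose (A - B) = transpose A - transpose B" for A :: "real^'n^'m"
  by (simp add: transpose_def vec_eq_iff)

lemma matrix_mult_sum_right: "(A::real^'n^'m) ** sum f S = (\<Sum>i\<in>S. A ** f i)"
  by (simp add: matrix_matrix_mult_def vec_eq_iff sum_distrib_left sum.swap[of _ S])

lemma matrix_mult_sum_left: "sum f S ** (A::real^'n^'m) = (\<Sum>i\<in>S. f i ** A)"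
  by (simp add: matrix_matrix_mult_def vec_eq_iff sum_distrib_right sum.swap[of _ S])

lemma matrix_add_rdistrib: "(B + C) ** (A::real^'n^'m) = B ** A + C ** A"
  by (simp add: matrix_matrix_mult_def vec_eq_iff distrib_right sum.distrib)

lemma scaleR_matrix_mult: "(c *\<^sub>R A) ** (B::real^'n^'m) = c *\<^sub>R (A ** B)" "A ** (c *\<^sub>R B) = c *\<^sub>R (A ** B)"
  by (simp_all add: matrix_matrix_mult_def vec_eq_iff sum_distrib_left mult_ac)

lemma transpose_scaleR: "transpose (c *\<^sub>R A) = c *\<^sub>R transpose A" for A :: "real^'n^'m"
  by (simp add: transpose_def vec_eq_iff)

lemma matrix_mult_diff_right: "(A::real^'n^'m) ** (B - C) = A ** B - A ** C"
  by (simp add: matrix_matrix_mult_def vec_eq_iff right_diff_distrib sum_subtractf)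

lemma matrix_mult_diff_left: "(B - C) ** (A::real^'n^'m) = B ** A - C ** A"
  by (simp add: matrix_matrix_mult_def vec_eq_iff left_diff_distrib sum_subtractf)

text \<open>The eigenvalue is \<open>\<mu> = max |T x|\<^sup>2\<close> over unit vectors: \<open>\<mu> - T\<^sup>T T\<close> is positive semidefinite
  and its quadratic form vanishes at a maximizer, which therefore lies in its kernel.\<close>

lemma gram_matrix_eigenvector:
  fixes T :: "real^'n^'n"
  assumes "T \<noteq> 0"
  obtains \<mu> v where "\<mu> > 0" "v \<noteq> 0" "(transpose T ** T) *v v = \<mu> *\<^sub>R v"
proof -
  have "compact (sphere (0::real^'n) 1)" "sphere (0::real^'n) 1 \<noteq> {}" by auto
  moreover have "continuous_on (sphere (0::real^'n) 1) (\<lambda>x. (T *v x) \<bullet> (T *v x))"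
    by (intro continuous_intros)
  ultimately obtain v where v: "norm v = 1"
    and max: "\<And>y. norm y = 1 \<Longrightarrow> (T *v y) \<bullet> (T *v y) \<le> (T *v v) \<bullet> (T *v v)"
    using continuous_attains_sup[of "sphere (0::real^'n) 1" "\<lambda>x. (T *v x) \<bullet> (T *v x)"]
    by (auto simp: dist_norm)
  define \<mu> where "\<mu> = (T *v v) \<bullet> (T *v v)"
  have bound: "(T *v y) \<bullet> (T *v y) \<le> \<mu> * (y \<bullet> y)" for y
  proof (cases "y = 0")
    case False
    define u where "u = y /\<^sub>R norm y"
    have u: "norm u = 1" "y = norm y *\<^sub>R u" using False by (auto simp: u_def)
    have "(T *v y) \<bullet> (T *v y) = (norm y)\<^sup>2 * ((T *v u) \<bullet> (T *v u))"
      by (subst (1 2) u(2)) (simp add: matrix_vector_mult_scaleR power2_eq_square)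
    also have "\<dots> \<le> (norm y)\<^sup>2 * \<mu>" unfolding \<mu>_def by (intro mult_left_mono max u) auto
    finally show ?thesis by (simp add: power2_norm_eq_inner mult.commute)
  qed auto
  define S where "S = (\<lambda>x. \<mu> *\<^sub>R x - (transpose T ** T) *v x)"
  have TT: "x \<bullet> ((transpose T ** T) *v y) = (T *v x) \<bullet> (T *v y)" for x y
    by (metis dot_lmul_matrix matrix_vector_mul_assoc transpose_matrix_vector transpose_transpose)
  have linS: "S (x + c *\<^sub>R y) = S x + c *\<^sub>R S y" for x y c
    by (simp add: S_def algebra_simps matrix_vector_right_distrib matrix_vector_mult_scaleR scaleR_diff_right)
  have symS: "x \<bullet> S y = y \<bullet> S x" for x y
    by (simp add: S_def inner_diff_right TT inner_commute)
  have nn: "0 \<le> x \<bullet> S x" for x using bound[of x] by (simp add: S_def inner_diff_right TT)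
  have v0: "v \<bullet> S v = 0"
    using v by (simp add: S_def inner_diff_right TT \<mu>_def[symmetric]) (simp add: norm_eq_1)
  have "S v = 0"
  proof (rule ccontr)
    assume *: "S v \<noteq> 0"
    define w where "w = S v"
    define b where "b = w \<bullet> S w"
    have "0 \<le> (v + t *\<^sub>R w) \<bullet> S (v + t *\<^sub>R w)" for t by (rule nn)
    also have "(v + t *\<^sub>R w) \<bullet> S (v + t *\<^sub>R w) = 2 * t * (w \<bullet> w) + t\<^sup>2 * b" for t
      using symS[of v w] v0
      by (simp add: linS inner_add_left inner_add_right b_def power2_eq_square w_def algebra_simps)
    finally have q: "0 \<le> 2 * t * (w \<bullet> w) + t\<^sup>2 * b" for t .
    have w: "w \<bullet> w > 0" using * by (simp add: w_def)
    have b: "b \<ge> 0" unfolding b_def by (rule nn)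
    \<comment> \<open>The quadratic is least at -|w|^2 / b; the added 1 guards against b = 0 and
      still leaves the value at \<open>t\<close> negative.\<close>
    define t where "t = - (w \<bullet> w) / (b + 1)"
    have "t * (b + 1) = - (w \<bullet> w)" using b by (simp add: t_def)
    then have "2 * t * (w \<bullet> w) + t\<^sup>2 * b = t * (w \<bullet> w) - t\<^sup>2"
      by algebra
    also have "t < 0" using w b by (simp add: t_def divide_neg_pos)
    then have "t * (w \<bullet> w) - t\<^sup>2 < 0" using w by (smt (verit) mult_neg_pos zero_le_power2)
    finally show False using q[of t] by simp
  qed
  then have ev: "(transpose T ** T) *v v = \<mu> *\<^sub>R v" by (simp add: S_def)
  have "\<mu> > 0"
  proof (rule ccontr)
    assume "\<not> \<mu> > 0"
    then have "\<mu> = 0" by (simp add: \<mu>_def order.antisym)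
    then have "T *v y = 0" for y
      using bound[of y] by (metis inner_gt_zero_iff mult_zero_left not_less)
    then have "T = 0" by (metis matrix_eq matrix_vector_mult_0)
    then show False using assms by simp
  qed
  moreover have "v \<noteq> 0" using v by auto
  ultimately show ?thesis using that ev by blast
qed

lemma subspace_projection_matrix:
  fixes W :: "(real^'n) set"
  assumes "subspace W"
  obtains Q where "orthogonal_proj_matrix Q" "\<And>x. x \<in> W \<Longrightarrow> Q *v x = x" "\<And>x. Q *v x \<in> W"
    "trace Q = dim W"
proof -
  obtain B where B: "B \<subseteq> W" "pairwise orthogonal B" "\<And>x. x \<in> B \<Longrightarrow> norm x = 1"
      "independent B" "card B = dim W" "span B = W"
    using orthonormal_basis_subspace[OF assms] by metis
  have fin: "finite B" using B(4) independent_imp_finite by blast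
  define Q :: "real^'n^'n" where "Q = (\<chi> i j. \<Sum>b\<in>B. b$i * b$j)"
  have Qv: "Q *v x = (\<Sum>b\<in>B. (b \<bullet> x) *\<^sub>R b)" for x
    unfolding Q_def matrix_vector_mult_def
    by (simp add: vec_eq_iff inner_vec_def sum_distrib_left sum_distrib_right
        sum.swap[of _ B] mult_ac)
  have inW: "Q *v x \<in> W" for x
    unfolding Qv using B(1) assms by (intro subspace_sum subspace_scale) auto
  have "Q *v b = b" if "b \<in> B" for b
  proof -
    have "(\<Sum>c\<in>B. (c \<bullet> b) *\<^sub>R c) = (\<Sum>c\<in>B. if c = b then b else 0)"
      using B(2,3) that by (intro sum.cong) (auto simp: pairwise_def orthogonal_def norm_eq_1)
    then show ?thesis using that fin by (simp add: Qv)
  qed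
  then have fixQ: "Q *v x = x" if "x \<in> W" for x
    using linear_eq_on[of "(*v) Q" "\<lambda>x. x" x B] that B(6) by (auto simp: linear_id[unfolded id_def])
  have "Q ** Q = Q" by (metis fixQ inW matrix_eq matrix_vector_mul_assoc)
  moreover have "transpose Q = Q" by (simp add: transpose_def Q_def vec_eq_iff mult.commute)
  moreover have "trace Q = dim W"
  proof -
    have "trace Q = (\<Sum>b\<in>B. b \<bullet> b)"
      by (simp add: trace_def Q_def inner_vec_def sum.swap[of _ B])
    also have "\<dots> = card B" using B(3) by (simp add: norm_eq_1)
    finally show ?thesis using B(5) by simp
  qed
  ultimately show ?thesis using that fixQ inW by (simp add: orthogonal_proj_matrix_def)
qed

text \<open>Invariance of \<open>W\<close> under \<open>g\<close> gives Q g Q = g Q; invariance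
  under the transpose, transposed, gives Q g Q = Q g.\<close>

lemma orthogonal_proj_matrix_commute:
  fixes W :: "(real^'n) set"
  assumes Q: "orthogonal_proj_matrix Q" "\<And>x. x \<in> W \<Longrightarrow> Q *v x = x" "\<And>x. Q *v x \<in> W"
    and g: "\<And>x. x \<in> W \<Longrightarrow> g *v x \<in> W" "\<And>x. x \<in> W \<Longrightarrow> transpose g *v x \<in> W"
  shows "Q ** g = g ** Q"
proof -
  have *: "Q ** h ** Q = h ** Q" if "\<And>x. x \<in> W \<Longrightarrow> h *v x \<in> W" for h
    using that Q(2,3) by (simp add: matrix_eq flip: matrix_vector_mul_assoc)
  have "transpose (Q ** transpose g ** Q) = transpose (transpose g ** Q)"
    using * g(2) by simp
  then have "Q ** g ** Q = Q ** g"
    using Q(1) by (simp add: orthogonal_proj_matrix_def matrix_transpose_mul matrix_mul_assoc)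
  then show ?thesis using *[of g] g(1) by simp
qed

text \<open>Positivity in the first orthogonality relation: the (i, j) entries of the averages of
  the matrix units \<open>E i j\<close> add up to the sum of the squares of
  \<open>trace (P ** g)\<close>, whose term at the identity is positive. So one of the averages is
  nonzero.\<close>

lemma trace_projection_average:
  fixes P P' :: "real^'n^'n"
  assumes P: "orthogonal_proj_matrix P" and P': "orthogonal_proj_matrix P'"
    and fin: "finite \<Gamma>" and one: "mat 1 \<in> \<Gamma>"
    and com: "\<And>g. g \<in> \<Gamma> \<Longrightarrow> P ** g = g ** P"
    and tr: "\<And>g. g \<in> \<Gamma> \<Longrightarrow> trace (P ** g) = trace (P' ** \<phi> g)"
    and ne: "trace P \<noteq> 0"
  obtains E where "(\<Sum>g\<in>\<Gamma>. P' ** \<phi> g ** E ** transpose g ** P) \<noteq> 0"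
proof -
  define E :: "'n \<Rightarrow> 'n \<Rightarrow> real^'n^'n" where "E i j = (\<chi> k l. if k = i \<and> l = j then 1 else 0)" for i j
  have entry: "(A ** E i j ** B)$i$j = A$i$i * B$j$j" for A B :: "real^'n^'n" and i j
  proof -
    have "(A ** E i j)$k$l = (if l = j then A$k$i else 0)" for k l
      by (simp add: matrix_matrix_mult_def E_def if_distrib[of "\<lambda>x. _ * x"] sum.delta cong: if_cong)
    then show ?thesis
      by (simp add: matrix_matrix_mult_def[of "A ** E i j"] if_distrib[of "\<lambda>x. x * _"] sum.delta cong: if_cong)
  qed
  have trg: "trace (transpose g ** P) = trace (P ** g)" if "g \<in> \<Gamma>" for g
    using P trace_transpose[of "transpose g ** P"]
    by (simp add: orthogonal_proj_matrix_def matrix_transpose_mul)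
  have "(\<Sum>i\<in>UNIV. \<Sum>j\<in>UNIV. (\<Sum>g\<in>\<Gamma>. P' ** \<phi> g ** E i j ** transpose g ** P)$i$j)
      = (\<Sum>g\<in>\<Gamma>. trace (P' ** \<phi> g) * trace (transpose g ** P))"
    using entry[of "P' ** \<phi> _" _ _ "transpose _ ** P"]
    by (simp add: trace_def sum_product matrix_mul_assoc sum.swap[of _ \<Gamma>])
  also have "\<dots> = (\<Sum>g\<in>\<Gamma>. (trace (P ** g))\<^sup>2)"
    using tr trg by (intro sum.cong) (auto simp: power2_eq_square)
  also have "\<dots> \<ge> (trace (P ** mat 1))\<^sup>2"
    using fin one by (intro member_le_sum) auto
  finally have "(\<Sum>i\<in>UNIV. \<Sum>j\<in>UNIV. (\<Sum>g\<in>\<Gamma>. P' ** \<phi> g ** E i j ** transpose g ** P)$i$j) > 0"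
    using ne by (smt (verit) matrix_mul_rid zero_less_power2)
  then obtain i j where "(\<Sum>g\<in>\<Gamma>. P' ** \<phi> g ** E i j ** transpose g ** P) \<noteq> 0"
    by (metis (mono_tags, lifting) less_irrefl sum.neutral zero_index)
  then show ?thesis using that by blast
qed

text \<open>Splitting off the top eigenspace of \<open>T\<^sup>T T\<close> for an averaged intertwiner \<open>T \<noteq> 0\<close> and
  inducting on the remaining orthogonal complement avoids both Schur's lemma and the
  classification of irreducible representations.\<close>

lemma equal_characters_partial_isometry:
  fixes P P' :: "real^'n^'n"
  assumes fin: "finite \<Gamma>" and one: "mat 1 \<in> \<Gamma>"
    and orth: "\<And>g. g \<in> \<Gamma> \<Longrightarrow> orthogonal_matrix g" "\<And>g. g \<in> \<Gamma> \<Longrightarrow> orthogonal_matrix (\<phi> g)"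
    and clos: "\<And>g h. g \<in> \<Gamma> \<Longrightarrow> h \<in> \<Gamma> \<Longrightarrow> g ** h \<in> \<Gamma>" "\<And>g. g \<in> \<Gamma> \<Longrightarrow> transpose g \<in> \<Gamma>"
    and hom: "\<And>g h. g \<in> \<Gamma> \<Longrightarrow> h \<in> \<Gamma> \<Longrightarrow> \<phi> (g ** h) = \<phi> g ** \<phi> h"
    and P: "orthogonal_proj_matrix P" "\<And>g. g \<in> \<Gamma> \<Longrightarrow> P ** g = g ** P"
    and P': "orthogonal_proj_matrix P'" "\<And>g. g \<in> \<Gamma> \<Longrightarrow> P' ** \<phi> g = \<phi> g ** P'"
    and tr: "\<And>g. g \<in> \<Gamma> \<Longrightarrow> trace (P ** g) = trace (P' ** \<phi> g)"
  shows "\<exists>U. transpose U ** U = P \<and> U ** transpose U = P' \<and> U ** P = U \<and> P' ** U = U \<and>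
    (\<forall>g\<in>\<Gamma>. U ** g = \<phi> g ** U)"
proof -
  have gg: "transpose g ** g = mat 1" "g ** transpose g = mat 1" if "g \<in> \<Gamma>" for g
    using orth(1)[OF that] by (auto simp: orthogonal_matrix_def)
  have phi1: "\<phi> (mat 1) = mat 1"
  proof -
    have "\<phi> (mat 1) ** \<phi> (mat 1) = \<phi> (mat 1)" using hom[OF one one] by simp
    then have "transpose (\<phi> (mat 1)) ** (\<phi> (mat 1) ** \<phi> (mat 1)) = transpose (\<phi> (mat 1)) ** \<phi> (mat 1)"
      by simp
    then show ?thesis using orth(2)[OF one] by (simp add: orthogonal_matrix_def matrix_mul_assoc)
  qed
  have phit: "\<phi> (transpose g) = transpose (\<phi> g)" if "g \<in> \<Gamma>" for g
  proof -
    have "\<phi> (transpose g) ** \<phi> g = mat 1"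
      using hom[OF clos(2)[OF that] that] gg[OF that] phi1 by simp
    then have "\<phi> (transpose g) ** \<phi> g ** transpose (\<phi> g) = transpose (\<phi> g)" by simp
    then show ?thesis using orth(2)[OF that] by (simp add: orthogonal_matrix_def flip: matrix_mul_assoc)
  qed
  \<comment> \<open>\<open>trace P\<close> is the rank. Bounding it by a natural number gives an
    induction in which every eigenspace split off lowers the bound by at least one.\<close>
  have "trace P \<le> real N \<Longrightarrow> ?thesis" for N
    using P P' tr
  proof (induction N arbitrary: P P')
    case 0
    have "trace P = 0" using 0 trace_proj[of P] trace_transpose_mult_self_nonneg[of P] by simp
    moreover have "trace P' = 0" using 0(6)[OF one] phi1 \<open>trace P = 0\<close> by simp
    ultimately have "P = 0" "P' = 0"
      using 0(2,4) trace_proj trace_transpose_mult_self_eq_0 by metis+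
    then show ?case by (intro exI[of _ 0]) (simp add: transpose_def matrix_matrix_mult_def zero_vec_def)
  next
    case (Suc N)
    note P = Suc.prems(2,3) and P' = Suc.prems(4,5) and tr = Suc.prems(6)
    have PP: "transpose P = P" "P ** P = P" "transpose P' = P'" "P' ** P' = P'"
      using P P' by (auto simp: orthogonal_proj_matrix_def)
    show ?case
    proof (cases "trace P = 0")
      case True
      then show ?thesis using Suc.IH[of P P'] Suc.prems by simp
    next
      case False
      then obtain E where E: "(\<Sum>g\<in>\<Gamma>. P' ** \<phi> g ** E ** transpose g ** P) \<noteq> 0"
        using trace_projection_average[OF P(1) P'(1) fin one P(2) tr] by blast
      define T where "T = (\<Sum>g\<in>\<Gamma>. P' ** \<phi> g ** E ** transpose g ** P)"
      have TP: "T ** P = T" "P' ** T = T"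
        unfolding T_def matrix_mult_sum_left matrix_mult_sum_right
        by (auto intro!: sum.cong simp: matrix_mul_assoc PP) (simp add: PP flip: matrix_mul_assoc)
      have Tg: "T ** h = \<phi> h ** T" if h: "h \<in> \<Gamma>" for h
      proof -
        have "T ** h = (\<Sum>g\<in>\<Gamma>. P' ** \<phi> g ** E ** transpose (transpose h ** g) ** P)"
          unfolding T_def matrix_mult_sum_left
          by (intro sum.cong) (auto simp: matrix_transpose_mul P(2)[OF h] simp flip: matrix_mul_assoc)
        also have "\<dots> = (\<Sum>g\<in>\<Gamma>. P' ** \<phi> (h ** g) ** E ** transpose g ** P)"
          by (rule sum.reindex_bij_witness[of _ "\<lambda>g. h ** g" "\<lambda>g. transpose h ** g"])
            (auto simp: clos h matrix_mul_assoc gg)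
        also have "\<dots> = \<phi> h ** T"
          unfolding T_def matrix_mult_sum_right
          by (intro sum.cong) (auto simp: hom h matrix_mul_assoc simp flip: P'(2)[OF h])
        finally show ?thesis .
      qed
      define S where "S = transpose T ** T"
      have ST: "transpose S = S" by (simp add: S_def matrix_transpose_mul)
      have Sg: "S ** h = h ** S" if h: "h \<in> \<Gamma>" for h
      proof -
        have "transpose (T ** transpose h) = transpose (\<phi> (transpose h) ** T)"
          using Tg[OF clos(2)[OF h]] by simp
        then have *: "h ** transpose T = transpose T ** \<phi> h"
          by (simp add: matrix_transpose_mul phit h)
        have "S ** h = transpose T ** \<phi> h ** T"
          by (simp add: S_def Tg h flip: matrix_mul_assoc)
        then show ?thesis by (simp add: S_def matrix_mul_assoc flip: *)
      qed
      have "T \<noteq> 0" using E by (simp add: T_def)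
      then obtain \<mu> v where \<mu>: "\<mu> > 0" "v \<noteq> 0" "S *v v = \<mu> *\<^sub>R v"
        using gram_matrix_eigenvector unfolding S_def by metis
      define W where "W = {x. S *v x = \<mu> *\<^sub>R x}"
      have "subspace W"
        by (auto simp: W_def subspace_def matrix_vector_right_distrib matrix_vector_mult_scaleR
            scaleR_add_right)
      from subspace_projection_matrix[OF this] obtain Q where Q: "orthogonal_proj_matrix Q" "\<And>x. x \<in> W \<Longrightarrow> Q *v x = x"
        "\<And>x. Q *v x \<in> W" "trace Q = dim W"
        by metis
      have QQ: "transpose Q = Q" "Q ** Q = Q" using Q(1) by (auto simp: orthogonal_proj_matrix_def)
      have SQ: "S ** Q = \<mu> *\<^sub>R Q"
        using Q(3) by (simp add: W_def matrix_eq scaleR_matrix_vector_assoc flip: matrix_vector_mul_assoc)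
      have Wg: "g *v x \<in> W" if "g \<in> \<Gamma>" "x \<in> W" for g x
        using that Sg[of g] by (simp add: W_def matrix_vector_mul_assoc matrix_vector_mult_scaleR)
          (metis matrix_vector_mul_assoc matrix_vector_mult_scaleR)
      have Qg: "Q ** g = g ** Q" if "g \<in> \<Gamma>" for g
        using orthogonal_proj_matrix_commute[OF Q(1-3)] Wg that clos(2) by blast
      have "v \<in> W" using \<mu> by (simp add: W_def)
      then have "dim W \<noteq> 0" using \<mu>(2) by (auto simp: dim_eq_0)
      then have "1 \<le> dim W" by linarith
      then have trQ: "trace Q \<ge> 1" using Q(4) by linarith
      have PQ: "P ** Q = Q"
      proof -
        have "P ** S = S" by (metis S_def TP(1) PP(1) matrix_mul_assoc matrix_transpose_mul)
        then have "P ** (S ** Q) = S ** Q" by (simp add: matrix_mul_assoc)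
        then show ?thesis using \<mu>(1) by (simp add: SQ scaleR_matrix_mult)
      qed
      have QP: "Q ** P = Q" using arg_cong[OF PQ, of transpose] by (simp add: matrix_transpose_mul PP QQ)
      \<comment> \<open>On \<open>W\<close> the matrix \<open>T\<close> multiplies lengths by the
        square root of \<open>\<mu>\<close>, so after rescaling it is an isometry there.\<close>
      define U where "U = (1 / sqrt \<mu>) *\<^sub>R (T ** Q)"
      have tU: "transpose U = (1 / sqrt \<mu>) *\<^sub>R (Q ** transpose T)"
        by (simp add: U_def transpose_scaleR matrix_transpose_mul QQ)
      have UU: "transpose U ** U = Q"
      proof -
        have "transpose U ** U = (1 / sqrt \<mu> * (1 / sqrt \<mu>)) *\<^sub>R (Q ** (S ** Q))"
          unfolding tU unfolding U_def S_def by (simp add: scaleR_matrix_mult matrix_mul_assoc)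
        also have "\<dots> = (1 / sqrt \<mu> * (1 / sqrt \<mu>) * \<mu>) *\<^sub>R Q"
          unfolding SQ by (simp add: scaleR_matrix_mult QQ)
        finally show ?thesis using \<mu>(1) by simp
      qed
      have UQ: "U ** Q = U"
        unfolding U_def by (simp add: QQ scaleR_matrix_mult flip: matrix_mul_assoc)
      have P'U: "P' ** U = U"
        unfolding U_def by (simp add: TP scaleR_matrix_mult matrix_mul_assoc)
      have Ug: "U ** g = \<phi> g ** U" if "g \<in> \<Gamma>" for g
        unfolding U_def scaleR_matrix_mult by (metis Qg Tg matrix_mul_assoc that)
      define Q' where "Q' = U ** transpose U"
      have Q': "orthogonal_proj_matrix Q'"
        by (simp add: orthogonal_proj_matrix_def Q'_def matrix_transpose_mul matrix_mul_assoc)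
          (metis UQ UU matrix_mul_assoc)
      have Q'U: "Q' ** U = U" by (metis Q'_def UQ UU matrix_mul_assoc)
      have Q'g: "Q' ** \<phi> g = \<phi> g ** Q'" if g: "g \<in> \<Gamma>" for g
      proof -
        have "transpose (U ** transpose g) = transpose (\<phi> (transpose g) ** U)"
          using Ug[OF clos(2)[OF g]] by simp
        then have "g ** transpose U = transpose U ** \<phi> g"
          by (simp add: matrix_transpose_mul phit g)
        then show ?thesis unfolding Q'_def by (metis Ug g matrix_mul_assoc)
      qed
      have P'Q': "P' ** Q' = Q'" by (simp add: Q'_def matrix_mul_assoc P'U)
      have Q'P': "Q' ** P' = Q'"
        using arg_cong[OF P'Q', of transpose] Q' by (simp add: matrix_transpose_mul PP orthogonal_proj_matrix_def)
      have Q'Q': "transpose Q' = Q'" "Q' ** Q' = Q'" using Q' by (auto simp: orthogonal_proj_matrix_def)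
      \<comment> \<open>Equality of characters passes to the complements: by cyclicity both sides
        are the trace of U^T (\<phi> g) U.\<close>
      have trQ': "trace (Q ** g) = trace (Q' ** \<phi> g)" if g: "g \<in> \<Gamma>" for g
      proof -
        have "trace (Q' ** \<phi> g) = trace (transpose U ** (\<phi> g ** U))"
          unfolding Q'_def by (metis matrix_mul_assoc trace_mul_sym)
        also have "\<dots> = trace (Q ** g)" by (metis Ug g UU matrix_mul_assoc)
        finally show ?thesis by simp
      qed
      have "\<exists>V. transpose V ** V = P - Q \<and> V ** transpose V = P' - Q' \<and> V ** (P - Q) = V \<and>
        (P' - Q') ** V = V \<and> (\<forall>g\<in>\<Gamma>. V ** g = \<phi> g ** V)"
      proof (rule Suc.IH)
        show "trace (P - Q) \<le> real N" using Suc.prems(1) trQ by (simp add: trace_sub)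
        show "orthogonal_proj_matrix (P - Q)" "orthogonal_proj_matrix (P' - Q')"
          by (auto simp: orthogonal_proj_matrix_def transpose_diff PP QQ PQ QP P'Q' Q'P' Q'Q'
              matrix_mult_diff_left matrix_mult_diff_right)
        show "trace ((P - Q) ** g) = trace ((P' - Q') ** \<phi> g)" if "g \<in> \<Gamma>" for g
          using that by (simp add: matrix_mult_diff_left trace_sub tr trQ')
      qed (auto simp: matrix_mult_diff_left matrix_mult_diff_right P P' Qg Q'g)
      then obtain V where V: "transpose V ** V = P - Q" "V ** transpose V = P' - Q'" "V ** (P - Q) = V"
        "(P' - Q') ** V = V" "\<And>g. g \<in> \<Gamma> \<Longrightarrow> V ** g = \<phi> g ** V"
        by blast
      have orth1: "transpose U ** V = 0"
      proof -
        have "transpose U ** Q' = transpose U" using arg_cong[OF Q'U, of transpose] 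
          by (simp add: matrix_transpose_mul Q'Q')
        then have "transpose U ** V = transpose U ** Q' ** ((P' - Q') ** V)" by (simp add: V(4))
        also have "\<dots> = transpose U ** (Q' ** (P' - Q')) ** V" by (simp add: matrix_mul_assoc)
        also have "Q' ** (P' - Q') = 0" by (simp add: matrix_mult_diff_right Q'P' Q'Q')
        finally show ?thesis by (simp add: matrix_matrix_mult_def vec_eq_iff)
      qed
      have orth2: "U ** transpose V = 0"
      proof -
        have "(P - Q) ** transpose V = transpose V" using arg_cong[OF V(3), of transpose]
          by (simp add: matrix_transpose_mul transpose_diff PP QQ)
        then have "U ** transpose V = U ** Q ** ((P - Q) ** transpose V)" by (simp add: UQ)
        also have "\<dots> = U ** (Q ** (P - Q)) ** transpose V" by (simp add: matrix_mul_assoc)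
        also have "Q ** (P - Q) = 0" by (simp add: matrix_mult_diff_right QP QQ)
        finally show ?thesis by (simp add: matrix_matrix_mult_def vec_eq_iff)
      qed
      have orth3: "transpose V ** U = 0" "V ** transpose U = 0"
        using arg_cong[OF orth1, of transpose] arg_cong[OF orth2, of transpose]
        by (simp_all add: matrix_transpose_mul) (simp_all add: transpose_def vec_eq_iff)
      have VP: "V ** P = V" "P' ** V = V"
      proof -
        have "(P - Q) ** P = P - Q" by (simp add: matrix_mult_diff_left PP QP)
        then show "V ** P = V" by (metis V(3) matrix_mul_assoc)
        have "P' ** (P' - Q') = P' - Q'" by (simp add: matrix_mult_diff_right PP P'Q')
        then show "P' ** V = V" by (metis V(4) matrix_mul_assoc)
      qed
      show ?thesis
      proof (intro exI[of _ "U + V"] conjI ballI)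
        show "transpose (U + V) ** (U + V) = P"
          by (simp add: transpose_add matrix_add_ldistrib matrix_add_rdistrib UU V orth1 orth3)
        show "(U + V) ** transpose (U + V) = P'"
          by (simp add: transpose_add matrix_add_ldistrib matrix_add_rdistrib V orth2 orth3 flip: Q'_def)
        show "(U + V) ** P = U + V"
          by (simp add: matrix_add_rdistrib VP) (metis UQ QP matrix_mul_assoc)
        show "P' ** (U + V) = U + V"
          by (simp add: matrix_add_ldistrib VP P'U)
        show "(U + V) ** g = \<phi> g ** (U + V)" if "g \<in> \<Gamma>" for g
          using that by (simp add: matrix_add_ldistrib matrix_add_rdistrib V Ug)
      qed
    qed
  qed
  then show ?thesis using real_arch_simple by blast
qed

section \<open>From equal characters to conjugacy and isometry\<close>

definition character_isomorphic :: "(real^'n^'n) set \<Rightarrow> (real^'n^'n) set \<Rightarrow> bool" where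
  "character_isomorphic \<Gamma> \<Gamma>' \<longleftrightarrow> (\<exists>\<phi>. \<phi> ` \<Gamma> = \<Gamma>' \<and>
     (\<forall>g\<in>\<Gamma>. \<forall>h\<in>\<Gamma>. \<phi> (g ** h) = \<phi> g ** \<phi> h) \<and> (\<forall>g\<in>\<Gamma>. trace (\<phi> g) = trace g))"

lemma carrier_orthogonal_group: "A \<in> carrier orthogonal_group \<longleftrightarrow> orthogonal_matrix A"
  by (simp add: orthogonal_group_def)

lemma mult_orthogonal_group: "A \<otimes>\<^bsub>orthogonal_group\<^esub> B = A ** B"
  by (simp add: orthogonal_group_def)

lemma one_orthogonal_group: "\<one>\<^bsub>orthogonal_group\<^esub> = mat 1"
  by (simp add: orthogonal_group_def)

lemma inv_orthogonal_group:
  assumes "orthogonal_matrix A"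
  shows "inv\<^bsub>orthogonal_group\<^esub> A = transpose A"
proof -
  interpret group "orthogonal_group :: (real^'n^'n) monoid" by (rule group_orthogonal_group)
  show ?thesis
    using assms by (intro inv_equality)
      (auto simp: orthogonal_group_def orthogonal_matrix_def)
qed

text \<open>With both projections equal to \<open>mat 1\<close> the partial isometry is an
  orthogonal matrix, and the intertwining relation becomes U g U^T = \<phi> g.\<close>

lemma character_isomorphic_imp_conjugate:
  fixes \<Gamma> \<Gamma>' :: "(real^'n^'n) set"
  assumes "subgroup \<Gamma> orthogonal_group" "subgroup \<Gamma>' orthogonal_group" "finite \<Gamma>"
    and "character_isomorphic \<Gamma> \<Gamma>'"
  shows "conjugate_in_orthogonal_group \<Gamma> \<Gamma>'"
proof -
  interpret G: subgroup \<Gamma> orthogonal_group by fact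
  interpret G': subgroup \<Gamma>' orthogonal_group by fact
  obtain \<phi> where \<phi>: "\<phi> ` \<Gamma> = \<Gamma>'" "\<And>g h. g \<in> \<Gamma> \<Longrightarrow> h \<in> \<Gamma> \<Longrightarrow> \<phi> (g ** h) = \<phi> g ** \<phi> h"
    "\<And>g. g \<in> \<Gamma> \<Longrightarrow> trace (\<phi> g) = trace g"
    using assms(4) unfolding character_isomorphic_def by blast
  have orth: "orthogonal_matrix g" if "g \<in> \<Gamma>" for g
    using G.subset that by (auto simp: orthogonal_group_def)
  have orth': "orthogonal_matrix (\<phi> g)" if "g \<in> \<Gamma>" for g
    using G'.subset \<phi>(1) that by (auto simp: orthogonal_group_def)
  have "\<exists>U. transpose U ** U = mat 1 \<and> U ** transpose U = mat 1 \<and> U ** mat 1 = U \<and> mat 1 ** U = U \<and>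
    (\<forall>g\<in>\<Gamma>. U ** g = \<phi> g ** U)"
  proof (rule equal_characters_partial_isometry[OF assms(3)])
    show "mat 1 \<in> \<Gamma>" using G.one_closed by (simp add: one_orthogonal_group)
    show "g ** h \<in> \<Gamma>" if "g \<in> \<Gamma>" "h \<in> \<Gamma>" for g h
      using G.m_closed[OF that] by (simp add: mult_orthogonal_group)
    show "transpose g \<in> \<Gamma>" if "g \<in> \<Gamma>" for g
      using G.m_inv_closed[OF that] orth[OF that] by (simp add: inv_orthogonal_group)
    show "orthogonal_proj_matrix (mat 1)" "orthogonal_proj_matrix (mat 1)"
      by (simp_all add: orthogonal_proj_matrix_def)
  qed (auto simp: \<phi> orth orth')
  then obtain U where U: "transpose U ** U = mat 1" "U ** transpose U = mat 1"
    "\<And>g. g \<in> \<Gamma> \<Longrightarrow> U ** g = \<phi> g ** U" by blast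
  have oU: "orthogonal_matrix U" using U by (simp add: orthogonal_matrix_def)
  have "U ** g ** transpose U = \<phi> g" if "g \<in> \<Gamma>" for g
    using U(2,3) that by (metis matrix_mul_assoc matrix_mul_rid)
  then have "\<Gamma>' = (\<lambda>g. U ** g ** transpose U) ` \<Gamma>" using \<phi>(1) by (metis (no_types, lifting) image_cong)
  then show ?thesis
    unfolding conjugate_in_orthogonal_group_def
    using oU by (intro bexI[of _ U]) (auto simp: carrier_orthogonal_group mult_orthogonal_group inv_orthogonal_group)
qed

lemma conjugate_imp_isometric:
  fixes \<Gamma> \<Gamma>' :: "(real^'n^'n) set"
  assumes "conjugate_in_orthogonal_group \<Gamma> \<Gamma>'"
  shows "isometric_orbifolds \<Gamma> \<Gamma>'"
proof -
  obtain a where oa: "orthogonal_matrix a" and \<Gamma>': "\<Gamma>' = (\<lambda>g. a ** g ** transpose a) ` \<Gamma>"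
    using assms unfolding conjugate_in_orthogonal_group_def
    by (auto simp: carrier_orthogonal_group mult_orthogonal_group inv_orthogonal_group cong: image_cong)
  have aa: "transpose a ** a = mat 1" "a ** transpose a = mat 1"
    using oa by (auto simp: orthogonal_matrix_def)
  have aa': "transpose a *v (a *v x) = x" "a *v (transpose a *v x) = x" for x
    by (simp_all add: matrix_vector_mul_assoc aa del: transpose_matrix_vector)
  have inner: "(a *v x) \<bullet> (a *v y) = x \<bullet> y" for x y
    using orthogonal_transformation_matrix[of "(*v) a"] oa by (simp add: orthogonal_transformation_def)
  have norm: "norm (a *v x) = norm x" for x by (simp add: norm_eq_sqrt_inner inner)
  have normt: "norm (transpose a *v x) = norm x" for x
    using norm[of "transpose a *v x"] by (simp add: aa' del: transpose_matrix_vector)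
  have orbit: "orbit_of \<Gamma>' (a *v x) = (*v) a ` orbit_of \<Gamma> x" for x
  proof -
    have "a ** g ** transpose a *v (a *v x) = a *v (g *v x)" for g
      by (simp add: aa' del: transpose_matrix_vector flip: matrix_vector_mul_assoc)
    then show ?thesis unfolding orbit_of_def \<Gamma>' image_image by (rule image_cong[OF refl])
  qed
  have inj: "inj ((*v) a)" by (metis aa'(1) injI)
  have "orbifold_isometry \<Gamma> \<Gamma>' ((`) ((*v) a))"
    unfolding orbifold_isometry_def
  proof (intro conjI ballI)
    have "(`) ((*v) a) ` spherical_orbifold \<Gamma> = spherical_orbifold \<Gamma>'"
    proof -
      have "(*v) a ` sphere 0 1 = sphere (0::real^'n) 1"
      proof
        show "sphere 0 1 \<subseteq> (*v) a ` sphere 0 1"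
          using aa'(2) normt by (metis image_eqI mem_sphere_0 subsetI)
      qed (auto simp: norm)
      then have "spherical_orbifold \<Gamma>' = (\<lambda>x. orbit_of \<Gamma>' (a *v x)) ` sphere 0 1"
        unfolding spherical_orbifold_def by (metis image_image)
      then show ?thesis by (simp add: orbit spherical_orbifold_def image_image)
    qed
    moreover have "inj_on ((`) ((*v) a)) (spherical_orbifold \<Gamma>)"
      using inj by (auto intro: inj_onI simp: inj_image_eq_iff)
    ultimately show "bij_betw ((`) ((*v) a)) (spherical_orbifold \<Gamma>) (spherical_orbifold \<Gamma>')"
      by (simp add: bij_betw_def)
    show "orbit_dist ((*v) a ` X) ((*v) a ` Y) = orbit_dist X Y" for X Y
    proof -
      have *: "{sphere_dist x y |x y. x \<in> A \<and> y \<in> B} = (\<lambda>(x, y). sphere_dist x y) ` (A \<times> B)"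
        for A B :: "(real^'n) set"
        by auto
      have "(*v) a ` X \<times> (*v) a ` Y = (\<lambda>(x, y). (a *v x, a *v y)) ` (X \<times> Y)"
        by auto
      then have "{sphere_dist x y |x y. x \<in> (*v) a ` X \<and> y \<in> (*v) a ` Y}
          = {sphere_dist x y |x y. x \<in> X \<and> y \<in> Y}"
        unfolding * by (simp add: image_image sphere_dist_def inner case_prod_beta)
      then show ?thesis by (simp add: orbit_dist_def)
    qed
    show "\<exists>U f. openin (top_of_set (sphere 0 1)) U \<and> x \<in> U \<and> f ` U \<subseteq> sphere 0 1 \<and>
       (\<forall>u\<in>U. \<forall>v\<in>U. sphere_dist (f u) (f v) = sphere_dist u v) \<and>
       (\<forall>u\<in>U. (*v) a ` orbit_of \<Gamma> u = orbit_of \<Gamma>' (f u))" if "x \<in> sphere 0 1" for x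
      \<comment> \<open>The isometry lifts to the whole sphere, which serves as the chart at every
        point.\<close>
      using that by (intro exI[of _ "sphere 0 1"] exI[of _ "(*v) a"])
        (auto simp: norm sphere_dist_def inner orbit)
  qed
  then show ?thesis by (auto simp: isometric_orbifolds_def)
qed

section \<open>Smooth functions and the Laplacian\<close>

abbreviation pd :: "'n \<Rightarrow> (real^'n \<Rightarrow> complex) \<Rightarrow> real^'n \<Rightarrow> complex" where
  "pd i \<equiv> partial_deriv (axis i 1)"

definition smooth_on :: "(real^'n) set \<Rightarrow> (real^'n \<Rightarrow> complex) \<Rightarrow> bool" where
  "smooth_on U F \<longleftrightarrow> (\<forall>k. C_k_on k U F)"

lemma ball_Basis_vec: "(\<forall>b\<in>(Basis :: (real^'n) set). P b) \<longleftrightarrow> (\<forall>i. P (axis i 1))"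
  by (auto simp: Basis_vec_def)

lemma sum_Basis_vec: "(\<Sum>b\<in>(Basis :: (real^'n) set). f b) = (\<Sum>i\<in>UNIV. f (axis i 1))"
proof -
  have "(Basis :: (real^'n) set) = range (\<lambda>i. axis i 1)" by (auto simp: Basis_vec_def)
  moreover have "inj (\<lambda>i::'n. axis i (1::real))" by (auto intro!: injI simp: axis_eq_axis)
  ultimately show ?thesis by (intro sum.reindex_cong) auto
qed

lemma laplacian_vec: "laplacian F x = (\<Sum>i\<in>UNIV. pd i (pd i F) x)" for F :: "real^'n \<Rightarrow> complex"
  by (simp add: laplacian_def sum_Basis_vec)

lemma C_k_on_Suc: "C_k_on (Suc k) U F \<longleftrightarrow> F differentiable_on U \<and> (\<forall>i. C_k_on k U (pd i F))"
  for F :: "real^'n \<Rightarrow> complex"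
  by (simp add: ball_Basis_vec)

declare C_k_on.simps(2) [simp del]

lemma pd_eq: "(F has_derivative D) (at x) \<Longrightarrow> pd i F x = D (axis i 1)"
  unfolding partial_deriv_def by (metis frechet_derivative_at)

lemma pd_cong:
  assumes "open U" "x \<in> U" "\<And>y. y \<in> U \<Longrightarrow> F y = G y"
  shows "pd i F x = pd i G x"
proof -
  have "(F has_derivative D) (at x) \<longleftrightarrow> (G has_derivative D) (at x)" for D
    using assms by (metis has_derivative_transform_within_open)
  then show ?thesis unfolding partial_deriv_def frechet_derivative_def by simp
qed

lemma differentiable_on_open: "open U \<Longrightarrow> F differentiable_on U \<longleftrightarrow> (\<forall>x\<in>U. F differentiable (at x))"
  by (simp add: differentiable_on_def at_within_open[of _ U])

lemma C_k_on_cong: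
  fixes F :: "real^'n \<Rightarrow> complex"
  assumes "open U" "\<And>y. y \<in> U \<Longrightarrow> F y = G y"
  shows "C_k_on k U F \<longleftrightarrow> C_k_on k U G"
  using assms(2)
proof (induction k arbitrary: F G)
  case 0
  then show ?case by (simp cong: continuous_on_cong)
next
  case (Suc k)
  have "F differentiable (at x) \<longleftrightarrow> G differentiable (at x)" if "x \<in> U" for x
    unfolding differentiable_def using Suc.prems that assms(1)
    by (metis has_derivative_transform_within_open)
  moreover have "C_k_on k U (pd i F) \<longleftrightarrow> C_k_on k U (pd i G)" for i
    using Suc.prems by (intro Suc.IH) (metis pd_cong[OF assms(1)])
  ultimately show ?case by (simp add: C_k_on_Suc differentiable_on_open assms(1))
qed

lemma C_k_on_SucD: "C_k_on (Suc k) U F \<Longrightarrow> C_k_on k U F" for F :: "real^'n \<Rightarrow> complex"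
proof (induction k arbitrary: F)
  case 0
  then show ?case by (simp add: C_k_on_Suc differentiable_imp_continuous_on)
next
  case (Suc k)
  then show ?case by (metis C_k_on_Suc)
qed

lemma smooth_on_pd: "smooth_on U F \<Longrightarrow> smooth_on U (pd i F)"
  unfolding smooth_on_def using C_k_on_Suc by blast

lemma smooth_on_differentiable: "smooth_on U F \<Longrightarrow> open U \<Longrightarrow> x \<in> U \<Longrightarrow> F differentiable (at x)"
  unfolding smooth_on_def using C_k_on_Suc[of 0 U F] differentiable_on_open by blast

lemma smooth_on_continuous: "smooth_on U F \<Longrightarrow> continuous_on U F"
  unfolding smooth_on_def by (metis C_k_on.simps(1))

lemma smooth_on_cong:
  "open U \<Longrightarrow> (\<And>y. y \<in> U \<Longrightarrow> F y = G y) \<Longrightarrow> smooth_on U F \<longleftrightarrow> smooth_on U G"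
  unfolding smooth_on_def using C_k_on_cong by blast

lemma smooth_on_subset:
  assumes "smooth_on U F" "V \<subseteq> U"
  shows "smooth_on V F"
proof -
  have "C_k_on k U F \<Longrightarrow> C_k_on k V F" for k
  proof (induction k arbitrary: F)
    case (Suc k)
    then show ?case using assms(2) differentiable_on_subset by (metis C_k_on_Suc)
  qed (use assms(2) continuous_on_subset in auto)
  then show ?thesis using assms(1) by (simp add: smooth_on_def)
qed

lemma C_k_on_const: "C_k_on k U (\<lambda>x. c)" for U :: "(real^'n) set"
proof (induction k arbitrary: c)
  case (Suc k)
  have "pd i (\<lambda>x. c) = (\<lambda>x::real^'n. 0)" for i :: 'n
    by (rule ext, subst pd_eq[of _ "\<lambda>_. 0"]) (auto intro: derivative_eq_intros)
  then show ?case using Suc by (simp add: C_k_on_Suc)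
qed simp

lemma smooth_on_const: "smooth_on U (\<lambda>x. c)"
  by (simp add: smooth_on_def C_k_on_const)

lemma pd_const: "pd i (\<lambda>x. c) x = 0"
  by (subst pd_eq[of _ "\<lambda>_. 0"]) (auto intro: derivative_eq_intros)

lemma pd_add: "F differentiable (at x) \<Longrightarrow> G differentiable (at x) \<Longrightarrow>
    pd i (\<lambda>x. F x + G x) x = pd i F x + pd i G x"
  unfolding frechet_derivative_works
  by (subst pd_eq, rule has_derivative_add, auto) (auto simp: partial_deriv_def)

lemma pd_mult: "F differentiable (at x) \<Longrightarrow> G differentiable (at x) \<Longrightarrow>
    pd i (\<lambda>x. F x * G x) x = F x * pd i G x + pd i F x * G x"
  unfolding frechet_derivative_works
  by (subst pd_eq, rule has_derivative_mult, auto) (auto simp: partial_deriv_def)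

lemma pd_cmult: "F differentiable (at x) \<Longrightarrow> pd i (\<lambda>x. c * F x) x = c * pd i F x"
  by (subst pd_mult) (auto simp: pd_const)

lemma pd_sum: "(\<And>j. j \<in> J \<Longrightarrow> F j differentiable (at x)) \<Longrightarrow>
    pd i (\<lambda>x. \<Sum>j\<in>J. F j x) x = (\<Sum>j\<in>J. pd i (F j) x)"
  by (induction J rule: infinite_finite_induct) (auto simp: pd_const pd_add)

lemma C_k_on_add:
  fixes F :: "real^'n \<Rightarrow> complex"
  assumes "open U"
  shows "C_k_on k U F \<Longrightarrow> C_k_on k U G \<Longrightarrow> C_k_on k U (\<lambda>x. F x + G x)"
proof (induction k arbitrary: F G)
  case (Suc k)
  have "C_k_on k U (pd i (\<lambda>x. F x + G x))" for i
  proof (subst C_k_on_cong[OF assms])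
    show "C_k_on k U (\<lambda>x. pd i F x + pd i G x)"
      using Suc by (simp add: C_k_on_Suc)
    show "pd i (\<lambda>x. F x + G x) y = pd i F y + pd i G y" if "y \<in> U" for y
      using Suc that by (intro pd_add) (auto simp: C_k_on_Suc differentiable_on_open assms)
  qed
  then show ?case using Suc.prems by (auto simp: C_k_on_Suc intro!: differentiable_on_add)
qed (simp add: continuous_on_add)

lemma C_k_on_mult:
  fixes F :: "real^'n \<Rightarrow> complex"
  assumes "open U"
  shows "C_k_on k U F \<Longrightarrow> C_k_on k U G \<Longrightarrow> C_k_on k U (\<lambda>x. F x * G x)"
proof (induction k arbitrary: F G)
  case (Suc k)
  have "C_k_on k U (pd i (\<lambda>x. F x * G x))" for i
  proof (subst C_k_on_cong[OF assms])
    show "C_k_on k U (\<lambda>x. F x * pd i G x + pd i F x * G x)"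
      using Suc C_k_on_SucD[OF Suc.prems(1)] C_k_on_SucD[OF Suc.prems(2)]
      by (intro C_k_on_add assms Suc.IH) (auto simp: C_k_on_Suc)
    show "pd i (\<lambda>x. F x * G x) y = F y * pd i G y + pd i F y * G y" if "y \<in> U" for y
      using Suc that by (intro pd_mult) (auto simp: C_k_on_Suc differentiable_on_open assms)
  qed
  then show ?case using Suc.prems
    by (auto simp: C_k_on_Suc differentiable_on_open assms)
qed (simp add: continuous_on_mult)

lemma smooth_on_add: "open U \<Longrightarrow> smooth_on U F \<Longrightarrow> smooth_on U G \<Longrightarrow> smooth_on U (\<lambda>x. F x + G x)"
  by (simp add: smooth_on_def C_k_on_add)

lemma smooth_on_mult: "open U \<Longrightarrow> smooth_on U F \<Longrightarrow> smooth_on U G \<Longrightarrow> smooth_on U (\<lambda>x. F x * G x)"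
  by (simp add: smooth_on_def C_k_on_mult)

lemma smooth_on_sum: "open U \<Longrightarrow> (\<And>j. j \<in> J \<Longrightarrow> smooth_on U (F j)) \<Longrightarrow> smooth_on U (\<lambda>x. \<Sum>j\<in>J. F j x)"
  by (induction J rule: infinite_finite_induct) (auto intro: smooth_on_const smooth_on_add)

lemma pd_coord: "pd i (\<lambda>x. of_real (x$j)) x = (if i = j then 1 else 0)"
proof -
  have "((\<lambda>x. complex_of_real (x$j)) has_derivative (\<lambda>h. of_real (h$j))) (at x)"
    by (intro bounded_linear_imp_has_derivative bounded_linear_compose[OF bounded_linear_of_real]
      bounded_linear_vec_nth)
  from pd_eq[OF this, of i] show ?thesis by (auto simp: axis_def)
qed

lemma differentiable_coord: "(\<lambda>x. complex_of_real (x$j)) differentiable (at x)"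
  by (intro bounded_linear_imp_differentiable bounded_linear_compose[OF bounded_linear_of_real]
      bounded_linear_vec_nth)

lemma smooth_on_coord: "smooth_on U (\<lambda>x::real^'n. of_real (x$j))"
proof -
  have "pd i (\<lambda>x::real^'n. of_real (x$j)) = (\<lambda>x. if i = j then 1 else 0)" for i
    by (simp add: pd_coord fun_eq_iff)
  then have "C_k_on k U (\<lambda>x::real^'n. of_real (x$j))" for k
    by (cases k) (auto simp: C_k_on_Suc C_k_on_const differentiable_coord
      intro!: continuous_intros differentiable_at_imp_differentiable_on)
  then show ?thesis by (simp add: smooth_on_def)
qed

section \<open>Powers of the norm\<close>

definition norm_powr :: "real \<Rightarrow> real^'n \<Rightarrow> complex" where
  "norm_powr m x = of_real (norm x powr m)"

lemma has_derivative_norm_powr: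
  assumes "x \<noteq> 0"
  shows "(norm_powr m has_derivative (\<lambda>h. of_real (m * norm x powr (m - 2) * (x \<bullet> h)))) (at x)"
proof -
  have 1: "((\<lambda>t. t powr m) has_derivative (\<lambda>h. h * (m * norm x powr (m - 1)))) (at (norm x))"
    using has_real_derivative_powr[of "norm x" m] assms
    by (simp add: has_field_derivative_def mult.commute[of _ "m * _"])
  have "((\<lambda>x. norm x powr m) has_derivative (\<lambda>h. (sgn x \<bullet> h) * (m * norm x powr (m - 1)))) (at x)"
    using has_derivative_compose[OF has_derivative_norm[OF assms] 1] by (simp add: inner_commute)
  moreover have "(sgn x \<bullet> h) * (m * norm x powr (m - 1)) = m * norm x powr (m - 2) * (x \<bullet> h)" for h
    using assms powr_add[of "norm x" "m - 2" 1] by (simp add: sgn_div_norm)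
  ultimately have "((\<lambda>x. norm x powr m) has_derivative (\<lambda>h. m * norm x powr (m - 2) * (x \<bullet> h))) (at x)"
    by simp
  then show ?thesis unfolding norm_powr_def[abs_def]
    by (rule bounded_linear.has_derivative[OF bounded_linear_of_real])
qed

lemma pd_norm_powr: "x \<noteq> 0 \<Longrightarrow> pd i (norm_powr m) x = of_real m * of_real (x$i) * norm_powr (m - 2) x"
  by (subst pd_eq[OF has_derivative_norm_powr]) (auto simp: inner_axis norm_powr_def)

text \<open>Each partial derivative is a multiple of a coordinate times
  \<open>norm_powr (m - 2)\<close>, so the induction on \<open>k\<close> runs over all real
  exponents at once.\<close>

lemma smooth_on_norm_powr: "smooth_on (- {0}) (norm_powr m :: real^'n \<Rightarrow> complex)"
proof -
  have "C_k_on k (- {0}) (norm_powr m :: real^'n \<Rightarrow> complex)" for k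
  proof (induction k arbitrary: m)
    case 0
    then show ?case by (auto simp: norm_powr_def[abs_def] intro!: continuous_intros)
  next
    case (Suc k)
    have "C_k_on k (- {0}) (pd i (norm_powr m) :: real^'n \<Rightarrow> complex)" for i
      by (subst C_k_on_cong[OF _ pd_norm_powr])
        (use Suc smooth_on_coord in \<open>auto intro!: C_k_on_mult C_k_on_const simp: smooth_on_def\<close>)
    moreover have "norm_powr m differentiable_on (- {0 :: real^'n})"
      by (subst differentiable_on_open) (auto simp: differentiable_def intro: has_derivative_norm_powr)
    ultimately show ?case by (simp add: C_k_on_Suc)
  qed
  then show ?thesis by (simp add: smooth_on_def)
qed

section \<open>Symmetry of second derivatives, and second derivatives at a maximum\<close>

lemma line_derivative:
  assumes "F differentiable (at (y + t *\<^sub>R axis i 1))" "bounded_linear L"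
  shows "((\<lambda>t. L (F (y + t *\<^sub>R axis i 1))) has_real_derivative L (pd i F (y + t *\<^sub>R axis i 1))) (at t)"
proof -
  let ?x = "y + t *\<^sub>R axis i 1"
  let ?D = "frechet_derivative F (at ?x)"
  have D: "(F has_derivative ?D) (at ?x)" using assms(1) frechet_derivative_works by blast
  have "((\<lambda>t. y + t *\<^sub>R axis i 1) has_derivative (\<lambda>h. h *\<^sub>R axis i 1)) (at t)"
    by (auto intro!: derivative_eq_intros)
  from has_derivative_compose[OF this D]
  have "((\<lambda>t. L (F (y + t *\<^sub>R axis i 1))) has_derivative (\<lambda>h. L (?D (h *\<^sub>R axis i 1)))) (at t)"
    by (rule bounded_linear.has_derivative[OF assms(2)])
  moreover have "L (?D (h *\<^sub>R axis i 1)) = L (pd i F ?x) * h" for h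
    using linear_scale[OF has_derivative_linear[OF D]] linear_scale[OF bounded_linear.linear[OF assms(2)]]
    by (simp add: partial_deriv_def)
  ultimately show ?thesis by (simp add: has_field_derivative_def mult.commute[of _ "L _"])
qed

text \<open>The mean value theorem is applied along axis \<open>i\<close> to the difference in
  direction \<open>j\<close>, then along axis \<open>j\<close>. It needs real values, hence the
  real-linear \<open>L\<close>, later \<open>Re\<close> and \<open>Im\<close>.\<close>

lemma line_derivative_second_difference:
  fixes F :: "real^'n \<Rightarrow> complex"
  assumes F: "\<And>y. y \<in> ball x e \<Longrightarrow> F differentiable (at y)"
    "\<And>y. y \<in> ball x e \<Longrightarrow> pd i F differentiable (at y)"
    and L: "bounded_linear L" and h: "0 < h" "2 * h < e"
  obtains \<xi> where "dist x \<xi> \<le> 2 * h"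
    "L (F (x + h *\<^sub>R axis i 1 + h *\<^sub>R axis j 1)) - L (F (x + h *\<^sub>R axis i 1))
      - L (F (x + h *\<^sub>R axis j 1)) + L (F x) = h\<^sup>2 * L (pd j (pd i F) \<xi>)"
proof -
  have near: "dist x (x + s *\<^sub>R axis i 1 + t *\<^sub>R axis j 1) \<le> 2 * h"
    if "0 \<le> s" "s \<le> h" "0 \<le> t" "t \<le> h" for s t
  proof -
    have "norm (s *\<^sub>R axis i 1 + t *\<^sub>R axis j (1::real)) \<le> \<bar>s\<bar> + \<bar>t\<bar>"
      using norm_triangle_ineq[of "s *\<^sub>R axis i 1" "t *\<^sub>R axis j (1::real)"] by simp
    then show ?thesis using that by (simp add: dist_norm norm_minus_commute algebra_simps)
  qed
  have inb: "x + s *\<^sub>R axis i 1 + t *\<^sub>R axis j 1 \<in> ball x e"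
    if "0 \<le> s" "s \<le> h" "0 \<le> t" "t \<le> h" for s t
    using near[OF that] h by simp
  define f where "f s = L (F (x + h *\<^sub>R axis j 1 + s *\<^sub>R axis i 1)) - L (F (x + s *\<^sub>R axis i 1))" for s
  have "\<exists>s. 0 < s \<and> s < h \<and> f h - f 0 = (h - 0) *
      (L (pd i F (x + h *\<^sub>R axis j 1 + s *\<^sub>R axis i 1)) - L (pd i F (x + s *\<^sub>R axis i 1)))"
  proof (rule MVT2)
    show "(f has_real_derivative L (pd i F (x + h *\<^sub>R axis j 1 + s *\<^sub>R axis i 1))
        - L (pd i F (x + s *\<^sub>R axis i 1))) (at s)" if "0 \<le> s" "s \<le> h" for s
      unfolding f_def using inb[of s h] inb[of s 0] that h
      by (intro DERIV_diff line_derivative F L) (auto simp: ac_simps)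
  qed (use h in auto)
  then obtain s where s: "0 < s" "s < h" and fs: "f h - f 0 = h *
      (L (pd i F (x + h *\<^sub>R axis j 1 + s *\<^sub>R axis i 1)) - L (pd i F (x + s *\<^sub>R axis i 1)))"
    by auto
  define g where "g t = L (pd i F (x + s *\<^sub>R axis i 1 + t *\<^sub>R axis j 1))" for t
  have "\<exists>t. 0 < t \<and> t < h \<and> g h - g 0 = (h - 0) * L (pd j (pd i F) (x + s *\<^sub>R axis i 1 + t *\<^sub>R axis j 1))"
  proof (rule MVT2)
    show "(g has_real_derivative L (pd j (pd i F) (x + s *\<^sub>R axis i 1 + t *\<^sub>R axis j 1))) (at t)"
      if "0 \<le> t" "t \<le> h" for t
      unfolding g_def using inb[of s t] that s by (intro line_derivative F L) auto
  qed (use h in auto)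
  then obtain t where t: "0 < t" "t < h" and
    gt: "g h - g 0 = h * L (pd j (pd i F) (x + s *\<^sub>R axis i 1 + t *\<^sub>R axis j 1))" by auto
  have "f h - f 0 = h * (g h - g 0)" unfolding fs g_def by (simp add: ac_simps)
  then have "f h - f 0 = h\<^sup>2 * L (pd j (pd i F) (x + s *\<^sub>R axis i 1 + t *\<^sub>R axis j 1))"
    using gt by (simp add: power2_eq_square)
  then show ?thesis
    using that[OF near[of s t]] s t by (simp add: f_def ac_simps)
qed

text \<open>The second difference is symmetric in \<open>i\<close> and \<open>j\<close>, so under
  \<open>L\<close> the two mixed derivatives take equal values at points \<open>\<xi> n\<close> and
  \<open>\<eta> n\<close> that both tend to \<open>x\<close>; continuity does the rest.\<close>

lemma pd_commute:
  fixes F :: "real^'n \<Rightarrow> complex"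
  assumes F: "smooth_on U F" and U: "open U" "x \<in> U"
  shows "pd i (pd j F) x = pd j (pd i F) x"
proof -
  obtain e where e: "e > 0" "ball x e \<subseteq> U" using U openE by blast
  have "L (pd i (pd j F) x) = L (pd j (pd i F) x)" if L: "bounded_linear L" for L :: "complex \<Rightarrow> real"
  proof -
    define A where "A = (\<lambda>y. L (pd i (pd j F) y))"
    define B where "B = (\<lambda>y. L (pd j (pd i F) y))"
    \<comment> \<open>The factor 3 gives \<open>2 * h n < e\<close>, which keeps every sampled point
      in the ball.\<close>
    define h where "h n = e / (3 * real (Suc n))" for n
    have h: "0 < h n" "2 * h n < e" for n
    proof -
      show "0 < h n" using e by (simp add: h_def)
      have "h n \<le> e / 3" unfolding h_def using e by (intro divide_left_mono) auto
      then show "2 * h n < e" using e by simp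
    qed
    have hlim: "h \<longlonglongrightarrow> 0"
    proof -
      have "h = (\<lambda>n. e / 3 * inverse (real (Suc n)))" by (simp add: h_def fun_eq_iff field_simps)
      moreover have "(\<lambda>n. e / 3 * inverse (real (Suc n))) \<longlonglongrightarrow> e / 3 * 0"
        by (intro tendsto_mult tendsto_const LIMSEQ_inverse_real_of_nat)
      ultimately show ?thesis by simp
    qed
    have d: "G differentiable (at y)" if "smooth_on U G" "y \<in> ball x e" for G y
      using that e U smooth_on_differentiable by blast
    have "\<exists>\<xi> \<eta>. dist x \<xi> \<le> 2 * h n \<and> dist x \<eta> \<le> 2 * h n \<and> A \<xi> = B \<eta>" for n
    proof -
      obtain \<xi> where \<xi>: "dist x \<xi> \<le> 2 * h n" "L (F (x + h n *\<^sub>R axis j 1 + h n *\<^sub>R axis i 1))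
        - L (F (x + h n *\<^sub>R axis j 1)) - L (F (x + h n *\<^sub>R axis i 1)) + L (F x) = (h n)\<^sup>2 * A \<xi>"
        unfolding A_def
        by (rule line_derivative_second_difference[of x e F j L "h n" i]) (use d F smooth_on_pd L h in blast)+
      obtain \<eta> where \<eta>: "dist x \<eta> \<le> 2 * h n" "L (F (x + h n *\<^sub>R axis i 1 + h n *\<^sub>R axis j 1))
        - L (F (x + h n *\<^sub>R axis i 1)) - L (F (x + h n *\<^sub>R axis j 1)) + L (F x) = (h n)\<^sup>2 * B \<eta>"
        unfolding B_def
        by (rule line_derivative_second_difference[of x e F i L "h n" j]) (use d F smooth_on_pd L h in blast)+
      have "(h n)\<^sup>2 * A \<xi> = (h n)\<^sup>2 * B \<eta>"
        unfolding \<xi>(2)[symmetric] \<eta>(2)[symmetric] by (simp add: ac_simps)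
      then show ?thesis using \<xi>(1) \<eta>(1) h(1)[of n] by auto
    qed
    then obtain \<xi> \<eta> where \<xi>\<eta>: "\<And>n. dist x (\<xi> n) \<le> 2 * h n" "\<And>n. dist x (\<eta> n) \<le> 2 * h n"
      "\<And>n. A (\<xi> n) = B (\<eta> n)" by metis
    have "(\<lambda>n. 2 * h n) \<longlonglongrightarrow> 0" using tendsto_mult_right[OF hlim, of 2] by simp
    then have lims: "\<xi> \<longlonglongrightarrow> x" "\<eta> \<longlonglongrightarrow> x"
      unfolding tendsto_dist_iff[of _ x]
      by (rule tendsto_sandwich[rotated 2, OF tendsto_const], 
          use \<xi>\<eta>(1,2) in \<open>auto simp: dist_commute\<close>)+
    have cont: "isCont (\<lambda>y. L (G y)) x" if "smooth_on U G" for G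
      using smooth_on_continuous[OF that] U L
      by (metis continuous_on_eq_continuous_at linear_continuous_on continuous_on_compose2 subset_UNIV)
    have "isCont A x" "isCont B x"
      unfolding A_def B_def by (intro cont smooth_on_pd F)+
    then have "(\<lambda>n. A (\<xi> n)) \<longlonglongrightarrow> A x" "(\<lambda>n. B (\<eta> n)) \<longlonglongrightarrow> B x"
      using lims by (auto intro: isCont_tendsto_compose)
    then show ?thesis using \<xi>\<eta>(3) LIMSEQ_unique by (simp add: A_def B_def)
  qed
  from this[OF bounded_linear_Re] this[OF bounded_linear_Im] show ?thesis by (rule complex_eqI)
qed

lemma pd_laplacian:
  fixes F :: "real^'n \<Rightarrow> complex"
  assumes F: "smooth_on U F" and U: "open U" "x \<in> U"
  shows "laplacian (pd j F) x = pd j (laplacian F) x"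
proof -
  have "pd i (pd i (pd j F)) x = pd j (pd i (pd i F)) x" for i
  proof -
    have "pd i (pd i (pd j F)) x = pd i (pd j (pd i F)) x"
      using pd_commute[OF F U(1)] by (intro pd_cong[OF U]) auto
    also have "\<dots> = pd j (pd i (pd i F)) x"
      using pd_commute[OF smooth_on_pd[OF F] U] .
    finally show ?thesis .
  qed
  then show ?thesis
    unfolding laplacian_vec[abs_def]
    using smooth_on_differentiable[OF smooth_on_pd[OF smooth_on_pd[OF F]] U]
    by (subst pd_sum) auto
qed

text \<open>On the line through \<open>x\<close> in direction \<open>i\<close> the first derivative
  vanishes at the maximum. If the second were positive, the first would be positive just after, and
  the function would increase beyond its maximum.\<close>

lemma local_max_second_derivative:
  fixes F :: "real^'n \<Rightarrow> complex"
  assumes F: "smooth_on U F" and U: "open U" "x \<in> U"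
    and max: "\<And>y. y \<in> U \<Longrightarrow> Re (F y) \<le> Re (F x)"
  shows "Re (pd i (pd i F) x) \<le> 0"
proof (rule ccontr)
  assume a: "\<not> Re (pd i (pd i F) x) \<le> 0"
  obtain e where e: "e > 0" "ball x e \<subseteq> U" using U openE by blast
  have inU: "x + t *\<^sub>R axis i 1 \<in> U" if "\<bar>t\<bar> < e" for t
    using that e by (intro subsetD[OF e(2)]) (simp add: dist_norm)
  define \<phi> where "\<phi> t = Re (F (x + t *\<^sub>R axis i 1))" for t
  define \<psi> where "\<psi> t = Re (pd i F (x + t *\<^sub>R axis i 1))" for t
  have d1: "(\<phi> has_real_derivative \<psi> t) (at t)" if "\<bar>t\<bar> < e" for t
    unfolding \<phi>_def \<psi>_def using smooth_on_differentiable[OF F U(1) inU[OF that]]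
    by (intro line_derivative bounded_linear_Re) auto
  have d2: "(\<psi> has_real_derivative Re (pd i (pd i F) x)) (at 0)"
    unfolding \<psi>_def
    using line_derivative[of "pd i F" x 0 i Re] smooth_on_differentiable[OF smooth_on_pd[OF F] U(1) inU[of 0]] e
    by (simp add: bounded_linear_Re)
  have "\<psi> 0 = 0"
    using max inU d1[of 0] e by (intro DERIV_local_max[of \<phi> "\<psi> 0" 0 e]) (auto simp: \<phi>_def)
  then obtain d where d: "d > 0" "\<And>h. 0 < h \<Longrightarrow> h < d \<Longrightarrow> 0 < \<psi> h"
    using DERIV_pos_inc_right[OF d2] a by auto
  define h where "h = min d e / 2"
  have h: "0 < h" "h < d" "h < e" using d(1) e(1) by (auto simp: h_def min_def)
  obtain z where z: "0 < z" "z < h" "\<phi> h - \<phi> 0 = (h - 0) * \<psi> z"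
    using MVT2[of 0 h \<phi> \<psi>] d1 h by (metis abs_of_nonneg order_le_less_trans)
  have "\<phi> h - \<phi> 0 > 0" using z d(2)[of z] h by simp
  moreover have "\<phi> h \<le> \<phi> 0" using max[OF inU[of h]] h by (simp add: \<phi>_def)
  ultimately show False by simp
qed

section \<open>A maximum principle on the sphere\<close>

lemma pd_square_dist:
  "pd i (\<lambda>x. of_real (R - (dist x y)\<^sup>2)) x = of_real (- 2 * (x - y)$i)"
proof -
  have "((\<lambda>x. complex_of_real (R - (x - y) \<bullet> (x - y))) has_derivative
      (\<lambda>h. of_real (- (2 * ((x - y) \<bullet> h))))) (at x)"
    by (rule bounded_linear.has_derivative[OF bounded_linear_of_real])
      (auto intro!: derivative_eq_intros simp: inner_commute)
  from pd_eq[OF this, of i] show ?thesis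
    by (simp add: dist_norm power2_norm_eq_inner inner_axis)
qed

lemma smooth_on_square_dist:
  "open U \<Longrightarrow> smooth_on U (\<lambda>x::real^'n. complex_of_real (R - (dist x y)\<^sup>2))"
proof -
  have *: "(\<lambda>x::real^'n. complex_of_real (R - (dist x y)\<^sup>2)) =
    (\<lambda>x. of_real R + (- 1) * (\<Sum>i\<in>UNIV. (of_real (x$i) + of_real (- y$i)) * (of_real (x$i) + of_real (- y$i))))"
    by (rule ext) (simp add: dist_norm power2_norm_eq_inner inner_vec_def)
  show "open U \<Longrightarrow> ?thesis"
    unfolding * by (intro smooth_on_add smooth_on_mult smooth_on_sum smooth_on_const smooth_on_coord)
qed

lemma laplacian_add:
  assumes "smooth_on U F" "smooth_on U G" "open U" "x \<in> U"
  shows "laplacian (\<lambda>x. F x + G x) x = laplacian F x + laplacian G x"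
proof -
  have "pd i (pd i (\<lambda>x. F x + G x)) x = pd i (pd i F) x + pd i (pd i G) x" for i
  proof -
    have "pd i (pd i (\<lambda>x. F x + G x)) x = pd i (\<lambda>x. pd i F x + pd i G x) x"
      using assms smooth_on_differentiable by (intro pd_cong[OF assms(3,4)] pd_add) blast+
    also have "\<dots> = pd i (pd i F) x + pd i (pd i G) x"
      using assms smooth_on_differentiable smooth_on_pd by (intro pd_add) blast+
    finally show ?thesis .
  qed
  then show ?thesis by (simp add: laplacian_vec sum.distrib)
qed

lemma laplacian_cmult:
  assumes "smooth_on U F" "open U" "x \<in> U"
  shows "laplacian (\<lambda>x. c * F x) x = c * laplacian F x"
proof -
  have "pd i (pd i (\<lambda>x. c * F x)) x = c * pd i (pd i F) x" for i
  proof -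
    have "pd i (pd i (\<lambda>x. c * F x)) x = pd i (\<lambda>x. c * pd i F x) x"
      using assms smooth_on_differentiable by (intro pd_cong[OF assms(2,3)] pd_cmult) blast+
    also have "\<dots> = c * pd i (pd i F) x"
      using assms smooth_on_differentiable smooth_on_pd by (intro pd_cmult) blast+
    finally show ?thesis .
  qed
  then show ?thesis by (simp add: laplacian_vec sum_distrib_left)
qed

lemma laplacian_mult:
  assumes "smooth_on U F" "smooth_on U G" "open U" "x \<in> U"
  shows "laplacian (\<lambda>x. F x * G x) x =
    F x * laplacian G x + 2 * (\<Sum>i\<in>UNIV. pd i F x * pd i G x) + laplacian F x * G x"
proof -
  note d = smooth_on_differentiable[OF _ assms(3)] 
  have "pd i (pd i (\<lambda>x. F x * G x)) x =
    F x * pd i (pd i G) x + 2 * (pd i F x * pd i G x) + pd i (pd i F) x * G x" for i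
  proof -
    have "pd i (pd i (\<lambda>x. F x * G x)) x = pd i (\<lambda>x. F x * pd i G x + pd i F x * G x) x"
      using assms d by (intro pd_cong[OF assms(3,4)] pd_mult) blast+
    also have "\<dots> = pd i (\<lambda>x. F x * pd i G x) x + pd i (\<lambda>x. pd i F x * G x) x"
      using assms by (intro pd_add d[of _ x] smooth_on_mult smooth_on_pd)
    also have "\<dots> = F x * pd i (pd i G) x + pd i F x * pd i G x + (pd i F x * pd i G x + pd i (pd i F) x * G x)"
      using assms by (intro arg_cong2[of _ _ _ _ "(+)"] pd_mult d[of _ x] smooth_on_pd)
    finally show ?thesis by simp
  qed
  then show ?thesis by (simp add: laplacian_vec sum.distrib sum_distrib_left sum_distrib_right)
qed

lemma laplacian_const: "laplacian (\<lambda>x::real^'n. c) x = 0"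
  by (simp add: laplacian_vec pd_const[abs_def])

lemma laplacian_square_dist:
  "laplacian (\<lambda>x::real^'n. of_real (R - (dist x y)\<^sup>2)) x = - 2 * of_nat CARD('n)"
proof -
  have "pd i (pd i (\<lambda>x::real^'n. of_real (R - (dist x y)\<^sup>2))) x = - 2" for i
  proof -
    have "pd i (\<lambda>x::real^'n. of_real (R - (dist x y)\<^sup>2)) = (\<lambda>x. - 2 * (of_real (x$i) + of_real (- y$i)))"
      by (rule ext, subst pd_square_dist) simp
    then show ?thesis
      by (simp only: pd_cmult pd_add pd_const pd_coord differentiable_coord differentiable_const differentiable_add) simp
  qed
  then show ?thesis by (simp add: laplacian_vec)
qed

text \<open>A polynomial stand-in for the exponential barrier of Hopf's boundary lemma. It vanishes
  on the sphere of radius \<open>R\<close> about \<open>y\<close>; near that sphere it has the sign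
  of R^2 - dist^2, and a large \<open>C\<close> makes its Laplacian positive.\<close>

definition barrier :: "real \<Rightarrow> real \<Rightarrow> real^'n \<Rightarrow> real^'n \<Rightarrow> real" where
  "barrier C R y x = (R\<^sup>2 - (dist x y)\<^sup>2) + C * (R\<^sup>2 - (dist x y)\<^sup>2)\<^sup>2"

lemma of_real_barrier:
  "(\<lambda>x. of_real (barrier C R y x)) =
    (\<lambda>x. of_real (R\<^sup>2 - (dist x y)\<^sup>2) + of_real C * (of_real (R\<^sup>2 - (dist x y)\<^sup>2) * of_real (R\<^sup>2 - (dist x y)\<^sup>2)))"
  by (simp add: barrier_def power2_eq_square)

lemma smooth_on_barrier: "open U \<Longrightarrow> smooth_on U (\<lambda>x. of_real (barrier C R y x))"
  unfolding of_real_barrier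
  by (intro smooth_on_add smooth_on_mult smooth_on_const smooth_on_square_dist)

lemma laplacian_barrier:
  "laplacian (\<lambda>x::real^'n. of_real (barrier C R y x)) x =
    of_real (8 * C * (dist x y)\<^sup>2 - 2 * CARD('n) * (1 + 2 * C * (R\<^sup>2 - (dist x y)\<^sup>2)))"
proof -
  define q :: "real^'n \<Rightarrow> complex" where "q = (\<lambda>x. of_real (R\<^sup>2 - (dist x y)\<^sup>2))"
  have q: "smooth_on UNIV q" unfolding q_def by (intro smooth_on_square_dist) simp
  have lq: "laplacian q x = - 2 * of_nat CARD('n)" unfolding q_def by (rule laplacian_square_dist)
  have "(\<Sum>i\<in>UNIV. pd i q x * pd i q x) = of_real (4 * (dist x y)\<^sup>2)"
    unfolding q_def pd_square_dist
    by (simp add: dist_norm power2_norm_eq_inner inner_vec_def sum_distrib_left)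
      (intro sum.cong refl, simp add: algebra_simps)
  moreover have "laplacian (\<lambda>x. q x + of_real C * (q x * q x)) x =
    laplacian q x + of_real C * (q x * laplacian q x + 2 * (\<Sum>i\<in>UNIV. pd i q x * pd i q x) + laplacian q x * q x)"
    using q by (simp add: laplacian_add[OF q smooth_on_mult[OF _ smooth_on_const smooth_on_mult[OF _ q q]]]
      laplacian_cmult[OF smooth_on_mult[OF _ q q]] laplacian_mult[OF q q])
  ultimately have "laplacian (\<lambda>x. q x + of_real C * (q x * q x)) x =
    of_real (8 * C * (dist x y)\<^sup>2 - 2 * CARD('n) * (1 + 2 * C * (R\<^sup>2 - (dist x y)\<^sup>2)))"
    unfolding lq by (simp add: q_def algebra_simps)
  then show ?thesis unfolding of_real_barrier q_def .
qed

text \<open>A maximum \<open>x0\<close> of \<open>Re G\<close> which is the only one on a closed ball with \<open>x0\<close> on its boundary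
  is impossible: adding a small multiple of the barrier, which is strictly subharmonic near \<open>x0\<close>
  and negative off the ball, produces an interior maximum with positive Laplacian.\<close>

lemma no_touching_ball:
  fixes G :: "real^'n \<Rightarrow> complex"
  assumes G: "smooth_on U G" and U: "open U" "x0 \<in> U"
    and harm: "\<And>x. x \<in> U \<Longrightarrow> laplacian G x = 0"
    and max: "\<And>x. x \<in> U \<Longrightarrow> Re (G x) \<le> Re (G x0)"
    and R: "R > 0" "dist x0 y = R"
    and strict: "\<And>x. x \<in> U \<Longrightarrow> dist x y \<le> R \<Longrightarrow> x \<noteq> x0 \<Longrightarrow> Re (G x) < Re (G x0)"
  shows False
proof -
  define N where "N = real CARD('n)"
  have N: "N \<ge> 1" unfolding N_def by simp
  \<comment> \<open>At distance at least R/2 from \<open>y\<close> this choice makes the term 8 C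
    dist^2 of \<open>laplacian_barrier\<close> at least 4N + 2, more than the bound 3N for the
    subtracted term.\<close>
  define C where "C = (2 * N + 1) / R\<^sup>2"
  have C: "C > 0" using N R by (simp add: C_def)
  have CR: "C * R\<^sup>2 = 2 * N + 1" using R by (simp add: C_def)
  obtain e where e: "e > 0" "cball x0 e \<subseteq> U" using U open_contains_cball by blast
  \<comment> \<open>Within \<rho> of \<open>x0\<close> the quantity |R^2 - dist^2| is at most 3 R
    \<rho>; the denominator 12 (2N + 1) turns this into |C (R^2 - dist^2)| at most 1/4.\<close>
  define \<rho> where "\<rho> = min e (R / (12 * (2 * N + 1)))"
  have \<rho>: "\<rho> > 0" "\<rho> \<le> e" "\<rho> \<le> R / (12 * (2 * N + 1))" using e R N by (auto simp: \<rho>_def)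
  have \<rho>R: "12 * (2 * N + 1) * \<rho> \<le> R" using \<rho>(3) N by (simp add: field_simps)
  then have \<rho>R2: "\<rho> \<le> R / 2" 
  proof -
    have "24 * (N * \<rho>) + 12 * \<rho> \<le> R" using \<rho>R by (simp add: algebra_simps)
    moreover have "N * \<rho> \<ge> 0" using N \<rho>(1) by simp
    ultimately show ?thesis using \<rho>(1) by linarith
  qed
  let ?q = "\<lambda>x. R\<^sup>2 - (dist x y)\<^sup>2"
  let ?h = "barrier C R y"
  have dy: "\<bar>dist x y - R\<bar> \<le> \<rho>" if "x \<in> cball x0 \<rho>" for x
    using that R(2) dist_triangle[of x y x0] dist_triangle[of x0 y x] by (auto simp: dist_commute)
  have q: "\<bar>C * ?q x\<bar> \<le> 1/4" "R / 2 \<le> dist x y" if "x \<in> cball x0 \<rho>" for x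
  proof -
    show "R / 2 \<le> dist x y" using dy[OF that] \<rho>R2 by linarith
    have "?q x = (R - dist x y) * (R + dist x y)" by (simp add: power2_eq_square algebra_simps)
    then have "\<bar>?q x\<bar> = \<bar>R - dist x y\<bar> * (R + dist x y)" using R by (simp add: abs_mult)
    also have "\<dots> \<le> \<rho> * (3 * R)"
      using dy[OF that] \<rho>R2 R \<rho>(1) by (intro mult_mono) auto
    finally have "\<bar>C * ?q x\<bar> \<le> C * (\<rho> * (3 * R))" using C by (simp add: abs_mult)
    moreover have "C * (\<rho> * (3 * R)) * 4 = 12 * (2 * N + 1) * \<rho> / R"
      using R by (simp add: C_def field_simps power2_eq_square)
    moreover have "12 * (2 * N + 1) * \<rho> / R \<le> 1" using \<rho>R R by simp
    ultimately show "\<bar>C * ?q x\<bar> \<le> 1/4" by linarith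
  qed
  have lap: "Re (laplacian (\<lambda>x. of_real (?h x)) x) > 0" if "x \<in> cball x0 \<rho>" for x
  proof -
    have "(R / 2)\<^sup>2 \<le> (dist x y)\<^sup>2" using q(2)[OF that] R by (intro power_mono) auto
    then have "8 * C * (R / 2)\<^sup>2 \<le> 8 * C * (dist x y)\<^sup>2" using C by (intro mult_left_mono) auto
    then have "2 * (2 * N + 1) \<le> 8 * C * (dist x y)\<^sup>2"
      using CR by (simp add: power_divide)
    moreover have "1 + 2 * C * ?q x \<le> 3/2" using q(1)[OF that] by linarith
    then have "2 * N * (1 + 2 * C * ?q x) \<le> 2 * N * (3/2)" using N by (intro mult_left_mono) auto
    moreover have "0 < a - b" if "2 * (2 * N + 1) \<le> a" "b \<le> 2 * N * (3/2)" for a b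
      using that N by simp
    ultimately have "0 < 8 * C * (dist x y)\<^sup>2 - 2 * N * (1 + 2 * C * ?q x)" by blast
    then show ?thesis unfolding laplacian_barrier Re_complex_of_real N_def of_nat_mult of_nat_numeral .
  qed
  have hneg: "?h x < 0" if "x \<in> cball x0 \<rho>" "dist x y > R" for x
  proof -
    have "?q x < 0" using that(2) R by (simp add: power_strict_mono)
    moreover have "1 + C * ?q x > 0" using q(1)[OF that(1)] by linarith
    moreover have "?h x = ?q x * (1 + C * ?q x)" by (simp add: barrier_def power2_eq_square algebra_simps)
    ultimately show ?thesis by (metis mult_neg_pos)
  qed
  have hx0: "?h x0 = 0" using R by (simp add: barrier_def)
  \<comment> \<open>On this part of the boundary of the small ball compactness leaves a gap below
    the maximum, which fixes \<epsilon>; on the rest of the boundary the barrier itself is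
    negative.\<close>
  define K where "K = sphere x0 \<rho> \<inter> cball y R"
  have cU: "cball x0 \<rho> \<subseteq> U" using e(2) \<rho>(2) by auto
  have KU: "K \<subseteq> U" "K \<subseteq> cball x0 \<rho>" using cU by (auto simp: K_def)
  have contG: "continuous_on U (\<lambda>x. Re (G x))"
    using smooth_on_continuous[OF G] by (intro continuous_intros)
  have conth: "continuous_on A ?h" for A
    unfolding barrier_def by (intro continuous_intros)
  have "\<exists>\<epsilon>>0. \<forall>x\<in>K. Re (G x) + \<epsilon> * ?h x < Re (G x0)"
  proof (cases "K = {}")
    case False
    have "compact K" by (auto simp: K_def intro: compact_Int)
    then obtain p where p: "p \<in> K" "\<And>x. x \<in> K \<Longrightarrow> Re (G x) \<le> Re (G p)"
      using continuous_attains_sup[OF _ False continuous_on_subset[OF contG KU(1)]] by blast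
    obtain s where s: "s \<in> K" "\<And>x. x \<in> K \<Longrightarrow> ?h x \<le> ?h s"
      using continuous_attains_sup[OF \<open>compact K\<close> False conth] by blast
    have "p \<noteq> x0" using p(1) \<rho>(1) by (auto simp: K_def)
    then have gap: "Re (G p) < Re (G x0)"
      using strict[of p] p(1) subsetD[OF KU(1) p(1)] by (simp add: K_def dist_commute)
    define \<epsilon> where "\<epsilon> = (Re (G x0) - Re (G p)) / (\<bar>?h s\<bar> + 1)"
    have "\<epsilon> > 0" using gap by (simp add: \<epsilon>_def)
    moreover have "Re (G x) + \<epsilon> * ?h x < Re (G x0)" if "x \<in> K" for x
    proof -
      have "\<epsilon> * ?h x < \<epsilon> * (\<bar>?h s\<bar> + 1)"
        using s(2)[OF that] \<open>\<epsilon> > 0\<close> by (intro mult_strict_left_mono) auto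
      also have "\<dots> = Re (G x0) - Re (G p)" by (simp add: \<epsilon>_def)
      finally show ?thesis using p(2)[OF that] by simp
    qed
    ultimately show ?thesis by blast
  qed (auto intro: exI[of _ 1])
  then obtain \<epsilon> where \<epsilon>: "\<epsilon> > 0" "\<And>x. x \<in> K \<Longrightarrow> Re (G x) + \<epsilon> * ?h x < Re (G x0)" by blast
  define W where "W x = G x + of_real \<epsilon> * of_real (?h x)" for x
  have ReW: "Re (W x) = Re (G x) + \<epsilon> * ?h x" for x by (simp add: W_def)
  have smW: "smooth_on U W"
    unfolding W_def[abs_def] by (intro smooth_on_add smooth_on_mult smooth_on_const smooth_on_barrier G U)
  have "compact (cball x0 \<rho>)" "cball x0 \<rho> \<noteq> {}" using \<rho>(1) by auto
  moreover have "continuous_on (cball x0 \<rho>) (\<lambda>x. Re (W x))"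
    using continuous_on_subset[OF smooth_on_continuous[OF smW] cU] by (intro continuous_intros)
  ultimately obtain p where p: "p \<in> cball x0 \<rho>" "\<And>x. x \<in> cball x0 \<rho> \<Longrightarrow> Re (W x) \<le> Re (W p)"
    using continuous_attains_sup[of "cball x0 \<rho>" "\<lambda>x. Re (W x)"] by blast
  have "Re (G x0) \<le> Re (W p)" using p(2)[of x0] \<rho>(1) by (simp add: ReW hx0)
  have pball: "p \<in> ball x0 \<rho>"
  proof (rule ccontr)
    assume "p \<notin> ball x0 \<rho>"
    then have ps: "p \<in> sphere x0 \<rho>" using p(1) by simp
    show False
    proof (cases "dist p y \<le> R")
      case True
      then show ?thesis using \<epsilon>(2)[of p] ps \<open>Re (G x0) \<le> Re (W p)\<close> by (auto simp: K_def ReW dist_commute)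
    next
      case False
      then have "\<epsilon> * ?h p < 0" using hneg[OF p(1)] \<epsilon>(1) by (simp add: mult_pos_neg)
      then show ?thesis using max[of p] p(1) cU \<open>Re (G x0) \<le> Re (W p)\<close> by (auto simp: ReW)
    qed
  qed
  have "ball x0 \<rho> \<subseteq> U" using cU by auto
  then have "smooth_on (ball x0 \<rho>) W"
    using smW smooth_on_subset by blast
  then have "Re (pd i (pd i W) p) \<le> 0" for i
    by (rule local_max_second_derivative) (use pball p(2) in auto)
  then have "Re (laplacian W p) \<le> 0" by (simp add: laplacian_vec sum_nonpos)
  moreover have "laplacian W p = laplacian G p + of_real \<epsilon> * laplacian (\<lambda>x. of_real (?h x)) p"
    unfolding W_def[abs_def] using p(1) cU
    by (subst laplacian_add[OF G smooth_on_mult[OF U(1) smooth_on_const smooth_on_barrier[OF U(1)]] U(1)])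
      (auto simp: laplacian_cmult[OF smooth_on_barrier[OF U(1)] U(1)])
  moreover have "laplacian G p = 0" using harm p(1) cU by blast
  ultimately show False using mult_pos_pos[OF \<epsilon>(1) lap[OF p(1)]] by simp
qed

text \<open>Homogeneity of degree 0 makes the maximum over the unit sphere a global one. The set
  \<open>Z\<close> where it is attained is closed; it is also open, for otherwise a ball that avoids
  \<open>Z\<close> would touch it, against \<open>no_touching_ball\<close>. Dimension at least 2
  makes the punctured space connected.\<close>

lemma harmonic_homogeneous_0_Re_const:
  fixes G :: "real^'n \<Rightarrow> complex"
  assumes G: "smooth_on (- {0}) G" and harm: "\<And>x. x \<noteq> 0 \<Longrightarrow> laplacian G x = 0"
    and hom: "\<And>t x. t > 0 \<Longrightarrow> x \<noteq> 0 \<Longrightarrow> G (t *\<^sub>R x) = G x" and n: "CARD('n) \<ge> 2"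
  shows "\<exists>c. \<forall>x. x \<noteq> 0 \<longrightarrow> Re (G x) = c"
proof -
  have cont: "continuous_on (- {0}) (\<lambda>x. Re (G x))"
    using smooth_on_continuous[OF G] by (intro continuous_intros)
  have "sphere (0::real^'n) 1 \<subseteq> - {0}" "sphere (0::real^'n) 1 \<noteq> {}" by auto
  then obtain p where p: "norm p = 1" "\<And>x. norm x = 1 \<Longrightarrow> Re (G x) \<le> Re (G p)"
    using continuous_attains_sup[OF compact_sphere _ continuous_on_subset[OF cont, of "sphere 0 1"]]
    by auto
  have max: "Re (G x) \<le> Re (G p)" if "x \<noteq> 0" for x
  proof -
    have "G x = G (x /\<^sub>R norm x)" using hom[of "inverse (norm x)" x] that by simp
    then show ?thesis using p(2)[of "x /\<^sub>R norm x"] that by simp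
  qed
  define Z where "Z = {x \<in> - {0}. Re (G x) = Re (G p)}"
  have closed: "closedin (top_of_set (- {0})) Z"
    unfolding Z_def using continuous_closedin_preimage_constant[OF cont] .
  have "openin (top_of_set (- {0})) Z"
  proof -
    have "\<exists>e>0. ball z e \<subseteq> Z" if z: "z \<in> Z" for z
    proof (rule ccontr)
      assume no: "\<not> (\<exists>e>0. ball z e \<subseteq> Z)"
      have z0: "norm z > 0" using z by (auto simp: Z_def)
      \<comment> \<open>A quarter of the norm is small enough for the ball about \<open>y\<close>
        through \<open>z\<close> to miss the origin.\<close>
      then have "norm z / 4 > 0" by simp
      then have "\<not> ball z (norm z / 4) \<subseteq> Z" using no by blast
      then obtain y where "y \<in> ball z (norm z / 4)" and y: "y \<notin> Z" by blast
      then have y: "dist z y < norm z / 4" "y \<notin> Z" by auto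
      have nz: "x \<noteq> 0" if "dist x y \<le> dist z y" for x
      proof
        assume "x = 0"
        then have "norm y \<le> dist z y" using that by simp
        moreover have "norm z \<le> dist z y + norm y" using norm_triangle_sub[of z y] by (simp add: dist_norm)
        ultimately show False using y(1) z0 by linarith
      qed
      define K where "K = {x \<in> cball y (dist z y). Re (G x) = Re (G p)}"
      have "cball y (dist z y) \<subseteq> - {0}"
      proof
        fix x assume "x \<in> cball y (dist z y)"
        then have "dist x y \<le> dist z y" by (simp add: dist_commute)
        from nz[OF this] show "x \<in> - {0}" by simp
      qed
      then have "continuous_on (cball y (dist z y)) (\<lambda>x. Re (G x))"
        using cont continuous_on_subset by blast
      then have "closed K"
        unfolding K_def using continuous_closed_preimage_constant[of "cball y (dist z y)"] by simp
      moreover have "K \<noteq> {}" using z by (auto simp: K_def Z_def dist_commute)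
      ultimately obtain x0 where x0: "x0 \<in> K" "\<And>x. x \<in> K \<Longrightarrow> dist y x0 \<le> dist y x"
        using distance_attains_inf[of K y] by blast
      define R where "R = dist x0 y"
      have "y \<noteq> 0" using nz[of y] by simp
      then have "Re (G y) \<noteq> Re (G p)" using y(2) by (auto simp: Z_def)
      then have R: "R > 0" using x0(1) by (auto simp: R_def K_def)
      have RZ: "R \<le> dist z y" using x0(1) by (auto simp: R_def K_def dist_commute)
      \<comment> \<open>The ball of radius \<open>R\<close> about \<open>y\<close> may touch
        \<open>Z\<close> at several points; the ball of half the radius, tangent to it from inside
        at \<open>x0\<close>, touches only there.\<close>
      define m where "m = midpoint x0 y"
      have m: "dist x0 m = R / 2" "dist m y = R / 2" by (simp_all add: m_def R_def dist_midpoint)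
      have x0p: "Re (G x0) = Re (G p)" using x0(1) by (simp add: K_def)
      show False
      proof (rule no_touching_ball[OF G])
        show "open (- {0::real^'n})" by auto
        show "x0 \<in> - {0}" using nz[of x0] RZ by (auto simp: R_def)
        show "Re (G x) \<le> Re (G x0)" if "x \<in> - {0}" for x using max that x0p by simp
        show "R / 2 > 0" using R by simp
        show "dist x0 m = R / 2" by (rule m)
        show "Re (G x) < Re (G x0)" if x: "x \<in> - {0}" "dist x m \<le> R / 2" "x \<noteq> x0" for x
        proof (rule ccontr)
          assume "\<not> Re (G x) < Re (G x0)"
          then have eq: "Re (G x) = Re (G p)" using max[of x] x x0p by simp
          have dxy: "dist x y \<le> R" using dist_triangle[of x y m] x(2) m(2) by simp
          then have "x \<in> K" using eq RZ by (auto simp: K_def dist_commute)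
          then have "R \<le> dist x y" using x0(2)[of x] by (simp add: R_def dist_commute)
          with dxy have xy: "norm (x - y) = R" by (simp add: dist_norm)
          have my: "m - y = x0 - m" using midpoint_eq_iff[of x0 y m] by (simp add: m_def[symmetric] algebra_simps)
          \<comment> \<open>Prepares the parallelogram law for x - m and x0 - m: since |x - y| = R
            and both vectors have length at most R/2, it forces x = x0.\<close>
          have "x - y = (x - m) + (x0 - m)" using my by (simp add: algebra_simps)
          moreover have "x - x0 = (x - m) - (x0 - m)" by simp
          moreover have "norm (a + b) ^ 2 + norm (a - b) ^ 2 = 2 * norm a ^ 2 + 2 * norm b ^ 2" for a b :: "real^'n"
            by (simp add: power2_norm_eq_inner inner_simps inner_commute)
          ultimately have "norm (x - y) ^ 2 + norm (x - x0) ^ 2 = 2 * norm (x - m) ^ 2 + 2 * norm (x0 - m) ^ 2"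
            by (metis (no_types))
          moreover have "norm (x - m) ^ 2 \<le> (R / 2)\<^sup>2"
            using x(2) by (intro power_mono) (auto simp: dist_norm)
          moreover have "norm (x0 - m) ^ 2 = (R / 2)\<^sup>2" using m(1) unfolding dist_norm by (rule arg_cong)
          moreover have "norm (x - y) ^ 2 = 4 * (R / 2)\<^sup>2" using xy by (simp add: power_divide)
          ultimately have "norm (x - x0) ^ 2 \<le> 0" by linarith
          then show False using x(3) by simp
        qed
      qed (use harm in auto)
    qed
    then have "open Z" unfolding open_contains_ball by blast
    then show ?thesis by (rule open_openin_trans[rotated]) (auto simp: Z_def)
  qed
  moreover have "connected (- {0::real^'n})"
    using connected_punctured_universe[of "0::real^'n"] n by simp
  moreover have "p \<in> Z" using p(1) by (auto simp: Z_def)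
  ultimately have "Z = - {0}" using closed unfolding connected_clopen by blast
  then show ?thesis unfolding Z_def by blast
qed

lemma harmonic_homogeneous_0_const:
  fixes G :: "real^'n \<Rightarrow> complex"
  assumes G: "smooth_on (- {0}) G" and harm: "\<And>x. x \<noteq> 0 \<Longrightarrow> laplacian G x = 0"
    and hom: "\<And>t x. t > 0 \<Longrightarrow> x \<noteq> 0 \<Longrightarrow> G (t *\<^sub>R x) = G x" and n: "CARD('n) \<ge> 2"
  shows "\<exists>c. \<forall>x. x \<noteq> 0 \<longrightarrow> G x = c"
proof -
  obtain a where a: "\<And>x. x \<noteq> 0 \<Longrightarrow> Re (G x) = a"
    using harmonic_homogeneous_0_Re_const[OF assms] by blast
  have "\<exists>c. \<forall>x. x \<noteq> 0 \<longrightarrow> Re (- \<i> * G x) = c"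
  proof (rule harmonic_homogeneous_0_Re_const)
    show "smooth_on (- {0}) (\<lambda>x. - \<i> * G x)" by (intro smooth_on_mult smooth_on_const G) auto
    show "laplacian (\<lambda>x. - \<i> * G x) x = 0" if "x \<noteq> 0" for x
      using that harm by (subst laplacian_cmult[OF G]) auto
  qed (use hom n in auto)
  then obtain b where b: "\<And>x. x \<noteq> 0 \<Longrightarrow> Im (G x) = b" by auto
  have "\<forall>x. x \<noteq> 0 \<longrightarrow> G x = Complex a b" using a b by (simp add: complex_eq_iff)
  then show ?thesis by blast
qed

section \<open>Dimensions and traces in function spaces\<close>

interpretation cf: vector_space "scale_fun :: complex \<Rightarrow> ('a \<Rightarrow> complex) \<Rightarrow> 'a \<Rightarrow> complex"
  by (rule vector_space_scale_fun)

interpretation cfp: vector_space_pair "scale_fun :: complex \<Rightarrow> ('a \<Rightarrow> complex) \<Rightarrow> 'a \<Rightarrow> complex"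
  "scale_fun :: complex \<Rightarrow> ('b \<Rightarrow> complex) \<Rightarrow> 'b \<Rightarrow> complex" ..

definition fin_dim :: "('a \<Rightarrow> complex) set \<Rightarrow> bool" where
  "fin_dim V \<longleftrightarrow> cf.subspace V \<and> (\<exists>S. finite S \<and> V \<subseteq> cf.span S)"

text \<open>Linearity is required on \<open>V\<close> only, because the additivity of
  \<open>laplacian\<close> and \<open>pd\<close> depends on differentiability.\<close>

definition lin_map :: "('a \<Rightarrow> complex) set \<Rightarrow> ('b \<Rightarrow> complex) set \<Rightarrow> (('a \<Rightarrow> complex) \<Rightarrow> 'b \<Rightarrow> complex) \<Rightarrow> bool" where
  "lin_map V W A \<longleftrightarrow> A ` V \<subseteq> W \<and> (\<forall>f\<in>V. \<forall>g\<in>V. A (f + g) = A f + A g) \<and>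
     (\<forall>c. \<forall>f\<in>V. A (scale_fun c f) = scale_fun c (A f))"

definition basis_of :: "('a \<Rightarrow> complex) set \<Rightarrow> ('a \<Rightarrow> complex) set" where
  "basis_of V = (SOME B. B \<subseteq> V \<and> cf.independent B \<and> V \<subseteq> cf.span B)"

definition lin_trace :: "('a \<Rightarrow> complex) set \<Rightarrow> (('a \<Rightarrow> complex) \<Rightarrow> 'a \<Rightarrow> complex) \<Rightarrow> complex" where
  "lin_trace V A = (\<Sum>b\<in>basis_of V. cf.representation (basis_of V) (A b) b)"

lemma basis_of:
  assumes "fin_dim V"
  shows "basis_of V \<subseteq> V" "cf.independent (basis_of V)" "cf.span (basis_of V) = V"
    "finite (basis_of V)" "card (basis_of V) = cf.dim V"
proof -
  have "\<exists>B. B \<subseteq> V \<and> cf.independent B \<and> V \<subseteq> cf.span B" using cf.basis_exists by metis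
  then have B: "basis_of V \<subseteq> V \<and> cf.independent (basis_of V) \<and> V \<subseteq> cf.span (basis_of V)"
    unfolding basis_of_def by (rule someI_ex)
  then show "basis_of V \<subseteq> V" "cf.independent (basis_of V)" by auto
  show sp: "cf.span (basis_of V) = V"
    using B assms by (simp add: cf.span_subspace fin_dim_def)
  show "finite (basis_of V)"
    using assms B cf.independent_span_bound unfolding fin_dim_def by (meson subset_trans)
  show "card (basis_of V) = cf.dim V"
    using cf.dim_eq_card[of "basis_of V" V] B sp by (metis cf.span_span)
qed

lemma lin_mapD:
  assumes "lin_map V W A"
  shows "f \<in> V \<Longrightarrow> A f \<in> W" "f \<in> V \<Longrightarrow> g \<in> V \<Longrightarrow> A (f + g) = A f + A g"
    "f \<in> V \<Longrightarrow> A (scale_fun c f) = scale_fun c (A f)"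
  using assms by (auto simp: lin_map_def)

lemma lin_map_sum:
  assumes "lin_map V W A" "fin_dim V" "\<And>i. i \<in> I \<Longrightarrow> f i \<in> V"
  shows "A (\<Sum>i\<in>I. scale_fun (c i) (f i)) = (\<Sum>i\<in>I. scale_fun (c i) (A (f i)))"
  using assms(3)
proof (induction I rule: infinite_finite_induct)
  case (insert i I)
  have V: "cf.subspace V" using assms(2) by (simp add: fin_dim_def)
  have "(\<Sum>i\<in>I. scale_fun (c i) (f i)) \<in> V" "scale_fun (c i) (f i) \<in> V"
    using insert by (auto intro!: cf.subspace_sum cf.subspace_scale V)
  then show ?case
    using insert by (simp only: sum.insert lin_mapD[OF assms(1)] insertI1 insert_iff simp_thms)
next
  case empty
  have "0 \<in> V" using assms(2) cf.subspace_0 by (auto simp: fin_dim_def)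
  then have "A (scale_fun 0 0) = scale_fun 0 (A 0)" by (rule lin_mapD[OF assms(1)])
  then show ?case by (simp add: scale_fun_def zero_fun_def)
next
  case (infinite I)
  have "0 \<in> V" using assms(2) cf.subspace_0 by (auto simp: fin_dim_def)
  then have "A (scale_fun 0 0) = scale_fun 0 (A 0)" by (rule lin_mapD[OF assms(1)])
  then show ?case using infinite by (simp add: scale_fun_def zero_fun_def)
qed

lemma basis_of_expand:
  assumes "fin_dim V" "f \<in> V"
  shows "f = (\<Sum>b\<in>basis_of V. scale_fun (cf.representation (basis_of V) f b) b)"
  using assms basis_of[OF assms(1)] by (intro cf.sum_representation_eq[symmetric]) auto

text \<open>The device behind the dimension and character formulas: a trace is moved from one space
  to another, usually of different degree, where the composite is simpler.\<close>

lemma lin_trace_commute: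
  assumes V: "fin_dim V" and W: "fin_dim W" and A: "lin_map V W A" and B: "lin_map W V B"
  shows "lin_trace V (\<lambda>f. B (A f)) = lin_trace W (\<lambda>f. A (B f))"
proof -
  have *: "lin_trace V (\<lambda>f. B (A f)) = (\<Sum>v\<in>basis_of V. \<Sum>w\<in>basis_of W.
      cf.representation (basis_of W) (A v) w * cf.representation (basis_of V) (B w) v)"
    if V: "fin_dim V" and W: "fin_dim W" and A: "lin_map V W A" and B: "lin_map W V B" 
    for V :: "('c \<Rightarrow> complex) set" and W :: "('d \<Rightarrow> complex) set" and A B
  proof -
    let ?RV = "cf.representation (basis_of V)" and ?RW = "cf.representation (basis_of W)"
    have "?RV (B (A v)) v = (\<Sum>w\<in>basis_of W. ?RW (A v) w * ?RV (B w) v)" if v: "v \<in> basis_of V" for v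
    proof -
      have "A v \<in> W" using basis_of(1)[OF V] v lin_mapD(1)[OF A] by blast
      then have "B (A v) = B (\<Sum>w\<in>basis_of W. scale_fun (?RW (A v) w) w)"
        using basis_of_expand[OF W] by metis
      also have "\<dots> = (\<Sum>w\<in>basis_of W. scale_fun (?RW (A v) w) (B w))"
        using basis_of(1)[OF W] by (intro lin_map_sum[OF B W]) auto
      finally have "?RV (B (A v)) = ?RV (\<Sum>w\<in>basis_of W. scale_fun (?RW (A v) w) (B w))" by simp
      moreover have "B w \<in> cf.span (basis_of V)" if "w \<in> basis_of W" for w
        using basis_of(1)[OF W] basis_of(3)[OF V] lin_mapD(1)[OF B] that by auto
      ultimately show ?thesis
        using basis_of(2)[OF V]
        by (simp add: cf.representation_sum cf.representation_scale cf.span_scale)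
    qed
    then show ?thesis by (simp add: lin_trace_def)
  qed
  show ?thesis
    unfolding *[OF V W A B] *[OF W V B A] by (subst sum.swap) (simp add: mult.commute)
qed

lemma lin_trace_cong: "(\<And>f. f \<in> V \<Longrightarrow> A f = B f) \<Longrightarrow> fin_dim V \<Longrightarrow> lin_trace V A = lin_trace V B"
  unfolding lin_trace_def by (intro sum.cong refl) (metis basis_of(1) subsetD)

lemma lin_trace_id:
  assumes "fin_dim V"
  shows "lin_trace V (\<lambda>f. f) = of_nat (cf.dim V)"
proof -
  have "lin_trace V (\<lambda>f. f) = (\<Sum>b\<in>basis_of V. 1)"
    unfolding lin_trace_def using basis_of(2)[OF assms]
    by (intro sum.cong) (auto simp: cf.representation_basis)
  then show ?thesis using basis_of(5)[OF assms] by simp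
qed

lemma lin_trace_lincomb:
  assumes V: "fin_dim V" and A: "\<And>i f. i \<in> I \<Longrightarrow> f \<in> V \<Longrightarrow> A i f \<in> V"
  shows "lin_trace V (\<lambda>f. \<Sum>i\<in>I. scale_fun (c i) (A i f)) = (\<Sum>i\<in>I. c i * lin_trace V (A i))"
proof -
  have in_span: "A i b \<in> cf.span (basis_of V)" if "i \<in> I" "b \<in> basis_of V" for i b
    using A that basis_of(1,3)[OF V] by auto
  have "lin_trace V (\<lambda>f. \<Sum>i\<in>I. scale_fun (c i) (A i f)) =
    (\<Sum>b\<in>basis_of V. \<Sum>i\<in>I. c i * cf.representation (basis_of V) (A i b) b)"
    unfolding lin_trace_def using in_span basis_of(2)[OF V]
    by (intro sum.cong) (auto simp: cf.representation_sum cf.representation_scale cf.span_scale)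
  then show ?thesis unfolding lin_trace_def by (simp add: sum.swap[of _ I] sum_distrib_left)
qed

lemma fin_dim_subset:
  assumes "fin_dim V" "cf.subspace W" "W \<subseteq> V"
  shows "fin_dim W"
  using assms unfolding fin_dim_def by (meson subset_trans)

text \<open>\<open>P\<close> is factored through \<open>W\<close> and commuted with the inclusion,
  which leaves the identity of \<open>W\<close>.\<close>

lemma lin_trace_projection:
  assumes V: "fin_dim V" and W: "cf.subspace W" "W \<subseteq> V" and P: "lin_map V W P" "\<And>f. f \<in> W \<Longrightarrow> P f = f"
  shows "lin_trace V P = of_nat (cf.dim W)"
proof -
  have fW: "fin_dim W" using fin_dim_subset V W .
  have "lin_map W V (\<lambda>f. f)" using W(2) by (auto simp: lin_map_def)
  from lin_trace_commute[OF V fW P(1) this] have "lin_trace V P = lin_trace W P" by simp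
  also have "\<dots> = lin_trace W (\<lambda>f. f)" by (rule lin_trace_cong[OF P(2) fW])
  finally show ?thesis using lin_trace_id[OF fW] by simp
qed

lemma lin_map_injective_surjective:
  assumes V: "fin_dim V" and T: "lin_map V V T" and inj: "\<And>f. f \<in> V \<Longrightarrow> T f = 0 \<Longrightarrow> f = 0"
  shows "T ` V = V"
proof -
  let ?B = "basis_of V"
  have sV: "cf.subspace V" using V by (simp add: fin_dim_def)
  \<comment> \<open>\<open>T\<close> is linear on \<open>V\<close> only. A globally linear map with
    the same values on a basis brings in the theory of spans and independent images.\<close>
  obtain L where L: "Vector_Spaces.linear scale_fun scale_fun L" "\<And>b. b \<in> ?B \<Longrightarrow> L b = T b"
    using cfp.linear_independent_extend[OF basis_of(2)[OF V], of T] by blast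
  interpret L: Vector_Spaces.linear scale_fun scale_fun L by (rule L(1))
  have LT: "L f = T f" if "f \<in> V" for f
  proof -
    have "L f = (\<Sum>b\<in>?B. scale_fun (cf.representation ?B f b) (L b))"
      by (subst basis_of_expand[OF V that]) (simp add: L.sum L.scale)
    also have "\<dots> = (\<Sum>b\<in>?B. scale_fun (cf.representation ?B f b) (T b))"
      using L(2) by (intro sum.cong) auto
    also have "\<dots> = T (\<Sum>b\<in>?B. scale_fun (cf.representation ?B f b) b)"
      using basis_of(1)[OF V] by (intro lin_map_sum[OF T V, symmetric]) auto
    also have "\<dots> = T f" using basis_of_expand[OF V that] by simp
    finally show ?thesis .
  qed
  have "inj_on L (cf.span ?B)"
    unfolding basis_of(3)[OF V]
  proof (rule inj_onI)
    fix f g assume fg: "f \<in> V" "g \<in> V" "L f = L g"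
    then have "f - g \<in> V" using sV cf.subspace_diff by blast
    moreover have "T (f - g) = 0" using fg LT[OF \<open>f - g \<in> V\<close>] by (simp add: L.diff)
    ultimately have "f - g = 0" by (rule inj)
    then show "f = g" by (simp only: right_minus_eq)
  qed
  note inj_L = this
  have indep: "cf.independent (L ` ?B)"
    by (rule L.independent_injective_image[OF basis_of(2)[OF V] inj_L])
  have card: "card (L ` ?B) = card ?B"
    by (rule card_image[OF inj_on_subset[OF inj_L cf.span_superset]])
  have sub: "L ` ?B \<subseteq> V" using L(2) basis_of(1)[OF V] lin_mapD(1)[OF T] by auto
  have "V \<subseteq> cf.span (L ` ?B)"
  proof (rule ccontr)
    assume "\<not> V \<subseteq> cf.span (L ` ?B)"
    then obtain v where v: "v \<in> V" "v \<notin> cf.span (L ` ?B)" by blast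
    then have "cf.independent (insert v (L ` ?B))" using cf.independent_insertI[OF v(2) indep] by simp
    then have "card (insert v (L ` ?B)) \<le> card ?B"
      using cf.independent_span_bound[OF basis_of(4)[OF V], of "insert v (L ` ?B)"]
      unfolding basis_of(3)[OF V] using v(1) sub by simp
    moreover have "v \<notin> L ` ?B" using v(2) cf.span_base[of v "L ` ?B"] by metis
    ultimately show False using card basis_of(4)[OF V] by simp
  qed
  also have "\<dots> = L ` V" using L.span_image[of ?B] basis_of(3)[OF V] by simp
  finally show ?thesis using LT lin_mapD(1)[OF T] by (auto simp: image_iff)
qed

section \<open>Homogeneous polynomials\<close>

primrec mons :: "nat \<Rightarrow> (real^'n \<Rightarrow> complex) set" where
  "mons 0 = {\<lambda>x. 1}"
| "mons (Suc k) = (\<lambda>(i, m) x. of_real (x$i) * m x) ` (UNIV \<times> mons k)"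

definition hpoly :: "nat \<Rightarrow> (real^'n \<Rightarrow> complex) set" where
  "hpoly k = cf.span (mons k)"

lemma mons_SucE:
  assumes "m \<in> mons (Suc k)"
  obtains j m' where "m = (\<lambda>x. of_real (x$j) * m' x)" "m' \<in> mons k"
  using assms by auto

lemma finite_mons: "finite (mons k)"
  by (induction k) auto

lemma fin_dim_hpoly: "fin_dim (hpoly k)"
  unfolding fin_dim_def hpoly_def using finite_mons by (blast intro: cf.subspace_span)

lemma subspace_hpoly: "cf.subspace (hpoly k)"
  by (simp add: hpoly_def)

lemma hpoly_add: "p \<in> hpoly k \<Longrightarrow> q \<in> hpoly k \<Longrightarrow> (\<lambda>x. p x + q x) \<in> hpoly k"
  using cf.span_add[of p "mons k" q] by (simp add: hpoly_def plus_fun_def)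

lemma hpoly_cmult: "p \<in> hpoly k \<Longrightarrow> (\<lambda>x. c * p x) \<in> hpoly k"
  using cf.span_scale[of p "mons k" c] by (simp add: hpoly_def scale_fun_def)

lemma hpoly_0: "(\<lambda>x. 0) \<in> hpoly k"
  using cf.span_zero[of "mons k"] by (simp add: hpoly_def zero_fun_def)

lemma hpoly_sum: "(\<And>i. i \<in> I \<Longrightarrow> p i \<in> hpoly k) \<Longrightarrow> (\<lambda>x. \<Sum>i\<in>I. p i x) \<in> hpoly k"
  by (induction I rule: infinite_finite_induct) (auto simp: hpoly_0 intro: hpoly_add)

text \<open>Span induction in pointwise form. Membership of the parts in \<open>hpoly k\<close>
  stays available because the differentiation rules ask for it.\<close>

lemma hpoly_induct [consumes 1, case_names mons zero add cmult]:
  assumes "p \<in> hpoly k" "\<And>m. m \<in> mons k \<Longrightarrow> P m" "P (\<lambda>x. 0)"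
    "\<And>p q. p \<in> hpoly k \<Longrightarrow> q \<in> hpoly k \<Longrightarrow> P p \<Longrightarrow> P q \<Longrightarrow> P (\<lambda>x. p x + q x)"
    "\<And>c p. p \<in> hpoly k \<Longrightarrow> P p \<Longrightarrow> P (\<lambda>x. c * p x)"
  shows "P p"
proof -
  have "p \<in> hpoly k \<and> P p"
    using assms(1) unfolding hpoly_def
  proof (rule cf.span_induct)
    show "cf.subspace {p. p \<in> cf.span (mons k) \<and> P p}"
    proof (rule cf.subspaceI; unfold hpoly_def[symmetric] mem_Collect_eq)
      show "0 \<in> hpoly k \<and> P 0" using assms(3) hpoly_0 by (simp add: zero_fun_def)
      show "p + q \<in> hpoly k \<and> P (p + q)" if "p \<in> hpoly k \<and> P p" "q \<in> hpoly k \<and> P q" for p q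
        using that assms(4)[of p q] hpoly_add[of p k q] unfolding plus_fun_def by blast
      show "scale_fun c p \<in> hpoly k \<and> P (scale_fun c p)" if "p \<in> hpoly k \<and> P p" for c p
        using that assms(5)[of p c] hpoly_cmult[of p k c] unfolding scale_fun_def by blast
    qed
    show "m \<in> mons k \<Longrightarrow> m \<in> cf.span (mons k) \<and> P m" for m
      using assms(2) cf.span_base by blast
  qed
  then show ?thesis ..
qed

lemma mons_in_hpoly: "m \<in> mons k \<Longrightarrow> m \<in> hpoly k"
  by (simp add: hpoly_def cf.span_base)

lemma hpoly_coord_mult: "p \<in> hpoly k \<Longrightarrow> (\<lambda>x. of_real (x$i) * p x) \<in> hpoly (Suc k)"
proof (induction rule: hpoly_induct)
  case (mons m)
  then have "(\<lambda>x. of_real (x$i) * m x) \<in> mons (Suc k)" by (auto intro!: image_eqI[of _ _ "(i, m)"])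
  then show ?case by (rule mons_in_hpoly)
next
  case (add p q)
  then show ?case using hpoly_add by (fastforce simp: distrib_left)
next
  case (cmult c p)
  then show ?case using hpoly_cmult[of _ "Suc k" c] by (fastforce simp: mult.left_commute)
qed (simp add: hpoly_0)

lemma mons_smooth: "m \<in> mons k \<Longrightarrow> open U \<Longrightarrow> smooth_on U m"
  by (induction k arbitrary: m) (auto intro!: smooth_on_const smooth_on_mult smooth_on_coord)

lemma hpoly_smooth: "p \<in> hpoly k \<Longrightarrow> open U \<Longrightarrow> smooth_on U p"
  by (induction rule: hpoly_induct)
    (auto intro: mons_smooth smooth_on_const smooth_on_add smooth_on_mult)

lemma hpoly_differentiable: "p \<in> hpoly k \<Longrightarrow> p differentiable (at x)"
  using smooth_on_differentiable[OF hpoly_smooth] by blast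

lemma pd_coord_mult: "p differentiable (at x) \<Longrightarrow>
    pd i (\<lambda>x. of_real (x$j) * p x) x = of_real (x$j) * pd i p x + (if i = j then 1 else 0) * p x"
  by (simp add: pd_mult differentiable_coord pd_coord)

lemma hpoly_pd_0:
  assumes "p \<in> hpoly 0"
  shows "pd i p = (\<lambda>x. 0)"
  using assms
  by (induction rule: hpoly_induct)
    (auto simp: pd_const[abs_def] fun_eq_iff pd_add pd_cmult hpoly_differentiable)

lemma hpoly_pd:
  assumes "p \<in> hpoly (Suc k)"
  shows "pd i p \<in> hpoly k"
proof -
  have *: "pd i m \<in> hpoly k" if "m \<in> mons (Suc k)" for m :: "real^'a \<Rightarrow> complex" and i
    using that
  proof (induction k arbitrary: m)
    case 0
    then obtain j where "m = (\<lambda>x. of_real (x$j))" by auto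
    then have "pd i m = (\<lambda>x. if i = j then 1 else 0)"
      by (intro ext) (simp add: pd_coord)
    then show ?case using mons_in_hpoly[of "\<lambda>x. 1" 0] hpoly_0 by auto
  next
    case (Suc k)
    from Suc.prems obtain j m' where m: "m = (\<lambda>x. of_real (x$j) * m' x)" "m' \<in> mons (Suc k)"
      by (rule mons_SucE)
    have "pd i m = (\<lambda>x. of_real (x$j) * pd i m' x + (if i = j then 1 else 0) * m' x)"
      unfolding m(1) using hpoly_differentiable[OF mons_in_hpoly[OF m(2)]]
      by (simp add: pd_coord_mult fun_eq_iff)
    then show ?case
      using Suc.IH[OF m(2)] mons_in_hpoly[OF m(2)] by (auto intro!: hpoly_add hpoly_cmult hpoly_coord_mult)
  qed
  show ?thesis using assms
  proof (induction rule: hpoly_induct)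
    case (add p q)
    then have "pd i (\<lambda>x. p x + q x) = (\<lambda>x. pd i p x + pd i q x)"
      by (auto simp: fun_eq_iff pd_add hpoly_differentiable)
    then show ?case using add by (simp add: hpoly_add)
  next
    case (cmult c p)
    then have "pd i (\<lambda>x. c * p x) = (\<lambda>x. c * pd i p x)"
      by (auto simp: fun_eq_iff pd_cmult hpoly_differentiable)
    then show ?case using cmult by (simp add: hpoly_cmult)
  next
    case zero
    then show ?case using hpoly_0 pd_const[of i 0] by (simp add: fun_eq_iff[symmetric] pd_const[abs_def])
  qed (rule *)
qed

lemma hpoly_euler: "p \<in> hpoly k \<Longrightarrow> (\<Sum>i\<in>UNIV. of_real (x$i) * pd i p x) = of_nat k * p x"
proof (induction arbitrary: x rule: hpoly_induct)
  case (mons m)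
  then show ?case
  proof (induction k arbitrary: m)
    case 0
    then show ?case by (auto simp: pd_const)
  next
    case (Suc k)
    from Suc.prems obtain j m' where m: "m = (\<lambda>x. of_real (x$j) * m' x)" "m' \<in> mons k"
      by (rule mons_SucE)
    have "(\<Sum>i\<in>UNIV. of_real (x$i) * pd i m x) =
       of_real (x$j) * (\<Sum>i\<in>UNIV. of_real (x$i) * pd i m' x)
       + (\<Sum>i\<in>UNIV. if i = j then of_real (x$j) * m' x else 0)"
      unfolding m(1) pd_coord_mult[OF hpoly_differentiable[OF mons_in_hpoly[OF m(2)]]]
      by (simp add: distrib_left sum.distrib sum_distrib_left mult.left_commute if_distrib[of "\<lambda>u. _ * u"]
          if_distrib[of "\<lambda>u. u * _"] cong: if_cong)
    then show ?case using Suc.IH[OF m(2)] by (simp add: m(1) algebra_simps)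
  qed
next
  case (add p q)
  then show ?case by (simp add: pd_add hpoly_differentiable distrib_left sum.distrib)
next
  case (cmult c p)
  have "(\<Sum>i\<in>UNIV. of_real (x$i) * pd i (\<lambda>x. c * p x) x) = c * (\<Sum>i\<in>UNIV. of_real (x$i) * pd i p x)"
    by (simp add: pd_cmult hpoly_differentiable[OF cmult(1)] sum_distrib_left mult_ac)
  then show ?case using cmult by simp
qed (simp add: pd_const)

lemma mons_homogeneous: "m \<in> mons k \<Longrightarrow> m (t *\<^sub>R x) = of_real (t ^ k) * m x"
  by (induction k arbitrary: m) (auto simp: mult_ac)

lemma hpoly_homogeneous: "p \<in> hpoly k \<Longrightarrow> p (t *\<^sub>R x) = of_real (t ^ k) * p x"
  by (induction rule: hpoly_induct) (auto simp: mons_homogeneous algebra_simps)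

lemma hpoly_comp:
  fixes g :: "real^'n^'n"
  assumes "p \<in> hpoly k"
  shows "(\<lambda>x. p (g *v x)) \<in> hpoly k"
proof -
  have *: "(\<lambda>x. m (g *v x)) \<in> hpoly k" if "m \<in> mons k" for m
    using that
  proof (induction k arbitrary: m)
    case 0
    then show ?case using mons_in_hpoly[of m 0] by auto
  next
    case (Suc k)
    from Suc.prems obtain j m' where m: "m = (\<lambda>x. of_real (x$j) * m' x)" "m' \<in> mons k" by (rule mons_SucE)
    have "(\<lambda>x. m (g *v x)) = (\<lambda>x. \<Sum>i\<in>UNIV. of_real (g$j$i) * (of_real (x$i) * m' (g *v x)))"
      by (simp add: m(1) matrix_vector_mult_def sum_distrib_right mult.assoc)
    then show ?case using Suc.IH[OF m(2)] by (auto intro!: hpoly_sum hpoly_cmult hpoly_coord_mult)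
  qed
  show ?thesis using assms
    by (induction rule: hpoly_induct) (auto intro: * hpoly_0 hpoly_add hpoly_cmult)
qed

lemma hpoly_laplacian: "p \<in> hpoly (Suc (Suc k)) \<Longrightarrow> laplacian p \<in> hpoly k"
  unfolding laplacian_vec[abs_def] by (intro hpoly_sum hpoly_pd)

lemma hpoly_laplacian_low:
  assumes "p \<in> hpoly k" "k < 2"
  shows "laplacian p = (\<lambda>x. 0)"
proof -
  have "pd i (pd i p) = (\<lambda>x. 0)" for i
  proof (cases k)
    case 0
    then have "pd i p = (\<lambda>x. 0)" using assms hpoly_pd_0 by blast
    then have "pd i (pd i p) = pd i (\<lambda>x. 0)" by simp
    also have "\<dots> = (\<lambda>x. 0)" by (rule ext) (rule pd_const)
    finally show ?thesis .
  next
    case (Suc j)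
    then show ?thesis using assms hpoly_pd_0[OF hpoly_pd[of p 0]] by simp
  qed
  then show ?thesis by (simp add: laplacian_vec[abs_def])
qed

lemma hpoly_eq_0_at_0:
  assumes "p \<in> hpoly k" "\<And>x. x \<noteq> 0 \<Longrightarrow> p x = 0"
  shows "p x = 0"
proof (cases "x = 0")
  case True
  \<comment> \<open>Homogeneity at t = 0 gives 0^k times a value off the origin; since 0^0 = 1 this
    is right for constants too.\<close>
  have "p (0 *\<^sub>R axis undefined 1) = of_real (0 ^ k) * p (axis undefined 1)"
    by (rule hpoly_homogeneous[OF assms(1)])
  then show ?thesis using assms(2)[of "axis undefined 1"] True by (simp add: axis_eq_0_iff)
qed (use assms in auto)

lemma pd_comp:
  fixes g :: "real^'n^'n"
  assumes "F differentiable (at (g *v x))"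
  shows "pd i (\<lambda>x. F (g *v x)) x = (\<Sum>c\<in>UNIV. of_real (g$c$i) * pd c F (g *v x))"
proof -
  let ?D = "frechet_derivative F (at (g *v x))"
  have D: "(F has_derivative ?D) (at (g *v x))" using assms frechet_derivative_works by blast
  have "((*v) g has_derivative (*v) g) (at x)"
    by (intro bounded_linear_imp_has_derivative matrix_vector_mul_bounded_linear)
  from has_derivative_compose[OF this D]
  have "pd i (\<lambda>x. F (g *v x)) x = ?D (g *v axis i 1)" by (rule pd_eq)
  also have "g *v axis i 1 = (\<Sum>c\<in>UNIV. g$c$i *\<^sub>R axis c 1)"
    by (simp add: vec_eq_iff matrix_vector_mult_def axis_def if_distrib sum.delta cong: if_cong)
  also have "?D \<dots> = (\<Sum>c\<in>UNIV. g$c$i *\<^sub>R ?D (axis c 1))"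
    using has_derivative_linear[OF D] by (simp add: linear_sum linear_scale)
  finally show ?thesis by (simp add: partial_deriv_def scaleR_conv_of_real)
qed

lemma hpoly_laplacian_comp:
  fixes g :: "real^'n^'n"
  assumes p: "p \<in> hpoly k" and g: "orthogonal_matrix g"
  shows "laplacian (\<lambda>x. p (g *v x)) x = laplacian p (g *v x)"
proof -
  have d: "q differentiable (at y)" if "smooth_on UNIV q" for q :: "real^'n \<Rightarrow> complex" and y
    using smooth_on_differentiable[OF that] by blast
  have sm: "smooth_on UNIV p" using hpoly_smooth[OF p] by blast
  have dcomp: "(\<lambda>x. q (g *v x)) differentiable (at y)" if "smooth_on UNIV q" for q :: "real^'n \<Rightarrow> complex" and y
    using differentiable_chain_at[OF bounded_linear_imp_differentiable[OF
        matrix_vector_mul_bounded_linear] d[OF that]] unfolding o_def .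
  have "pd i (pd i (\<lambda>x. p (g *v x))) x =
      (\<Sum>c\<in>UNIV. \<Sum>e\<in>UNIV. of_real (g$c$i * g$e$i) * pd e (pd c p) (g *v x))" for i
  proof -
    have "pd i (\<lambda>x. p (g *v x)) = (\<lambda>x. \<Sum>c\<in>UNIV. of_real (g$c$i) * pd c p (g *v x))"
      by (rule ext) (rule pd_comp[OF d[OF sm]])
    then have "pd i (pd i (\<lambda>x. p (g *v x))) x = (\<Sum>c\<in>UNIV. pd i (\<lambda>x. of_real (g$c$i) * pd c p (g *v x)) x)"
      using dcomp[OF smooth_on_pd[OF sm]] by (simp add: pd_sum)
    also have "\<dots> = (\<Sum>c\<in>UNIV. of_real (g$c$i) * (\<Sum>e\<in>UNIV. of_real (g$e$i) * pd e (pd c p) (g *v x)))"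
      using dcomp[OF smooth_on_pd[OF sm]] d[OF smooth_on_pd[OF sm]] by (simp add: pd_cmult pd_comp)
    finally show ?thesis by (simp add: sum_distrib_left mult_ac)
  qed
  then have "laplacian (\<lambda>x. p (g *v x)) x =
      (\<Sum>i\<in>UNIV. \<Sum>c\<in>UNIV. \<Sum>e\<in>UNIV. of_real (g$c$i * g$e$i) * pd e (pd c p) (g *v x))"
    by (simp add: laplacian_vec)
  also have "\<dots> = (\<Sum>c\<in>UNIV. \<Sum>e\<in>UNIV. of_real (\<Sum>i\<in>UNIV. g$c$i * g$e$i) * pd e (pd c p) (g *v x))"
  proof -
    have "(\<Sum>i\<in>UNIV. \<Sum>e\<in>UNIV. complex_of_real (g$c$i * g$e$i) * pd e (pd c p) (g *v x))
      = (\<Sum>e\<in>UNIV. of_real (\<Sum>i\<in>UNIV. g$c$i * g$e$i) * pd e (pd c p) (g *v x))" for c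
      by (subst sum.swap) (simp add: sum_distrib_right)
    then show ?thesis by (subst sum.swap) simp
  qed
  also have "\<dots> = (\<Sum>c\<in>UNIV. \<Sum>e\<in>UNIV. if c = e then pd e (pd c p) (g *v x) else 0)"
  proof (intro sum.cong refl)
    fix c e
    have "(\<Sum>i\<in>UNIV. g$c$i * g$e$i) = (g ** transpose g)$c$e"
      by (simp add: matrix_matrix_mult_def transpose_def)
    also have "\<dots> = (if c = e then 1 else 0)" using g by (simp add: orthogonal_matrix_def mat_def)
    finally show "of_real (\<Sum>i\<in>UNIV. g$c$i * g$e$i) * pd e (pd c p) (g *v x) =
      (if c = e then pd e (pd c p) (g *v x) else 0)" by simp
  qed
  finally show ?thesis by (simp add: laplacian_vec)
qed

section \<open>Eigenfunctions and harmonic polynomials\<close>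

text \<open>The scalars \<open>t\<close> and \<open>c\<close> are fixed numbers, so the lemma
  applies a second time, to \<open>pd i F\<close> with \<open>c / t\<close>; this yields
  \<open>scaled_laplacian\<close>.\<close>

lemma scaled_pd:
  fixes F :: "real^'n \<Rightarrow> complex"
  assumes F: "\<And>x. x \<noteq> 0 \<Longrightarrow> F differentiable (at x)" and t: "t > 0"
    and hom: "\<And>x. x \<noteq> 0 \<Longrightarrow> F (t *\<^sub>R x) = c * F x" and x: "x \<noteq> 0"
  shows "of_real t * pd i F (t *\<^sub>R x) = c * pd i F x"
proof -
  let ?D = "frechet_derivative F (at (t *\<^sub>R x))"
  have D: "(F has_derivative ?D) (at (t *\<^sub>R x))"
    using F[of "t *\<^sub>R x"] x t frechet_derivative_works by auto
  have "((\<lambda>x. t *\<^sub>R x) has_derivative (\<lambda>h. t *\<^sub>R h)) (at x)" by (auto intro!: derivative_eq_intros)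
  from has_derivative_compose[OF this D]
  have "pd i (\<lambda>x. F (t *\<^sub>R x)) x = ?D (t *\<^sub>R axis i 1)" by (rule pd_eq)
  also have "\<dots> = of_real t * pd i F (t *\<^sub>R x)"
    using linear_scale[OF has_derivative_linear[OF D]] by (simp add: partial_deriv_def scaleR_conv_of_real)
  also have "pd i (\<lambda>x. F (t *\<^sub>R x)) x = pd i (\<lambda>x. c * F x) x"
    by (rule pd_cong[of "- {0}"]) (use x hom in auto)
  finally show ?thesis using pd_cmult[OF F[OF x], of i c] by simp
qed

lemma scaled_laplacian:
  fixes F :: "real^'n \<Rightarrow> complex"
  assumes F: "smooth_on (- {0}) F" and t: "t > 0"
    and hom: "\<And>x. x \<noteq> 0 \<Longrightarrow> F (t *\<^sub>R x) = c * F x" and x: "x \<noteq> 0"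
  shows "of_real (t\<^sup>2) * laplacian F (t *\<^sub>R x) = c * laplacian F x"
proof -
  have d: "G differentiable (at y)" if "smooth_on (- {0}) G" "y \<noteq> 0" for G and y :: "real^'n"
    using smooth_on_differentiable[OF that(1), of y] that(2) by auto
  have "of_real (t\<^sup>2) * pd i (pd i F) (t *\<^sub>R x) = c * pd i (pd i F) x" for i
  proof -
    have 1: "pd i F (t *\<^sub>R y) = c / of_real t * pd i F y" if "y \<noteq> 0" for y
      using scaled_pd[OF d[OF F] t hom that, of i] t by (simp add: field_simps)
    have "of_real t * pd i (pd i F) (t *\<^sub>R x) = c / of_real t * pd i (pd i F) x"
      by (rule scaled_pd[OF d[OF smooth_on_pd[OF F]] t 1 x])
    then show ?thesis using t by (simp add: field_simps power2_eq_square)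
  qed
  then show ?thesis by (simp add: laplacian_vec sum_distrib_left)
qed

text \<open>F(t x) = t^k F(x) is differentiated at t = 1. In contrast to \<open>hpoly_euler\<close>
  this covers functions that are singular at the origin.\<close>

lemma euler_homogeneous:
  fixes F :: "real^'n \<Rightarrow> complex"
  assumes F: "F differentiable (at x)" and hom: "\<And>t. t > 0 \<Longrightarrow> F (t *\<^sub>R x) = of_real (t ^ k) * F x"
  shows "(\<Sum>i\<in>UNIV. of_real (x$i) * pd i F x) = of_nat k * F x"
proof -
  let ?D = "frechet_derivative F (at x)"
  have D: "(F has_derivative ?D) (at x)" using F frechet_derivative_works by blast
  have "((\<lambda>t. t *\<^sub>R x) has_derivative (\<lambda>h. h *\<^sub>R x)) (at 1)" by (auto intro!: derivative_eq_intros)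
  then have "((\<lambda>t. F (t *\<^sub>R x)) has_derivative (\<lambda>h. ?D (h *\<^sub>R x))) (at 1)"
    by (rule has_derivative_compose) (simp add: D)
  then have 1: "((\<lambda>t. F (t *\<^sub>R x)) has_vector_derivative ?D x) (at 1)"
    using linear_scale[OF has_derivative_linear[OF D]] by (simp add: has_vector_derivative_def)
  have "((\<lambda>t. t ^ k) has_real_derivative of_nat k) (at (1::real))"
    by (rule DERIV_cong[OF DERIV_pow]) simp
  then have "((\<lambda>t. complex_of_real (t ^ k)) has_vector_derivative of_real (of_nat k)) (at 1)"
    by (intro has_vector_derivative_of_real) (simp add: has_real_derivative_iff_has_vector_derivative)
  from has_vector_derivative_mult_left[OF this, of "F x"]
  have "((\<lambda>t. of_real (t ^ k) * F x) has_vector_derivative (of_real (of_nat k) * F x)) (at 1)" .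
  then have "((\<lambda>t. F (t *\<^sub>R x)) has_vector_derivative (of_real (of_nat k) * F x)) (at 1)"
    by (rule has_vector_derivative_transform_within_open[of _ _ _ "{0<..}"]) (use hom in auto)
  with 1 have "?D x = of_real (of_nat k) * F x" by (rule vector_derivative_unique_at)
  moreover have "?D x = ?D (\<Sum>i\<in>UNIV. x$i *\<^sub>R axis i 1)"
    by (rule arg_cong[of _ _ ?D]) (simp add: vec_eq_iff axis_def if_distrib sum.delta cong: if_cong)
  moreover have "?D (\<Sum>i\<in>UNIV. x$i *\<^sub>R axis i 1) = (\<Sum>i\<in>UNIV. of_real (x$i) * pd i F x)"
    unfolding linear_sum[OF has_derivative_linear[OF D]] linear_scale[OF has_derivative_linear[OF D]]
      partial_deriv_def scaleR_conv_of_real[where 'a = complex] ..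
  ultimately show ?thesis by simp
qed

text \<open>Partial derivatives lower the degree until degree \<open>0\<close>, where the maximum principle applies;
  Euler's identity recovers the function from them. This takes the place of removing the
  singularity at the origin.\<close>

lemma harmonic_homogeneous_hpoly:
  fixes F :: "real^'n \<Rightarrow> complex"
  assumes n: "CARD('n) \<ge> 2"
  shows "smooth_on (- {0}) F \<Longrightarrow> (\<And>x. x \<noteq> 0 \<Longrightarrow> laplacian F x = 0) \<Longrightarrow>
    (\<And>t x. t > 0 \<Longrightarrow> x \<noteq> 0 \<Longrightarrow> F (t *\<^sub>R x) = of_real (t ^ k) * F x) \<Longrightarrow>
    \<exists>p\<in>hpoly k. \<forall>x. x \<noteq> 0 \<longrightarrow> F x = p x"
proof (induction k arbitrary: F)
  case 0
  have "\<exists>c. \<forall>x. x \<noteq> 0 \<longrightarrow> F x = c"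
  proof (rule harmonic_homogeneous_0_const[OF 0(1) _ _ n])
    show "laplacian F x = 0" if "x \<noteq> 0" for x by (rule 0(2)[OF that])
    show "F (t *\<^sub>R x) = F x" if "t > 0" "x \<noteq> 0" for t x using 0(3)[OF that] by simp
  qed
  then obtain c where "\<forall>x. x \<noteq> 0 \<longrightarrow> F x = c" by (elim exE)
  moreover have "(\<lambda>x. c) \<in> hpoly 0" using hpoly_cmult[OF mons_in_hpoly[of "\<lambda>x. 1" 0], of c] by simp
  ultimately show ?case by (intro bexI[of _ "\<lambda>x. c"])
next
  case (Suc k)
  have d: "F differentiable (at y)" if "y \<noteq> 0" for y
    by (rule smooth_on_differentiable[OF Suc.prems(1)]) (use that in auto)
  have "\<exists>p\<in>hpoly k. \<forall>x. x \<noteq> 0 \<longrightarrow> pd i F x = p x" for i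
  proof (rule Suc.IH)
    show "smooth_on (- {0}) (pd i F)" by (rule smooth_on_pd[OF Suc.prems(1)])
    show "laplacian (pd i F) x = 0" if "x \<noteq> 0" for x
    proof -
      have "laplacian (pd i F) x = pd i (laplacian F) x"
        by (rule pd_laplacian[OF Suc.prems(1)]) (use that in auto)
      also have "\<dots> = pd i (\<lambda>x. 0) x"
        by (rule pd_cong[of "- {0}"]) (use that in \<open>auto simp: Suc.prems(2)\<close>)
      finally show ?thesis by (simp add: pd_const)
    qed
    show "pd i F (t *\<^sub>R x) = of_real (t ^ k) * pd i F x" if "t > 0" "x \<noteq> 0" for t x
    proof -
      have "of_real t * pd i F (t *\<^sub>R x) = of_real (t ^ Suc k) * pd i F x"
        by (rule scaled_pd[OF d that(1) Suc.prems(3)[OF that(1)] that(2)])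
      also have "\<dots> = of_real t * (of_real (t ^ k) * pd i F x)" by (simp only: power_Suc of_real_mult mult.assoc)
      finally have eq: "of_real t * pd i F (t *\<^sub>R x) = of_real t * (of_real (t ^ k) * pd i F x)" .
      have "complex_of_real t \<noteq> 0" using that(1) by simp
      from mult_left_cancel[OF this, THEN iffD1, OF eq] show ?thesis .
    qed
  qed
  then have "\<forall>i. \<exists>p. p \<in> hpoly k \<and> (\<forall>x. x \<noteq> 0 \<longrightarrow> pd i F x = p x)" by (simp add: Bex_def)
  then have "\<exists>p. \<forall>i. p i \<in> hpoly k \<and> (\<forall>x. x \<noteq> 0 \<longrightarrow> pd i F x = p i x)" by (rule choice)
  then obtain p where p: "\<And>i. p i \<in> hpoly k" "\<And>i x. x \<noteq> 0 \<Longrightarrow> pd i F x = p i x"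
    by auto
  have "(\<lambda>x. inverse (of_nat (Suc k)) * (\<Sum>i\<in>UNIV. of_real (x$i) * p i x)) \<in> hpoly (Suc k)"
    by (intro hpoly_cmult hpoly_sum hpoly_coord_mult p)
  moreover have "F x = inverse (of_nat (Suc k)) * (\<Sum>i\<in>UNIV. of_real (x$i) * p i x)" if "x \<noteq> 0" for x
  proof -
    have "(\<Sum>i\<in>UNIV. of_real (x$i) * pd i F x) = of_nat (Suc k) * F x"
      by (rule euler_homogeneous[OF d[OF that] Suc.prems(3)[OF _ that]])
    then have eq: "(\<Sum>i\<in>UNIV. of_real (x$i) * p i x) = of_nat (Suc k) * F x"
      by (simp only: p(2)[OF that])
    have "of_nat (Suc k) \<noteq> (0::complex)" by (rule of_nat_neq_0)
    then show ?thesis unfolding eq mult.assoc[symmetric] by (simp del: of_nat_Suc)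
  qed
  ultimately show ?case by (intro bexI[of _ "\<lambda>x. inverse (of_nat (Suc k)) * (\<Sum>i\<in>UNIV. of_real (x$i) * p i x)"]) simp_all
qed

lemma norm_powr_1: "norm x = 1 \<Longrightarrow> norm_powr m x = 1"
  by (simp add: norm_powr_def)

lemma sum_coord_sq: "(\<Sum>i\<in>UNIV. complex_of_real (x$i) * of_real (x$i)) = of_real ((norm x)\<^sup>2)"
  by (simp add: power2_norm_eq_inner inner_vec_def)

lemma laplacian_norm_powr:
  fixes x :: "real^'n" and m :: real
  assumes x: "x \<noteq> 0"
  shows "laplacian (norm_powr m) x = of_real (m * (CARD('n) + m - 2)) * norm_powr (m - 2) x"
proof -
  have d: "norm_powr a differentiable (at x)" for a
    using has_derivative_norm_powr[OF x] differentiable_def by blast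
  have "pd i (pd i (norm_powr m)) x = of_real m * norm_powr (m - 2) x
      + of_real (m * (m - 2)) * (of_real (x$i) * of_real (x$i)) * norm_powr (m - 4) x" for i
  proof -
    have "pd i (pd i (norm_powr m)) x = pd i (\<lambda>x. of_real m * (of_real (x$i) * norm_powr (m - 2) x)) x"
      by (rule pd_cong[of "- {0}"]) (use x in \<open>auto simp: pd_norm_powr mult_ac\<close>)
    also have "\<dots> = of_real m * pd i (\<lambda>x. of_real (x$i) * norm_powr (m - 2) x) x"
      by (intro pd_cmult differentiable_mult differentiable_coord d)
    finally show ?thesis
      by (simp add: pd_coord_mult[OF d] pd_norm_powr[OF x] algebra_simps)
  qed
  then have "laplacian (norm_powr m) x = of_nat CARD('n) * (of_real m * norm_powr (m - 2) x)
      + of_real (m * (m - 2)) * (of_real ((norm x)\<^sup>2) * norm_powr (m - 4) x)"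
    unfolding sum_coord_sq[symmetric] by (simp add: laplacian_vec sum.distrib sum_distrib_left sum_distrib_right mult_ac)
  moreover have "of_real ((norm x)\<^sup>2) * norm_powr (m - 4) x = norm_powr (m - 2) x"
  proof -
    have "(norm x)\<^sup>2 * norm x powr (m - 4) = norm x powr (m - 2)"
      using x powr_add[of "norm x" 2 "m - 4"] by (simp add: powr_numeral)
    then show ?thesis by (simp only: norm_powr_def of_real_mult[symmetric])
  qed
  ultimately show ?thesis by (simp add: algebra_simps)
qed

lemma radial_extension_smooth:
  assumes "smooth_on_sphere f"
  shows "smooth_on (- {0}) (radial_extension f)"
  using assms by (simp add: smooth_on_sphere_def smooth_on_def)

lemma radial_extension_scale: "t > 0 \<Longrightarrow> radial_extension f (t *\<^sub>R x) = radial_extension f x"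
  by (simp add: radial_extension_def field_simps)

lemma radial_extension_sphere: "norm x = 1 \<Longrightarrow> radial_extension f x = f x"
  by (simp add: radial_extension_def)

text \<open>The value 0 off the sphere matches the representatives demanded by
  \<open>smooth_on_sphere\<close>.\<close>

definition sphere_restrict :: "(real^'n \<Rightarrow> complex) \<Rightarrow> real^'n \<Rightarrow> complex" where
  "sphere_restrict p x = (if x \<in> sphere 0 1 then p x else 0)"

definition invariant_hpoly :: "(real^'n^'n) set \<Rightarrow> nat \<Rightarrow> (real^'n \<Rightarrow> complex) set" where
  "invariant_hpoly G k = {p \<in> hpoly k. \<forall>g\<in>G. \<forall>x. p (g *v x) = p x}"

definition harmonic_hpoly :: "(real^'n^'n) set \<Rightarrow> nat \<Rightarrow> (real^'n \<Rightarrow> complex) set" where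
  "harmonic_hpoly G k = {p \<in> invariant_hpoly G k. \<forall>x. laplacian p x = 0}"

text \<open>Serves both directions of the correspondence: m = k, j = 0 for the radial extension of
  an eigenfunction, and m = -k, j = k for a harmonic polynomial. Both times the coefficient is k(k +
  n - 2) up to sign.\<close>

lemma laplacian_norm_powr_mult:
  fixes F :: "real^'n \<Rightarrow> complex" and m :: real
  assumes F: "smooth_on (- {0}) F" and x: "x \<noteq> 0"
    and euler: "(\<Sum>i\<in>UNIV. of_real (x$i) * pd i F x) = of_nat j * F x"
  shows "laplacian (\<lambda>x. norm_powr m x * F x) x =
    norm_powr m x * laplacian F x + of_real (m * (CARD('n) + m - 2 + 2 * j)) * norm_powr (m - 2) x * F x"
proof -
  have "(\<Sum>i\<in>UNIV. pd i (norm_powr m) x * pd i F x)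
      = of_real m * norm_powr (m - 2) x * (\<Sum>i\<in>UNIV. of_real (x$i) * pd i F x)"
    by (simp add: pd_norm_powr[OF x] sum_distrib_left mult_ac)
  then show ?thesis
    unfolding euler using x
    by (subst laplacian_mult[OF smooth_on_norm_powr F]) (auto simp: laplacian_norm_powr algebra_simps)
qed

text \<open>The eigenvalue is k(k + d - 1) with d = n - 1, exactly the value for which r^k times the
  radial extension of \<open>f\<close> is harmonic off the origin.\<close>

lemma eigenspace_subset:
  fixes \<Gamma> :: "(real^'n^'n) set"
  assumes n: "CARD('n) \<ge> 2" and G: "\<And>g. g \<in> \<Gamma> \<Longrightarrow> orthogonal_matrix g"
    and f: "f \<in> eigenspace \<Gamma> (real k * (real k + real CARD('n) - 2))"
  shows "f \<in> sphere_restrict ` harmonic_hpoly \<Gamma> k"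
proof -
  define l where "l = real k * (real k + real CARD('n) - 2)"
  have sm: "smooth_on_sphere f" and inv: "\<And>g x. g \<in> \<Gamma> \<Longrightarrow> norm x = 1 \<Longrightarrow> f (g *v x) = f x"
    and eig: "\<And>x. norm x = 1 \<Longrightarrow> laplace_beltrami f x = of_real l * f x"
    using f by (auto simp: eigenspace_def invariant_functions_def l_def)
  let ?f = "radial_extension f"
  define F where "F x = norm_powr (real k) x * ?f x" for x
  note smf = radial_extension_smooth[OF sm]
  have nz: "x = norm x *\<^sub>R (x /\<^sub>R norm x)" "norm (x /\<^sub>R norm x) = 1" if "x \<noteq> 0" for x :: "real^'n"
    using that by auto
  \<comment> \<open>The eigenvalue equation is given at radius 1; the Laplacian of a function of
    degree 0 has degree -2, which carries the equation to every radius.\<close>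
  have lapf: "laplacian ?f x = - of_real l * norm_powr (-2) x * ?f x" if x: "x \<noteq> 0" for x
  proof -
    let ?u = "x /\<^sub>R norm x"
    have "of_real ((norm x)\<^sup>2) * laplacian ?f (norm x *\<^sub>R ?u) = 1 * laplacian ?f ?u"
      by (rule scaled_laplacian[OF smf]) (use x in \<open>auto simp: radial_extension_scale\<close>)
    moreover have "laplacian ?f ?u = - of_real l * ?f x"
      using eig[OF nz(2)[OF x]] by (simp add: laplace_beltrami_def radial_extension_def) (metis minus_minus)
    ultimately have eq: "of_real ((norm x)\<^sup>2) * laplacian ?f x = - of_real l * ?f x" using x by simp
    have "norm_powr (-2) x = inverse (of_real ((norm x)\<^sup>2))"
      using x by (simp add: norm_powr_def powr_minus powr_numeral)
    then have "laplacian ?f x = norm_powr (-2) x * (of_real ((norm x)\<^sup>2) * laplacian ?f x)"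
      using x by simp
    then show ?thesis unfolding eq by simp
  qed
  have harmF: "laplacian F x = 0" if x: "x \<noteq> 0" for x
  proof -
    have "(\<Sum>i\<in>UNIV. of_real (x$i) * pd i ?f x) = of_nat 0 * ?f x"
      by (rule euler_homogeneous) (use smooth_on_differentiable[OF smf, of x] x in \<open>auto simp: radial_extension_scale\<close>)
    from laplacian_norm_powr_mult[OF smf x this, of "real k"]
    have "laplacian F x = norm_powr (real k) x * laplacian ?f x + of_real l * norm_powr (real k - 2) x * ?f x"
      unfolding F_def[abs_def] l_def by (simp add: algebra_simps)
    moreover have "norm_powr (real k) x * norm_powr (-2) x = norm_powr (real k - 2) x"
      using x by (simp add: norm_powr_def flip: powr_add of_real_mult)
    ultimately show ?thesis unfolding lapf[OF x] by (simp add: algebra_simps)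
  qed
  have "\<exists>p\<in>hpoly k. \<forall>x. x \<noteq> 0 \<longrightarrow> F x = p x"
  proof (rule harmonic_homogeneous_hpoly[OF n])
    show "smooth_on (- {0}) F"
      unfolding F_def[abs_def] by (intro smooth_on_mult smooth_on_norm_powr smf) auto
    show "F (t *\<^sub>R x) = of_real (t ^ k) * F x" if "t > 0" "x \<noteq> 0" for t x
      using that by (simp add: F_def radial_extension_scale norm_powr_def powr_mult powr_realpow)
  qed (rule harmF)
  then obtain p where p: "p \<in> hpoly k" "\<And>x. x \<noteq> 0 \<Longrightarrow> F x = p x" by blast
  have gn: "norm (g *v x) = norm x" if "g \<in> \<Gamma>" for g and x :: "real^'n"
    using G[OF that] orthogonal_transformation_matrix[of "(*v) g"]
    by (simp add: orthogonal_transformation)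
  have "p (g *v x) = p x" if g: "g \<in> \<Gamma>" for g x
  proof (cases "x = 0")
    case False
    then have "g *v x \<noteq> 0" using gn[OF g, of x] by auto
    have "?f (g *v x) = ?f x"
      using inv[OF g nz(2)[OF False]] False
      by (simp add: radial_extension_def gn[OF g] matrix_vector_mult_scaleR)
    then show ?thesis
      using p(2)[OF False] p(2)[of "g *v x"] \<open>g *v x \<noteq> 0\<close> by (simp add: F_def gn[OF g] norm_powr_def)
  qed simp
  moreover have "laplacian p x = 0" for x
  proof -
    have *: "laplacian p x = 0" if "x \<noteq> 0" for x
    proof -
      have "pd i p y = pd i F y" if "y \<noteq> 0" for i y
        using that p(2) by (intro pd_cong[of "- {0}"]) auto
      then have "pd i (pd i p) x = pd i (pd i F) x" for i
        using that by (rule_tac pd_cong[of "- {0}" x]) auto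
      then show ?thesis using harmF[OF that] by (simp add: laplacian_vec)
    qed
    show ?thesis
    \<comment> \<open>At the origin the equation follows from the homogeneity of the polynomial
      \<open>laplacian p\<close>; below degree 2 that polynomial is identically 0.\<close>
    proof (cases "k < 2")
      case False
      then obtain j where j: "k = Suc (Suc j)" by (metis add_2_eq_Suc le_Suc_ex not_less)
      show ?thesis by (rule hpoly_eq_0_at_0[OF hpoly_laplacian[OF p(1)[unfolded j]] *])
    qed (use hpoly_laplacian_low[OF p(1)] in auto)
  qed
  ultimately have "p \<in> harmonic_hpoly \<Gamma> k"
    using p(1) by (simp add: harmonic_hpoly_def invariant_hpoly_def)
  moreover have "f = sphere_restrict p"
  proof
    fix x
    show "f x = sphere_restrict p x"
    proof (cases "norm x = 1")
      case True
      then have "x \<noteq> 0" by auto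
      with p(2)[OF this] True show ?thesis
        by (simp add: F_def norm_powr_1 radial_extension_sphere sphere_restrict_def)
    qed (use sm in \<open>auto simp: smooth_on_sphere_def sphere_restrict_def\<close>)
  qed
  ultimately show ?thesis by blast
qed

lemma harmonic_subset_eigenspace:
  fixes \<Gamma> :: "(real^'n^'n) set"
  assumes G: "\<And>g. g \<in> \<Gamma> \<Longrightarrow> orthogonal_matrix g" and p: "p \<in> harmonic_hpoly \<Gamma> k"
  shows "sphere_restrict p \<in> eigenspace \<Gamma> (real k * (real k + real CARD('n) - 2))"
proof -
  have ph: "p \<in> hpoly k" and inv: "\<And>g x. g \<in> \<Gamma> \<Longrightarrow> p (g *v x) = p x" and harm: "\<And>x. laplacian p x = 0"
    using p by (auto simp: harmonic_hpoly_def invariant_hpoly_def)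
  define F where "F x = norm_powr (- real k) x * p x" for x
  have gn: "norm (g *v x) = norm x" if "g \<in> \<Gamma>" for g and x :: "real^'n"
    using G[OF that] orthogonal_transformation_matrix[of "(*v) g"]
    by (simp add: orthogonal_transformation)
  have smp: "smooth_on (- {0}) p" by (rule hpoly_smooth[OF ph]) auto
  have smF: "smooth_on (- {0}) F"
    unfolding F_def[abs_def] by (intro smooth_on_mult smooth_on_norm_powr smp) auto
  have ext: "radial_extension (sphere_restrict p) x = F x" if "x \<noteq> 0" for x
    using that by (simp add: radial_extension_def sphere_restrict_def F_def hpoly_homogeneous[OF ph]
      norm_powr_def powr_minus powr_realpow power_inverse)
  have "smooth_on (- {0}) (radial_extension (sphere_restrict p))"
    using smF ext by (subst smooth_on_cong[of _ _ F]) auto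
  then have "smooth_on_sphere (sphere_restrict p)"
    by (simp add: smooth_on_sphere_def smooth_on_def sphere_restrict_def)
  moreover have "laplace_beltrami (sphere_restrict p) x =
      of_real (real k * (real k + real CARD('n) - 2)) * sphere_restrict p x" if x: "norm x = 1" for x
  proof -
    have x0: "x \<noteq> 0" using x by auto
    have "pd i (radial_extension (sphere_restrict p)) y = pd i F y" if "y \<noteq> 0" for i y
      using that ext by (intro pd_cong[of "- {0}"]) auto
    then have "pd i (pd i (radial_extension (sphere_restrict p))) x = pd i (pd i F) x" for i
      using x0 by (rule_tac pd_cong[of "- {0}" x]) auto
    then have "laplacian (radial_extension (sphere_restrict p)) x = laplacian F x"
      by (simp add: laplacian_vec)
    also have "\<dots> = of_real (- real k * (CARD('n) + - real k - 2 + 2 * k)) * p x"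
      unfolding F_def[abs_def]
      by (subst laplacian_norm_powr_mult[OF smp x0 hpoly_euler[OF ph]]) (simp add: harm norm_powr_1[OF x])
    finally show ?thesis using x by (simp add: laplace_beltrami_def sphere_restrict_def algebra_simps)
  qed
  ultimately show ?thesis
    using inv gn by (auto simp: eigenspace_def invariant_functions_def sphere_restrict_def)
qed

lemma subspace_invariant_hpoly: "cf.subspace (invariant_hpoly \<Gamma> k)"
proof (rule cf.subspaceI)
  show "0 \<in> invariant_hpoly \<Gamma> k" using hpoly_0 by (simp add: invariant_hpoly_def zero_fun_def)
  show "p + q \<in> invariant_hpoly \<Gamma> k" if "p \<in> invariant_hpoly \<Gamma> k" "q \<in> invariant_hpoly \<Gamma> k" for p q
    using that hpoly_add[of p k q] by (simp add: invariant_hpoly_def plus_fun_def)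
  show "scale_fun c p \<in> invariant_hpoly \<Gamma> k" if "p \<in> invariant_hpoly \<Gamma> k" for c p
    using that hpoly_cmult[of p k c] by (simp add: invariant_hpoly_def scale_fun_def)
qed

lemma hpoly_laplacian_add: "p \<in> hpoly k \<Longrightarrow> q \<in> hpoly j \<Longrightarrow>
    laplacian (\<lambda>x. p x + q x) x = laplacian p x + laplacian q x"
  by (rule laplacian_add[of UNIV]) (auto intro: hpoly_smooth)

lemma hpoly_laplacian_cmult: "p \<in> hpoly k \<Longrightarrow> laplacian (\<lambda>x. c * p x) x = c * laplacian p x"
  by (rule laplacian_cmult[of UNIV]) (auto intro: hpoly_smooth)

lemma subspace_harmonic_hpoly: "cf.subspace (harmonic_hpoly \<Gamma> k)"
proof (rule cf.subspaceI)
  show "0 \<in> harmonic_hpoly \<Gamma> k" using cf.subspace_0[OF subspace_invariant_hpoly]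
    by (simp add: harmonic_hpoly_def zero_fun_def laplacian_const)
  show "p + q \<in> harmonic_hpoly \<Gamma> k" if "p \<in> harmonic_hpoly \<Gamma> k" "q \<in> harmonic_hpoly \<Gamma> k" for p q
    using that cf.subspace_add[OF subspace_invariant_hpoly, of p \<Gamma> k q] hpoly_laplacian_add[of p k q k]
    by (simp add: harmonic_hpoly_def plus_fun_def invariant_hpoly_def)
  show "scale_fun c p \<in> harmonic_hpoly \<Gamma> k" if "p \<in> harmonic_hpoly \<Gamma> k" for c p
    using that cf.subspace_scale[OF subspace_invariant_hpoly, of p \<Gamma> k c] hpoly_laplacian_cmult[of p k c]
    by (simp add: harmonic_hpoly_def scale_fun_def invariant_hpoly_def)
qed

text \<open>A homogeneous polynomial is determined by its values on the sphere, so restricting to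
  the sphere preserves the dimension.\<close>

lemma orbifold_spectrum_eq_dim:
  fixes \<Gamma> :: "(real^'n^'n) set"
  assumes n: "CARD('n) \<ge> 2" and G: "\<And>g. g \<in> \<Gamma> \<Longrightarrow> orthogonal_matrix g"
  shows "orbifold_spectrum \<Gamma> (real k * (real k + real CARD('n) - 2)) = cf.dim (harmonic_hpoly \<Gamma> k)"
proof -
  have eq: "eigenspace \<Gamma> (real k * (real k + real CARD('n) - 2)) = sphere_restrict ` harmonic_hpoly \<Gamma> k"
    using eigenspace_subset[OF n G] harmonic_subset_eigenspace[OF G] by blast
  have lin: "Vector_Spaces.linear scale_fun scale_fun (sphere_restrict :: (real^'n \<Rightarrow> complex) \<Rightarrow> _)"
    unfolding Vector_Spaces.linear_def module_hom_def module_hom_axioms_def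
    using vector_space_scale_fun cf.module_axioms
    by (auto simp: sphere_restrict_def[abs_def] scale_fun_def plus_fun_def)
  have "inj_on sphere_restrict (cf.span (harmonic_hpoly \<Gamma> k))"
    unfolding cf.span_eq_iff[THEN iffD2, OF subspace_harmonic_hpoly]
  proof (rule inj_onI)
    fix p q assume pq: "p \<in> harmonic_hpoly \<Gamma> k" "q \<in> harmonic_hpoly \<Gamma> k" "sphere_restrict p = sphere_restrict q"
    then have h: "p \<in> hpoly k" "q \<in> hpoly k" by (auto simp: harmonic_hpoly_def invariant_hpoly_def)
    define r where "r = (\<lambda>x. p x + (- 1) * q x)"
    have r: "r \<in> hpoly k" unfolding r_def by (intro hpoly_add hpoly_cmult h)
    have r1: "r x = 0" if "norm x = 1" for x
      using fun_cong[OF pq(3), of x] that by (simp add: sphere_restrict_def r_def)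
    have "r x = 0" if "x \<noteq> 0" for x
      using hpoly_homogeneous[OF r, of "norm x" "x /\<^sub>R norm x"] r1[of "x /\<^sub>R norm x"] that by simp
    from hpoly_eq_0_at_0[OF r this] show "p = q" by (simp add: r_def fun_eq_iff)
  qed
  note inj = this
  have fd: "fin_dim (harmonic_hpoly \<Gamma> k)"
    by (rule fin_dim_subset[OF fin_dim_hpoly[of k] subspace_harmonic_hpoly])
      (auto simp: harmonic_hpoly_def invariant_hpoly_def)
  let ?B = "basis_of (harmonic_hpoly \<Gamma> k)"
  interpret L: Vector_Spaces.linear scale_fun scale_fun "sphere_restrict :: (real^'n \<Rightarrow> complex) \<Rightarrow> _"
    by (rule lin)
  note span_eq = cf.span_eq_iff[THEN iffD2, OF subspace_harmonic_hpoly[of \<Gamma> k]]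
  have inj': "inj_on sphere_restrict (cf.span ?B)" using inj by (simp only: basis_of(3)[OF fd] span_eq)
  have "cf.span (sphere_restrict ` ?B) = cf.span (sphere_restrict ` harmonic_hpoly \<Gamma> k)"
    by (simp only: L.span_image basis_of(3)[OF fd] span_eq)
  moreover have "cf.independent (sphere_restrict ` ?B)"
    by (rule L.independent_injective_image[OF basis_of(2)[OF fd] inj'])
  ultimately have "cf.dim (sphere_restrict ` harmonic_hpoly \<Gamma> k) = card (sphere_restrict ` ?B)"
    by (rule cf.dim_eq_card)
  also have "\<dots> = card ?B" by (rule card_image[OF inj_on_subset[OF inj' cf.span_superset]])
  finally show ?thesis using basis_of(5)[OF fd] by (simp add: orbifold_spectrum_def eq)
qed

section \<open>Dimensions of invariant polynomials\<close>

lemma fin_dim_invariant_hpoly: "fin_dim (invariant_hpoly \<Gamma> k)"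
  by (rule fin_dim_subset[OF fin_dim_hpoly[of k] subspace_invariant_hpoly])
    (auto simp: invariant_hpoly_def)

text \<open>Multiplication by r^2, written as a sum of coordinate products so that
  \<open>hpoly_coord_mult\<close> settles the degree.\<close>

definition r2_mult :: "(real^'n \<Rightarrow> complex) \<Rightarrow> real^'n \<Rightarrow> complex" where
  "r2_mult p x = (\<Sum>i\<in>UNIV. of_real (x$i) * (of_real (x$i) * p x))"

lemma r2_mult_eq: "r2_mult p x = of_real ((norm x)\<^sup>2) * p x"
  by (simp only: r2_mult_def sum_coord_sq[symmetric] sum_distrib_right mult.assoc)

lemma hpoly_r2_mult: "p \<in> hpoly k \<Longrightarrow> r2_mult p \<in> hpoly (Suc (Suc k))"
  unfolding r2_mult_def[abs_def] by (intro hpoly_sum hpoly_coord_mult)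

lemma laplacian_r2_mult:
  fixes p :: "real^'n \<Rightarrow> complex"
  assumes p: "p \<in> hpoly k"
  shows "laplacian (r2_mult p) x = of_nat (2 * CARD('n) + 4 * k) * p x + of_real ((norm x)\<^sup>2) * laplacian p x"
proof -
  \<comment> \<open>Minus the squared norm, in the form whose derivatives were computed for the
    barrier.\<close>
  define q :: "real^'n \<Rightarrow> complex" where "q = (\<lambda>x. of_real (0 - (dist x 0)\<^sup>2))"
  have smq: "smooth_on UNIV q" unfolding q_def by (rule smooth_on_square_dist) simp
  have smp: "smooth_on UNIV p" by (rule hpoly_smooth[OF p]) simp
  have "r2_mult p = (\<lambda>x. (- 1) * (q x * p x))" by (rule ext) (simp add: r2_mult_eq q_def)
  then have "laplacian (r2_mult p) x = (- 1) * (q x * laplacian p x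
      + 2 * (\<Sum>i\<in>UNIV. pd i q x * pd i p x) + laplacian q x * p x)"
    using laplacian_cmult[OF smooth_on_mult[OF open_UNIV smq smp] open_UNIV, of x "- 1"]
      laplacian_mult[OF smq smp open_UNIV, of x] by simp
  moreover have "laplacian q x = - 2 * of_nat CARD('n)" unfolding q_def by (rule laplacian_square_dist)
  moreover have "(\<Sum>i\<in>UNIV. pd i q x * pd i p x) = - 2 * (\<Sum>i\<in>UNIV. of_real (x$i) * pd i p x)"
    unfolding q_def pd_square_dist by (simp add: sum_distrib_left mult.assoc)
  ultimately show ?thesis by (simp add: hpoly_euler[OF p] q_def algebra_simps)
qed

text \<open>For q = \<Delta> p the hypothesis reads r^2 q = - c p. Applying \<Delta> gives r^2
  \<Delta> q = - (c + 2n + 4j) q, the same equation with a larger constant and a degree lower by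
  two; below degree 2 the left side is 0 and c > 0 forces p = 0.\<close>

lemma hpoly_pos_eq_0:
  fixes p :: "real^'n \<Rightarrow> complex"
  assumes "p \<in> hpoly k" "c > (0::nat)"
    "\<And>x. of_real ((norm x)\<^sup>2) * laplacian p x = - of_nat c * p x"
  shows "p x = 0"
  using assms
proof (induction k arbitrary: p c x rule: less_induct)
  case (less k)
  show ?case
  proof (cases "k < 2")
    case True
    then have "laplacian p x = 0" using hpoly_laplacian_low[OF less.prems(1)] by simp
    then show ?thesis using less.prems(3)[of x] less.prems(2) by simp
  next
    case False
    then obtain j where j: "k = Suc (Suc j)" by (metis add_2_eq_Suc le_Suc_ex not_less)
    define q where "q = laplacian p"
    have q: "q \<in> hpoly j" unfolding q_def using hpoly_laplacian less.prems(1) j by simp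
    have pq: "r2_mult q = (\<lambda>x. - of_nat c * p x)"
      by (rule ext) (simp only: r2_mult_eq q_def less.prems(3))
    have "of_real ((norm x)\<^sup>2) * laplacian q x = - of_nat (c + (2 * CARD('n) + 4 * j)) * q x" for x
    proof -
      have "of_nat (2 * CARD('n) + 4 * j) * q x + of_real ((norm x)\<^sup>2) * laplacian q x = - of_nat c * q x"
        using laplacian_r2_mult[OF q, of x] hpoly_laplacian_cmult[OF less.prems(1), of "- of_nat c" x]
        unfolding pq by (simp add: q_def)
      then show ?thesis by (simp add: algebra_simps)
    qed
    then have "q x = 0"
      by (rule less.IH[of j q "c + (2 * CARD('n) + 4 * j)", rotated -1]) (use j q less.prems(2) in simp_all)
    with less.prems(3)[of x] have "- of_nat c * p x = 0" by (simp only: q_def mult_zero_right)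
    then show ?thesis using less.prems(2) by simp
  qed
qed

lemma dim_invariant_hpoly_low:
  assumes "k < 2"
  shows "invariant_hpoly \<Gamma> k = harmonic_hpoly \<Gamma> k"
proof -
  have "laplacian p x = 0" if "p \<in> invariant_hpoly \<Gamma> k" for p x
    using that hpoly_laplacian_low[of p k] assms by (simp add: invariant_hpoly_def)
  then show ?thesis by (auto simp: harmonic_hpoly_def)
qed

text \<open>The operator \<open>\<Delta> \<circ> r\<^sup>2\<close> is injective, hence invertible, on invariant polynomials of degree \<open>k\<close>;
  with its inverse \<open>S\<close> the map \<open>p \<mapsto> p - r\<^sup>2 S \<Delta> p\<close> projects degree \<open>k + 2\<close> onto the harmonic ones,
  and its trace is the difference of the two dimensions.\<close>

lemma dim_invariant_hpoly:
  fixes \<Gamma> :: "(real^'n^'n) set"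
  assumes G: "\<And>g. g \<in> \<Gamma> \<Longrightarrow> orthogonal_matrix g"
  shows "cf.dim (invariant_hpoly \<Gamma> (Suc (Suc k))) =
    cf.dim (harmonic_hpoly \<Gamma> (Suc (Suc k))) + cf.dim (invariant_hpoly \<Gamma> k)"
proof -
  let ?V = "invariant_hpoly \<Gamma> k" and ?W = "invariant_hpoly \<Gamma> (Suc (Suc k))"
  have gn: "norm (g *v x) = norm x" if "g \<in> \<Gamma>" for g and x :: "real^'n"
    using G[OF that] orthogonal_transformation_matrix[of "(*v) g"] by (simp add: orthogonal_transformation)
  note fV = fin_dim_invariant_hpoly[of \<Gamma> k] and fW = fin_dim_invariant_hpoly[of \<Gamma> "Suc (Suc k)"]
  have M: "lin_map ?V ?W r2_mult"
    unfolding lin_map_def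
  proof (intro conjI ballI allI subsetI)
    show "q \<in> ?W" if "q \<in> r2_mult ` ?V" for q
      using that by (auto simp: invariant_hpoly_def hpoly_r2_mult r2_mult_eq gn)
  qed (auto simp: r2_mult_eq fun_eq_iff plus_fun_def scale_fun_def algebra_simps)
  have D: "lin_map ?W ?V laplacian"
    unfolding lin_map_def
  proof (intro conjI ballI allI subsetI)
    show "q \<in> ?V" if "q \<in> laplacian ` ?W" for q
    proof -
      from that obtain p where "p \<in> ?W" and q: "q = laplacian p" by blast
      then have p: "p \<in> hpoly (Suc (Suc k))" "\<And>g x. g \<in> \<Gamma> \<Longrightarrow> p (g *v x) = p x"
        by (simp_all add: invariant_hpoly_def)
      have "laplacian p (g *v x) = laplacian p x" if g: "g \<in> \<Gamma>" for g x
        using hpoly_laplacian_comp[OF p(1) G[OF g], of x] p(2)[OF g] by simp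
      then show ?thesis using hpoly_laplacian[OF p(1)] q by (simp add: invariant_hpoly_def)
    qed
    show "laplacian (p + q) = laplacian p + laplacian q" if "p \<in> ?W" "q \<in> ?W" for p q
      using that hpoly_laplacian_add[of p _ q] by (auto simp: plus_fun_def invariant_hpoly_def)
    show "laplacian (scale_fun c p) = scale_fun c (laplacian p)" if "p \<in> ?W" for c p
      using that hpoly_laplacian_cmult[of p _ c] by (auto simp: scale_fun_def invariant_hpoly_def)
  qed
  define T where "T = (\<lambda>p. laplacian (r2_mult p :: real^'n \<Rightarrow> complex))"
  have T: "lin_map ?V ?V T"
    unfolding T_def lin_map_def using lin_mapD[OF M] lin_mapD[OF D] by auto
  have injT: "p = 0" if "p \<in> ?V" "T p = 0" for p
  proof -
    have p: "p \<in> hpoly k" using that(1) by (simp add: invariant_hpoly_def)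
    have "of_real ((norm x)\<^sup>2) * laplacian p x = - of_nat (2 * CARD('n) + 4 * k) * p x" for x
    proof -
      have "of_nat (2 * CARD('n) + 4 * k) * p x + of_real ((norm x)\<^sup>2) * laplacian p x = 0"
        using fun_cong[OF that(2), of x] unfolding T_def laplacian_r2_mult[OF p] by (simp add: zero_fun_def)
      then show ?thesis by (simp only: add_eq_0_iff minus_mult_left)
    qed
    then have "p x = 0" for x using hpoly_pos_eq_0[OF p, of "2 * CARD('n) + 4 * k" x] by simp
    then show ?thesis by (simp add: zero_fun_def fun_eq_iff)
  qed
  have surj: "T ` ?V = ?V" by (rule lin_map_injective_surjective[OF fV T injT])
  have injT': "inj_on T ?V"
  proof (rule inj_onI)
    fix p q assume pq: "p \<in> ?V" "q \<in> ?V" "T p = T q"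
    have sV: "cf.subspace ?V" by (rule subspace_invariant_hpoly)
    have "p + scale_fun (- 1) q \<in> ?V" using pq sV cf.subspace_add cf.subspace_scale by blast
    moreover have "T (p + scale_fun (- 1) q) = T q + scale_fun (- 1) (T q)"
      using pq cf.subspace_scale[OF sV pq(2), of "- 1"] by (simp only: lin_mapD(2,3)[OF T])
    then have "T (p + scale_fun (- 1) q) = 0"
      by (simp add: scale_fun_def plus_fun_def zero_fun_def)
    ultimately have "p + scale_fun (- 1) q = 0" by (rule injT)
    then show "p = q" by (simp add: scale_fun_def plus_fun_def zero_fun_def fun_eq_iff)
  qed
  define S where "S = inv_into ?V T"
  have TS: "T (S q) = q" "S q \<in> ?V" if "q \<in> ?V" for q
  proof -
    have "q \<in> T ` ?V" using that surj by simp
    then show "T (S q) = q" "S q \<in> ?V" unfolding S_def by (rule f_inv_into_f, rule inv_into_into)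
  qed
  have ST: "S (T p) = p" if "p \<in> ?V" for p
    unfolding S_def by (rule inv_into_f_f[OF injT' that])
  have S: "lin_map ?V ?V S"
    unfolding lin_map_def
  proof (intro conjI ballI allI)
    have sV: "cf.subspace ?V" by (rule subspace_invariant_hpoly)
    show "S (p + q) = S p + S q" if "p \<in> ?V" "q \<in> ?V" for p q
      using ST[of "S p + S q"] lin_mapD(2)[OF T, of "S p" "S q"] TS that cf.subspace_add[OF sV] by simp
    show "S (scale_fun c p) = scale_fun c (S p)" if "p \<in> ?V" for c p
      using ST[of "scale_fun c (S p)"] lin_mapD(3)[OF T, of "S p" c] TS that cf.subspace_scale[OF sV] by simp
  qed (use TS in auto)
  define P where "P = (\<lambda>p. r2_mult (S (laplacian p)))"
  have MS: "lin_map ?V ?W (\<lambda>q. r2_mult (S q))"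
    unfolding lin_map_def using lin_mapD[OF M] lin_mapD[OF S] by auto
  have P: "lin_map ?W ?W P"
    unfolding P_def lin_map_def using lin_mapD[OF MS] lin_mapD[OF D] by auto
  \<comment> \<open>Moving the Laplacian round the trace turns r^2 S \<Delta> in degree k + 2 into
    \<Delta> r^2 S, the identity of degree k.\<close>
  have "lin_trace ?W P = lin_trace ?V (\<lambda>q. laplacian (r2_mult (S q)))"
    unfolding P_def by (rule lin_trace_commute[OF fW fV D MS])
  also have "\<dots> = lin_trace ?V (\<lambda>q. q)"
    by (rule lin_trace_cong[OF _ fV]) (use TS in \<open>simp add: T_def\<close>)
  also have "\<dots> = of_nat (cf.dim ?V)" by (rule lin_trace_id[OF fV])
  finally have trP: "lin_trace ?W P = of_nat (cf.dim ?V)" .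
  define Q where "Q = (\<lambda>p. p + scale_fun (- 1) (P p))"
  have sW: "cf.subspace ?W" by (rule subspace_invariant_hpoly)
  have QW: "Q p \<in> ?W" if "p \<in> ?W" for p
    unfolding Q_def using that lin_mapD(1)[OF P] sW cf.subspace_add cf.subspace_scale by blast
  have lapQ: "laplacian (Q p) = 0" if "p \<in> ?W" for p
  proof -
    have "laplacian (Q p) = laplacian p + scale_fun (- 1) (laplacian (P p))"
      unfolding Q_def lin_mapD(2)[OF D that cf.subspace_scale[OF sW lin_mapD(1)[OF P that]]]
        lin_mapD(3)[OF D lin_mapD(1)[OF P that]] ..
    also have "laplacian (P p) = laplacian p"
      unfolding P_def using TS(1)[OF lin_mapD(1)[OF D that]] by (simp add: T_def)
    finally show ?thesis by (simp add: scale_fun_def plus_fun_def zero_fun_def)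
  qed
  have "lin_trace ?W Q = of_nat (cf.dim (harmonic_hpoly \<Gamma> (Suc (Suc k))))"
  proof (rule lin_trace_projection[OF fW subspace_harmonic_hpoly])
    show "harmonic_hpoly \<Gamma> (Suc (Suc k)) \<subseteq> ?W" by (auto simp: harmonic_hpoly_def)
    show "lin_map ?W (harmonic_hpoly \<Gamma> (Suc (Suc k))) Q"
      unfolding lin_map_def
    proof (intro conjI ballI allI subsetI)
      show "q \<in> harmonic_hpoly \<Gamma> (Suc (Suc k))" if "q \<in> Q ` ?W" for q
        using that QW lapQ by (auto simp: harmonic_hpoly_def zero_fun_def)
      show "Q (f + g) = Q f + Q g" if "f \<in> ?W" "g \<in> ?W" for f g
        unfolding Q_def lin_mapD(2)[OF P that] by (simp add: scale_fun_def plus_fun_def algebra_simps)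
      show "Q (scale_fun c f) = scale_fun c (Q f)" if "f \<in> ?W" for c f
        unfolding Q_def lin_mapD(3)[OF P that] by (simp add: scale_fun_def plus_fun_def algebra_simps)
    qed
    show "Q p = p" if "p \<in> harmonic_hpoly \<Gamma> (Suc (Suc k))" for p
    proof -
      have "laplacian p = 0" using that by (simp add: harmonic_hpoly_def zero_fun_def fun_eq_iff)
      moreover have "P p = r2_mult (S 0)" by (simp add: P_def calculation)
      moreover have "S 0 = 0" using lin_map_sum[OF S fV, of "{}"] by simp
      ultimately have "P p = 0" by (simp add: r2_mult_eq zero_fun_def fun_eq_iff)
      then show ?thesis by (simp add: Q_def scale_fun_def zero_fun_def plus_fun_def)
    qed
  qed
  moreover have "lin_trace ?W Q = lin_trace ?W (\<lambda>p. p) - lin_trace ?W P"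
  proof -
    have "lin_trace ?W Q = lin_trace ?W (\<lambda>f. \<Sum>i\<in>{0,1::nat}. scale_fun (if i = 0 then 1 else - 1) ((if i = 0 then (\<lambda>p. p) else P) f))"
      unfolding Q_def by (rule arg_cong[of _ _ "lin_trace ?W"]) (auto simp: scale_fun_def fun_eq_iff)
    also have "\<dots> = lin_trace ?W (\<lambda>p. p) - lin_trace ?W P"
      by (subst lin_trace_lincomb[OF fW]) (use lin_mapD(1)[OF P] in auto)
    finally show ?thesis .
  qed
  ultimately have "of_nat (cf.dim (harmonic_hpoly \<Gamma> (Suc (Suc k)))) = (of_nat (cf.dim ?W) - of_nat (cf.dim ?V) :: complex)"
    using trP lin_trace_id[OF fW] by simp
  then have "(of_nat (cf.dim ?W) :: complex) = of_nat (cf.dim (harmonic_hpoly \<Gamma> (Suc (Suc k))) + cf.dim ?V)"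
    by simp
  then show ?thesis by (simp only: of_nat_eq_iff)
qed

lemma isospectral_dim_invariant_hpoly:
  fixes \<Gamma> \<Gamma>' :: "(real^'n^'n) set"
  assumes n: "CARD('n) \<ge> 2" and G: "\<And>g. g \<in> \<Gamma> \<Longrightarrow> orthogonal_matrix g" "\<And>g. g \<in> \<Gamma>' \<Longrightarrow> orthogonal_matrix g"
    and iso: "isospectral \<Gamma> \<Gamma>'"
  shows "cf.dim (invariant_hpoly \<Gamma> k) = cf.dim (invariant_hpoly \<Gamma>' k)"
proof -
  have H: "cf.dim (harmonic_hpoly \<Gamma> k) = cf.dim (harmonic_hpoly \<Gamma>' k)" for k
    using iso orbifold_spectrum_eq_dim[OF n G(1), of \<Gamma> k] orbifold_spectrum_eq_dim[OF n G(2), of \<Gamma>' k]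
    by (simp add: isospectral_def)
  show ?thesis
  proof (induction k rule: less_induct)
    case (less k)
    show ?case
    proof (cases "k < 2")
      case False
      then obtain j where "k = Suc (Suc j)" by (metis add_2_eq_Suc le_Suc_ex not_less)
      then show ?thesis using less[of j] H dim_invariant_hpoly[OF G(1)] dim_invariant_hpoly[OF G(2)] by simp
    qed (simp add: dim_invariant_hpoly_low H)
  qed
qed

section \<open>Characters on homogeneous polynomials\<close>

primrec mpow :: "real^'n^'n \<Rightarrow> nat \<Rightarrow> real^'n^'n" where
  "mpow g 0 = mat 1"
| "mpow g (Suc k) = g ** mpow g k"

definition comp_mat :: "real^'n^'n \<Rightarrow> (real^'n \<Rightarrow> complex) \<Rightarrow> real^'n \<Rightarrow> complex" where
  "comp_mat g f x = f (g *v x)"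

lemma sum_fun_apply: "sum f A x = (\<Sum>i\<in>A. f i x)" for f :: "'i \<Rightarrow> 'a \<Rightarrow> complex"
  by (induction A rule: infinite_finite_induct) auto

lemma comp_mat_add: "comp_mat g (f + f') = comp_mat g f + comp_mat g f'"
  by (simp add: comp_mat_def plus_fun_def fun_eq_iff)

lemma comp_mat_scale: "comp_mat g (scale_fun c f) = scale_fun c (comp_mat g f)"
  by (simp add: comp_mat_def scale_fun_def fun_eq_iff)

lemma comp_mat_comp: "comp_mat g (comp_mat h f) = comp_mat (h ** g) f"
  by (simp add: comp_mat_def fun_eq_iff matrix_vector_mul_assoc)

lemma comp_mat_sum: "comp_mat g (\<Sum>i\<in>I. scale_fun (c i) (f i)) = (\<Sum>i\<in>I. scale_fun (c i) (comp_mat g (f i)))"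
proof (induction I rule: infinite_finite_induct)
  case (insert x F)
  then show ?case by (simp only: sum.insert[OF insert.hyps] comp_mat_add comp_mat_scale)
qed (simp_all add: comp_mat_def zero_fun_def fun_eq_iff)

lemma hpoly_comp_mat: "p \<in> hpoly k \<Longrightarrow> comp_mat g p \<in> hpoly k"
  using hpoly_comp[of p k g] by (simp add: comp_mat_def[abs_def])

lemma lin_map_comp_mat: "lin_map (hpoly k) (hpoly k) (comp_mat g)"
  by (auto simp: lin_map_def hpoly_comp_mat comp_mat_add comp_mat_scale)

definition coord_mult :: "'n \<Rightarrow> (real^'n \<Rightarrow> complex) \<Rightarrow> real^'n \<Rightarrow> complex" where
  "coord_mult i f x = of_real (x$i) * f x"

lemma lin_map_coord_mult: "lin_map (hpoly k) (hpoly (Suc k)) (coord_mult i)"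
  using hpoly_coord_mult
  by (fastforce simp: lin_map_def coord_mult_def[abs_def] plus_fun_def scale_fun_def algebra_simps)

lemma lin_map_pd: "lin_map (hpoly (Suc k)) (hpoly k) (pd i)"
  unfolding lin_map_def
proof (intro conjI ballI allI)
  show "pd i ` hpoly (Suc k) \<subseteq> hpoly k" using hpoly_pd by blast
  show "pd i (f + g) = pd i f + pd i g" if "f \<in> hpoly (Suc k)" "g \<in> hpoly (Suc k)" for f g
    unfolding plus_fun_def
    by (rule ext) (rule pd_add[OF hpoly_differentiable[OF that(1)] hpoly_differentiable[OF that(2)]])
  show "pd i (scale_fun c f) = scale_fun c (pd i f)" if "f \<in> hpoly (Suc k)" for c f
    unfolding scale_fun_def by (rule ext) (rule pd_cmult[OF hpoly_differentiable[OF that]])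
qed

lemma lin_map_compose: "lin_map V W A \<Longrightarrow> lin_map W X B \<Longrightarrow> lin_map V X (\<lambda>f. B (A f))"
  unfolding lin_map_def by (auto simp: image_subset_iff)

definition poly_char :: "real^'n^'n \<Rightarrow> nat \<Rightarrow> complex" where
  "poly_char g k = lin_trace (hpoly k) (comp_mat g)"

text \<open>Carries Newton's identities without eigenvalues. Writing M(k) for this matrix and h(k)
  for \<open>poly_char g k\<close>, one has M(k + 1) = h(k) g + g M(k), and by Euler's identity the
  trace of M(k) is k h(k).\<close>

definition poly_char_matrix :: "real^'n^'n \<Rightarrow> nat \<Rightarrow> 'n \<Rightarrow> 'n \<Rightarrow> complex" where
  "poly_char_matrix g k c b = lin_trace (hpoly k) (\<lambda>f. coord_mult c (pd b (comp_mat g f)))"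

lemma lin_trace_0: "lin_trace V (\<lambda>f. (\<lambda>x. 0)) = 0"
  by (simp add: lin_trace_def cf.representation_zero[unfolded zero_fun_def])

lemma lin_trace_add:
  assumes V: "fin_dim V" and A: "\<And>f. f \<in> V \<Longrightarrow> A f \<in> V" and B: "\<And>f. f \<in> V \<Longrightarrow> B f \<in> V"
  shows "lin_trace V (\<lambda>f. A f + B f) = lin_trace V A + lin_trace V B"
proof -
  have "lin_trace V (\<lambda>f. A f + B f) = lin_trace V (\<lambda>f. \<Sum>i\<in>{True, False}. scale_fun 1 ((if i then A else B) f))"
    by (rule arg_cong[of _ _ "lin_trace V"]) (auto simp: scale_fun_def fun_eq_iff)
  also have "\<dots> = lin_trace V A + lin_trace V B"
    by (subst lin_trace_lincomb[OF V]) (use A B in auto)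
  finally show ?thesis .
qed

lemma poly_char_matrix_0:
  fixes g :: "real^'n^'n"
  shows "poly_char_matrix g 0 c b = 0"
proof -
  have *: "coord_mult c (pd b (comp_mat g f)) = (\<lambda>x. 0)" if "f \<in> hpoly 0" for f
    unfolding hpoly_pd_0[OF hpoly_comp_mat[OF that, of g], of b] by (simp add: coord_mult_def[abs_def])
  have "poly_char_matrix g 0 c b = lin_trace (hpoly 0 :: (real^'n \<Rightarrow> complex) set) (\<lambda>f. (\<lambda>x. 0))"
    unfolding poly_char_matrix_def by (rule lin_trace_cong) (simp_all only: * fin_dim_hpoly)
  then show ?thesis by (simp only: lin_trace_0)
qed

lemma hpoly_coord_mult_pd: "f \<in> hpoly k \<Longrightarrow> coord_mult c (pd b f) \<in> hpoly k"
proof (cases k)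
  case 0
  assume "f \<in> hpoly k"
  then have "pd b f = (\<lambda>x. 0)" using hpoly_pd_0 0 by blast
  then have "coord_mult c (pd b f) = (\<lambda>x. 0)"
    by (simp add: coord_mult_def[abs_def])
  then show ?thesis using hpoly_0 by simp
next
  case (Suc j)
  assume "f \<in> hpoly k"
  then show ?thesis using lin_mapD(1)[OF lin_map_coord_mult] lin_mapD(1)[OF lin_map_pd] Suc by blast
qed

lemma poly_char_matrix_Suc:
  fixes g :: "real^'n^'n"
  shows "poly_char_matrix g (Suc k) c b =
    of_real (g$c$b) * poly_char g k + (\<Sum>e\<in>UNIV. of_real (g$c$e) * poly_char_matrix g k e b)"
proof -
  let ?V = "hpoly k :: (real^'n \<Rightarrow> complex) set"
  note fV = fin_dim_hpoly[of k, where 'a = 'n]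
  \<comment> \<open>\<open>coord_mult c\<close> is moved round the trace, which lowers the degree to
    \<open>k\<close>. Coordinate \<open>c\<close> of g x is a combination of coordinates, and the
    product rule produces the two terms.\<close>
  have "poly_char_matrix g (Suc k) c b = lin_trace ?V (\<lambda>f. pd b (comp_mat g (coord_mult c f)))"
    unfolding poly_char_matrix_def
    by (rule lin_trace_commute[OF fin_dim_hpoly fV lin_map_compose[OF lin_map_comp_mat lin_map_pd] lin_map_coord_mult])
  also have "\<dots> = lin_trace ?V (\<lambda>f. scale_fun (of_real (g$c$b)) (comp_mat g f)
      + (\<Sum>e\<in>UNIV. scale_fun (of_real (g$c$e)) (coord_mult e (pd b (comp_mat g f)))))"
  proof (rule lin_trace_cong[OF _ fV], rule ext)
    fix f :: "real^'n \<Rightarrow> complex" and x assume f: "f \<in> ?V"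
    have d: "comp_mat g f differentiable (at x)" for x
      using hpoly_differentiable[OF hpoly_comp_mat[OF f]] .
    have "comp_mat g (coord_mult c f) = (\<lambda>x. \<Sum>e\<in>UNIV. of_real (g$c$e) * (of_real (x$e) * comp_mat g f x))"
      by (simp add: comp_mat_def coord_mult_def fun_eq_iff matrix_vector_mult_def sum_distrib_right mult.assoc)
    then have "pd b (comp_mat g (coord_mult c f)) x =
       (\<Sum>e\<in>UNIV. pd b (\<lambda>x. of_real (g$c$e) * (of_real (x$e) * comp_mat g f x)) x)"
      by (simp add: pd_sum d differentiable_coord)
    also have "\<dots> = (\<Sum>e\<in>UNIV. of_real (g$c$e) *
        (of_real (x$e) * pd b (comp_mat g f) x + (if b = e then 1 else 0) * comp_mat g f x))"
      by (intro sum.cong refl) (simp add: pd_cmult d differentiable_coord pd_coord_mult)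
    also have "\<dots> = (\<Sum>e\<in>UNIV. of_real (g$c$e) * (of_real (x$e) * pd b (comp_mat g f) x))
        + (\<Sum>e\<in>UNIV. if b = e then of_real (g$c$e) * comp_mat g f x else 0)"
      unfolding sum.distrib[symmetric] by (intro sum.cong refl) (simp add: distrib_left)
    also have "\<dots> = (\<Sum>e\<in>UNIV. of_real (g$c$e) * (of_real (x$e) * pd b (comp_mat g f) x))
        + of_real (g$c$b) * comp_mat g f x" by simp
    also have "\<dots> = (scale_fun (of_real (g$c$b)) (comp_mat g f)
      + (\<Sum>e\<in>UNIV. scale_fun (of_real (g$c$e)) (coord_mult e (pd b (comp_mat g f))))) x"
      by (simp add: scale_fun_def coord_mult_def sum_fun_apply)
    finally show "pd b (comp_mat g (coord_mult c f)) x = (scale_fun (of_real (g$c$b)) (comp_mat g f)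
      + (\<Sum>e\<in>UNIV. scale_fun (of_real (g$c$e)) (coord_mult e (pd b (comp_mat g f))))) x" .
  qed
  also have "\<dots> = lin_trace ?V (\<lambda>f. scale_fun (of_real (g$c$b)) (comp_mat g f))
      + lin_trace ?V (\<lambda>f. \<Sum>e\<in>UNIV. scale_fun (of_real (g$c$e)) (coord_mult e (pd b (comp_mat g f))))"
    by (rule lin_trace_add[OF fV])
      (auto intro!: cf.subspace_scale cf.subspace_sum subspace_hpoly hpoly_comp_mat hpoly_coord_mult_pd)
  also have "lin_trace ?V (\<lambda>f. \<Sum>e\<in>UNIV. scale_fun (of_real (g$c$e)) (coord_mult e (pd b (comp_mat g f))))
      = (\<Sum>e\<in>UNIV. of_real (g$c$e) * poly_char_matrix g k e b)"
    unfolding poly_char_matrix_def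
    by (rule lin_trace_lincomb[OF fV]) (intro hpoly_comp_mat hpoly_coord_mult_pd)
  also have "lin_trace ?V (\<lambda>f. scale_fun (of_real (g$c$b)) (comp_mat g f)) = of_real (g$c$b) * poly_char g k"
    using lin_trace_lincomb[OF fV, of "{()}" "\<lambda>_. comp_mat g" "\<lambda>_. of_real (g$c$b)"]
    by (simp add: hpoly_comp_mat poly_char_def)
  finally show ?thesis .
qed

text \<open>The diagonal operators add up to the Euler operator, which is multiplication by
  \<open>k\<close> in degree \<open>k\<close>.\<close>

lemma poly_char_matrix_trace:
  fixes g :: "real^'n^'n"
  shows "(\<Sum>b\<in>UNIV. poly_char_matrix g k b b) = of_nat k * poly_char g k"
proof -
  note fV = fin_dim_hpoly[of k, where 'a = 'n]
  have "(\<Sum>b\<in>UNIV. poly_char_matrix g k b b) = (\<Sum>b\<in>UNIV. 1 * poly_char_matrix g k b b)" by simp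
  also have "\<dots> = lin_trace (hpoly k) (\<lambda>f. \<Sum>b\<in>UNIV. scale_fun 1 (coord_mult b (pd b (comp_mat g f))))"
    unfolding poly_char_matrix_def
    by (rule lin_trace_lincomb[OF fV, symmetric]) (intro hpoly_comp_mat hpoly_coord_mult_pd)
  also have "\<dots> = lin_trace (hpoly k) (\<lambda>f. scale_fun (of_nat k) (comp_mat g f))"
  proof (rule lin_trace_cong[OF _ fV], rule ext)
    fix f :: "real^'n \<Rightarrow> complex" and x assume f: "f \<in> hpoly k"
    show "(\<Sum>b\<in>UNIV. scale_fun 1 (coord_mult b (pd b (comp_mat g f)))) x = scale_fun (of_nat k) (comp_mat g f) x"
      using hpoly_euler[OF hpoly_comp_mat[OF f], of x g]
      by (simp add: scale_fun_def coord_mult_def sum_fun_apply)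
  qed
  also have "\<dots> = of_nat k * poly_char g k"
    using lin_trace_lincomb[OF fV, of "{()}" "\<lambda>_. comp_mat g" "\<lambda>_. of_nat k"]
    by (simp add: hpoly_comp_mat poly_char_def)
  finally show ?thesis .
qed

lemma poly_char_0:
  fixes g :: "real^'n^'n"
  shows "poly_char g 0 = 1"
proof -
  have *: "comp_mat g f = f" if "f \<in> hpoly 0" for f
    using that by (induction rule: hpoly_induct) (auto simp: comp_mat_def fun_eq_iff)
  have "poly_char g 0 = lin_trace (hpoly 0 :: (real^'n \<Rightarrow> complex) set) (\<lambda>f. f)"
    unfolding poly_char_def by (rule lin_trace_cong) (simp_all only: * fin_dim_hpoly)
  also have "\<dots> = of_nat (cf.dim (hpoly 0 :: (real^'n \<Rightarrow> complex) set))" by (rule lin_trace_id[OF fin_dim_hpoly])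
  also have "cf.dim (hpoly 0 :: (real^'n \<Rightarrow> complex) set) = 1"
  proof -
    have "cf.independent {\<lambda>x::real^'n. 1::complex}"
      by (rule cf.independent_insertI) (auto simp: zero_fun_def fun_eq_iff cf.independent_empty)
    then show ?thesis unfolding hpoly_def by (simp add: cf.dim_eq_card_independent)
  qed
  finally show ?thesis by simp
qed

lemma poly_char_matrix_eq:
  "poly_char_matrix g k c b = (\<Sum>j<k. poly_char g (k - Suc j) * of_real (mpow g (Suc j)$c$b))"
proof (induction k arbitrary: c)
  case (Suc k)
  have "(\<Sum>e\<in>UNIV. of_real (g$c$e) * poly_char_matrix g k e b) =
      (\<Sum>j<k. poly_char g (k - Suc j) * of_real (mpow g (Suc (Suc j))$c$b))"
    unfolding Suc mpow.simps(2)[of g "Suc _"] matrix_matrix_mult_def[of g "mpow g (Suc _)"]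
    by (simp add: sum_distrib_left sum.swap[of _ "{..<k}"] mult.left_commute del: mpow.simps)
  then show ?case
    unfolding poly_char_matrix_Suc sum.lessThan_Suc_shift by (simp add: mult.commute)
qed (simp add: poly_char_matrix_0)

lemma poly_char_Suc:
  "of_nat (Suc k) * poly_char g (Suc k) = (\<Sum>j\<le>k. of_real (trace (mpow g (Suc j))) * poly_char g (k - j))"
proof -
  have "of_nat (Suc k) * poly_char g (Suc k) =
     (\<Sum>b\<in>UNIV. \<Sum>j<Suc k. poly_char g (Suc k - Suc j) * of_real (mpow g (Suc j)$b$b))"
    unfolding poly_char_matrix_trace[symmetric] poly_char_matrix_eq ..
  also have "\<dots> = (\<Sum>j<Suc k. \<Sum>b\<in>UNIV. poly_char g (Suc k - Suc j) * of_real (mpow g (Suc j)$b$b))"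
    by (rule sum.swap)
  also have "\<dots> = (\<Sum>j\<le>k. of_real (trace (mpow g (Suc j))) * poly_char g (k - j))"
    unfolding lessThan_Suc_atMost
    by (simp add: trace_def sum_distrib_left sum_distrib_right mult.commute del: mpow.simps)
  finally show ?thesis .
qed

text \<open>\<open>newton p k\<close> is the complete homogeneous symmetric function \<open>h\<^sub>k\<close> when the \<open>p j\<close> are power sums.\<close>

fun newton :: "(nat \<Rightarrow> real) \<Rightarrow> nat \<Rightarrow> real" where
  "newton p 0 = 1"
| "newton p (Suc k) = (\<Sum>j\<le>k. p (Suc j) * newton p (k - j)) / real (Suc k)"

lemma newton_1: "newton p (Suc 0) = p 1"
  by simp

lemma newton_2: "newton p 2 = ((p 1)\<^sup>2 + p 2) / 2"
  by (simp add: numeral_eq_Suc power2_eq_square)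

lemma newton_3: "newton p 3 = ((p 1)^3 + 3 * p 1 * p 2 + 2 * p 3) / 6"
  by (simp add: numeral_eq_Suc field_simps)

lemma newton_4: "newton p 4 = ((p 1)^4 + 6 * (p 1)\<^sup>2 * p 2 + 3 * (p 2)\<^sup>2 + 8 * p 1 * p 3 + 6 * p 4) / 24"
  by (simp add: numeral_eq_Suc field_simps)

lemma poly_char_eq_newton: "poly_char g k = of_real (newton (\<lambda>j. trace (mpow g j)) k)"
proof (induction k rule: less_induct)
  case (less k)
  show ?case
  proof (cases k)
    case (Suc j)
    let ?p = "\<lambda>j. trace (mpow g j)"
    have IH: "poly_char g (j - i) = of_real (newton ?p (j - i))" for i
      using less[of "j - i"] Suc by simp
    have "of_real (real (Suc j)) * poly_char g (Suc j) =
        of_real (\<Sum>i\<le>j. ?p (Suc i) * newton ?p (j - i))"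
      unfolding of_real_of_nat_eq poly_char_Suc IH by (simp only: of_real_sum of_real_mult)
    also have "(\<Sum>i\<le>j. ?p (Suc i) * newton ?p (j - i)) = real (Suc j) * newton ?p (Suc j)"
      by (simp del: of_nat_Suc mpow.simps)
    finally have "of_real (real (Suc j)) * poly_char g (Suc j) =
        of_real (real (Suc j)) * complex_of_real (newton ?p (Suc j))" by (simp only: of_real_mult)
    moreover have "complex_of_real (real (Suc j)) \<noteq> 0" by (simp del: of_nat_Suc)
    ultimately have "poly_char g (Suc j) = of_real (newton ?p (Suc j))"
      using mult_left_cancel by blast
    then show ?thesis unfolding Suc .
  qed (simp add: poly_char_0)
qed

text \<open>Molien's theorem, coefficient by coefficient: averaging over the group projects onto the
  invariants, and the trace of the average is the average of the characters.\<close>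

lemma sum_newton_eq_dim:
  fixes \<Gamma> :: "(real^'n^'n) set"
  assumes fin: "finite \<Gamma>" and one: "mat 1 \<in> \<Gamma>" and clos: "\<And>g h. g \<in> \<Gamma> \<Longrightarrow> h \<in> \<Gamma> \<Longrightarrow> g ** h \<in> \<Gamma>"
    and orth: "\<And>g. g \<in> \<Gamma> \<Longrightarrow> orthogonal_matrix g" and inv: "\<And>g. g \<in> \<Gamma> \<Longrightarrow> transpose g \<in> \<Gamma>"
  shows "(\<Sum>g\<in>\<Gamma>. newton (\<lambda>j. trace (mpow g j)) k) = real (card \<Gamma>) * real (cf.dim (invariant_hpoly \<Gamma> k))"
proof -
  let ?V = "hpoly k :: (real^'n \<Rightarrow> complex) set"
  note fV = fin_dim_hpoly[of k, where 'a = 'n]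
  define N where "N = card \<Gamma>"
  have N: "N > 0" using fin one by (auto simp: N_def card_gt_0_iff)
  define P where "P f = (\<Sum>g\<in>\<Gamma>. scale_fun (1 / of_nat N) (comp_mat g f))" for f :: "real^'n \<Rightarrow> complex"
  have "lin_trace ?V P = of_nat (cf.dim (invariant_hpoly \<Gamma> k))"
  proof (rule lin_trace_projection[OF fV subspace_invariant_hpoly])
    show "invariant_hpoly \<Gamma> k \<subseteq> ?V" by (auto simp: invariant_hpoly_def)
    show "P f = f" if "f \<in> invariant_hpoly \<Gamma> k" for f
    proof -
      have "comp_mat g f = f" if "g \<in> \<Gamma>" for g
        using that \<open>f \<in> _\<close> by (simp add: invariant_hpoly_def comp_mat_def fun_eq_iff)
      then have "P f = (\<Sum>g\<in>\<Gamma>. scale_fun (1 / of_nat N) f)" unfolding P_def by (intro sum.cong) auto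
      also have "\<dots> = f" using N by (simp add: N_def fun_eq_iff sum_fun_apply scale_fun_def)
      finally show ?thesis .
    qed
    show "lin_map ?V (invariant_hpoly \<Gamma> k) P"
      unfolding lin_map_def
    proof (intro conjI ballI allI subsetI)
      show "p \<in> invariant_hpoly \<Gamma> k" if "p \<in> P ` ?V" for p
      proof -
        from that obtain f where f: "f \<in> ?V" "p = P f" by blast
        have "comp_mat h (P f) = P f" if h: "h \<in> \<Gamma>" for h
        proof -
          have hh: "transpose h ** h = mat 1" "h ** transpose h = mat 1"
            using orth[OF h] by (auto simp: orthogonal_matrix_def)
          have "comp_mat h (P f) = (\<Sum>g\<in>\<Gamma>. scale_fun (1 / of_nat N) (comp_mat (g ** h) f))"
            unfolding P_def comp_mat_sum comp_mat_comp ..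
          also have "\<dots> = P f"
            unfolding P_def
            by (rule sum.reindex_bij_witness[of _ "\<lambda>g. g ** transpose h" "\<lambda>g. g ** h"])
              (auto simp: clos h inv hh simp flip: matrix_mul_assoc)
          finally show ?thesis .
        qed
        then have "P f (h *v x) = P f x" if "h \<in> \<Gamma>" for h x
          using that by (metis comp_mat_def)
        moreover have "P f \<in> ?V"
          unfolding P_def by (intro cf.subspace_sum cf.subspace_scale subspace_hpoly hpoly_comp_mat f)
        ultimately show ?thesis by (simp add: invariant_hpoly_def f(2))
      qed
    qed (auto simp: P_def comp_mat_def scale_fun_def sum_fun_apply fun_eq_iff
        sum.distrib distrib_left sum_distrib_left mult.left_commute)
  qed
  moreover have "lin_trace ?V P = (\<Sum>g\<in>\<Gamma>. 1 / of_nat N * poly_char g k)"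
    unfolding P_def[abs_def] poly_char_def by (rule lin_trace_lincomb[OF fV hpoly_comp_mat])
  ultimately have "of_nat (cf.dim (invariant_hpoly \<Gamma> k)) = (\<Sum>g\<in>\<Gamma>. poly_char g k) / (of_nat N :: complex)"
    by (simp add: sum_divide_distrib)
  then have "complex_of_real (\<Sum>g\<in>\<Gamma>. newton (\<lambda>j. trace (mpow g j)) k) =
      of_real (real N * real (cf.dim (invariant_hpoly \<Gamma> k)))"
    using N by (simp add: poly_char_eq_newton)
  then show ?thesis unfolding N_def by (simp only: of_real_eq_iff)
qed

section \<open>Multiplicities of eigenvalues\<close>

text \<open>\<open>unity_mult N g k\<close> is the multiplicity of the eigenvalue \<open>cis (2 \<pi> k / N)\<close> of \<open>g\<close>, for \<open>g\<^sup>N = 1\<close>;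
  linear forms serve as the complexification of the space on which \<open>g\<close> acts.\<close>

definition unity_mult :: "nat \<Rightarrow> real^'n^'n \<Rightarrow> nat \<Rightarrow> nat" where
  "unity_mult N g k = cf.dim {f \<in> hpoly 1. comp_mat g f = scale_fun (cis (2 * pi * k / N)) f}"

lemma mpow_add: "mpow g (i + j) = mpow g i ** mpow g j"
  by (induction i) (auto simp: matrix_mul_assoc)

lemma mpow_mult: "mpow g (i * j) = mpow (mpow g i) j"
  by (induction j) (auto simp: mpow_add)

lemma mpow_one: "mpow (mat 1) j = mat 1"
  by (induction j) auto

lemma mpow_mod:
  assumes "mpow g N = mat 1"
  shows "mpow g (j mod N) = mpow g j"
proof -
  have "mpow g j = mpow g (N * (j div N) + j mod N)" by simp
  then show ?thesis using assms by (simp only: mpow_add mpow_mult mpow_one matrix_mul_lid)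
qed

lemma poly_char_1: "poly_char g 1 = of_real (trace g)"
  by (simp add: poly_char_eq_newton)

lemma cis_multiple_pow: "cis (2 * pi * real k / real N) ^ N = 1" if "N > 0"
proof -
  have "real N * (2 * pi * real k / real N) = 2 * pi * real k" using that by simp
  then show ?thesis unfolding Complex.DeMoivre by (simp only: cis_multiple_2pi[OF Ints_of_nat])
qed

text \<open>The average of z^(-i) g^i over one period projects onto the eigenspace of
  \<open>z\<close>, so its trace is the multiplicity.\<close>

lemma of_nat_unity_mult:
  fixes g :: "real^'n^'n"
  assumes N: "N > 0" and g: "mpow g N = mat 1"
  shows "of_nat (unity_mult N g k) =
    (\<Sum>i<N. inverse (cis (2 * pi * k / N)) ^ i * of_real (trace (mpow g i))) / of_nat N"
proof -
  define z where "z = cis (2 * pi * k / N)"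
  have z: "z \<noteq> 0" "z ^ N = 1" using cis_multiple_pow[OF N] by (auto simp: z_def)
  let ?V = "hpoly 1 :: (real^'n \<Rightarrow> complex) set"
  note fV = fin_dim_hpoly[of 1, where 'a = 'n]
  define W where "W = {f \<in> ?V. comp_mat g f = scale_fun z f}"
  define P where "P f = (\<Sum>i<N. scale_fun (inverse z ^ i / of_nat N) (comp_mat (mpow g i) f))" for f :: "real^'n \<Rightarrow> complex"
  have sW: "cf.subspace W"
    unfolding W_def
    by (rule cf.subspaceI)
      (auto simp: subspace_hpoly cf.subspace_0 cf.subspace_add cf.subspace_scale comp_mat_add comp_mat_scale
        cf.scale_right_distrib cf.scale_left_commute, auto simp: comp_mat_def scale_fun_def fun_eq_iff)
  have PV: "P f \<in> ?V" if "f \<in> ?V" for f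
    unfolding P_def using that by (intro cf.subspace_sum cf.subspace_scale subspace_hpoly hpoly_comp_mat)
  have "lin_trace ?V P = of_nat (cf.dim W)"
  proof (rule lin_trace_projection[OF fV sW])
    show "W \<subseteq> ?V" by (auto simp: W_def)
    show "P f = f" if "f \<in> W" for f
    proof -
      have "comp_mat (mpow g i) f = scale_fun (z ^ i) f" for i
      proof (induction i)
        case (Suc i)
        have "comp_mat (mpow g (Suc i)) f = comp_mat (mpow g i) (comp_mat g f)"
          by (simp add: comp_mat_comp)
        also have "\<dots> = scale_fun (z ^ Suc i) f"
          using that Suc by (simp add: W_def comp_mat_scale)
        finally show ?case .
      qed (simp add: comp_mat_def fun_eq_iff scale_fun_def)
      then have "P f = (\<Sum>i<N. scale_fun (1 / of_nat N) f)"
        unfolding P_def using z(1) by (intro sum.cong) (auto simp: power_inverse)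
      then show ?thesis using N by (simp add: sum_fun_apply fun_eq_iff scale_fun_def)
    qed
    show "lin_map ?V W P"
      unfolding lin_map_def
    proof (intro conjI ballI allI subsetI)
      show "p \<in> W" if "p \<in> P ` ?V" for p
      proof -
        from that obtain f where f: "f \<in> ?V" "p = P f" by blast
        \<comment> \<open>Applying g / z shifts the summation index by one; the two boundary terms
          agree because g^N = 1 and z^N = 1.\<close>
        have "scale_fun (inverse z) (comp_mat g (P f)) =
            (\<Sum>i<N. scale_fun (inverse z ^ Suc i / of_nat N) (comp_mat (mpow g (Suc i)) f))"
          unfolding P_def comp_mat_sum comp_mat_comp cf.scale_sum_right
          using mpow_add[of g _ 1] by (intro sum.cong) auto
        also have "\<dots> = (\<Sum>i<N. scale_fun (inverse z ^ i / of_nat N) (comp_mat (mpow g i) f))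
            + scale_fun (inverse z ^ N / of_nat N) (comp_mat (mpow g N) f)
            - scale_fun (inverse z ^ 0 / of_nat N) (comp_mat (mpow g 0) f)"
          using sum.lessThan_Suc_shift[of "\<lambda>i. scale_fun (inverse z ^ i / of_nat N) (comp_mat (mpow g i) f)" N]
          by (simp only: sum.lessThan_Suc o_def) (simp add: algebra_simps)
        also have "\<dots> = P f" using g z(2) by (simp add: P_def power_inverse)
        finally have "scale_fun z (scale_fun (inverse z) (comp_mat g (P f))) = scale_fun z (P f)" by simp
        then have "comp_mat g (P f) = scale_fun z (P f)" using z(1) by simp
        then show ?thesis using PV[OF f(1)] by (simp add: W_def f(2))
      qed
      show "P (f + f') = P f + P f'" for f f'
        unfolding P_def comp_mat_add cf.scale_right_distrib sum.distrib ..
      show "P (scale_fun c f) = scale_fun c (P f)" for c f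
        unfolding P_def comp_mat_scale cf.scale_sum_right by (simp add: mult.commute)
    qed
  qed
  moreover have "lin_trace ?V P = (\<Sum>i<N. inverse z ^ i / of_nat N * poly_char (mpow g i) 1)"
    unfolding P_def[abs_def] poly_char_def by (rule lin_trace_lincomb[OF fV hpoly_comp_mat])
  ultimately show ?thesis
    unfolding poly_char_1 unity_mult_def W_def z_def by (simp add: sum_divide_distrib)
qed

text \<open>For different \<open>i\<close> and \<open>j\<close> the terms are the powers of a single
  N-th root of unity, which is not 1 because 0 < |i - j| < N; their geometric sum vanishes.\<close>

lemma sum_cis_multiples:
  assumes "N > 0" "i < N" "j < N"
  shows "(\<Sum>k<N. cis (2 * pi * real k / real N) ^ i * inverse (cis (2 * pi * real k / real N)) ^ j) =
    (if i = j then of_nat N else 0)"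
proof (cases "i = j")
  case False
  define w where "w = cis (2 * pi * (real i - real j) / real N)"
  have "cis (2 * pi * real k / real N) ^ i * inverse (cis (2 * pi * real k / real N)) ^ j = w ^ k" for k
    unfolding w_def cis_inverse Complex.DeMoivre cis_mult
    by (rule arg_cong[of _ _ cis]) (use assms(1) in \<open>simp add: field_simps\<close>)
  moreover have "w \<noteq> 1"
  proof
    assume "w = 1"
    from arg_cong[OF this, of Re] have "cos (2 * pi * (real i - real j) / real N) = 1"
      unfolding w_def by simp
    then obtain n :: int where "2 * pi * (real i - real j) / real N = real_of_int n * 2 * pi"
      unfolding cos_one_2pi_int by (elim exE)
    then have "2 * pi * (real i - real j) = 2 * pi * (real_of_int n * real N)"
      using assms(1) by (simp add: field_simps)
    then have "real i - real j = real_of_int n * real N" unfolding mult_cancel_left by simp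
    then have "real_of_int (int i - int j) = real_of_int (n * int N)" by simp
    then have "int i - int j = n * int N" by (simp only: of_int_eq_iff)
    then have "int N dvd int i - int j" by simp
    moreover have "int i - int j \<noteq> 0" using False by simp
    ultimately have "\<bar>int N\<bar> \<le> \<bar>int i - int j\<bar>" by (intro dvd_imp_le_int)
    then show False using assms(2,3) by linarith
  qed
  moreover have "w ^ N = 1"
  proof -
    have "w ^ N = cis (2 * pi * real_of_int (int i - int j))"
      using assms(1) by (simp add: w_def Complex.DeMoivre)
    also have "\<dots> = 1" by (rule cis_multiple_2pi) simp
    finally show ?thesis .
  qed
  ultimately show ?thesis using False by (simp add: geometric_sum)
qed (simp add: power_mult_distrib[symmetric] cis_mult)

text \<open>Fourier inversion of \<open>of_nat_unity_mult\<close>.\<close>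

lemma trace_eq_sum_unity_mult:
  fixes g :: "real^'n^'n"
  assumes N: "N > 0" and g: "mpow g N = mat 1"
  shows "of_real (trace (mpow g j)) = (\<Sum>k<N. of_nat (unity_mult N g k) * cis (2 * pi * k / N) ^ j)"
proof -
  let ?z = "\<lambda>k. cis (2 * pi * real k / real N)"
  have zj: "?z k ^ (j mod N) = ?z k ^ j" for k
  proof -
    have "?z k ^ j = ?z k ^ (N * (j div N) + j mod N)" by simp
    then show ?thesis by (simp only: power_add power_mult cis_multiple_pow[OF N] power_one mult_1_left)
  qed
  have "(\<Sum>k<N. of_nat (unity_mult N g k) * ?z k ^ (j mod N)) =
      (\<Sum>k<N. \<Sum>i<N. (?z k ^ (j mod N) * inverse (?z k) ^ i) * of_real (trace (mpow g i)) / of_nat N)"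
    unfolding of_nat_unity_mult[OF assms] sum_divide_distrib sum_distrib_right
    by (intro sum.cong refl) (simp only: times_divide_eq_left times_divide_eq_right mult_ac)
  also have "\<dots> = (\<Sum>i<N. (\<Sum>k<N. ?z k ^ (j mod N) * inverse (?z k) ^ i) * of_real (trace (mpow g i)) / of_nat N)"
    by (subst sum.swap) (simp add: sum_divide_distrib sum_distrib_right)
  also have "\<dots> = (\<Sum>i<N. if j mod N = i then of_real (trace (mpow g i)) else 0)"
    using N by (intro sum.cong refl) (auto simp only: sum_cis_multiples lessThan_iff mod_less_divisor if_True if_False
        mult_zero_left div_0 nonzero_mult_div_cancel_left of_nat_eq_0_iff split: if_split)
  also have "\<dots> = of_real (trace (mpow g (j mod N)))" using N by simp
  finally show ?thesis unfolding zj mpow_mod[OF g] by simp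
qed

section \<open>Poles of the Molien series\<close>

text \<open>Let H be the series of \<open>h\<close>, Q the product of linear factors and
  \<open>Pf I\<close> the generating series of the power sums. The recursion says H' = Pf H, and
  logarithmic differentiation gives Q' = - Pf Q. So H Q has derivative 0 and constant term
  1.\<close>

lemma newton_fps:
  fixes h P :: "nat \<Rightarrow> complex" and \<mu> :: "'i \<Rightarrow> nat"
  assumes I: "finite I" and h0: "h 0 = 1"
    and rec: "\<And>k. of_nat (Suc k) * h (Suc k) = (\<Sum>j\<le>k. P (Suc j) * h (k - j))"
    and P: "\<And>j. P (Suc j) = (\<Sum>i\<in>I. of_nat (\<mu> i) * z i ^ Suc j)"
  shows "Abs_fps h * (\<Prod>i\<in>I. (1 - fps_const (z i) * fps_X) ^ \<mu> i) = 1"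
proof -
  define L where "L i = Abs_fps (\<lambda>j. z i ^ j)" for i
  define f where "f i = (1 - fps_const (z i) * fps_X)" for i
  have fL: "f i * L i = 1" for i
  proof (rule fps_ext)
    fix k show "fps_nth (f i * L i) k = fps_nth (1 :: complex fps) k"
      by (cases k) (simp_all add: f_def L_def left_diff_distrib mult.assoc fps_mult_fps_X_commute)
  qed
  have df1: "fps_deriv (f i) = - fps_const (z i)" for i by (simp add: f_def)
  have df: "fps_deriv (f i ^ m) = - (fps_const (of_nat m * z i) * L i) * f i ^ m" for i m
  proof (cases m)
    case (Suc k)
    have "fps_deriv (f i ^ m) = fps_const (of_nat m) * (- fps_const (z i)) * f i ^ k"
      by (simp only: Suc fps_deriv_power df1 diff_Suc_1)
    also have "\<dots> = - (fps_const (of_nat m * z i)) * (f i * L i) * f i ^ k"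
      unfolding fL fps_const_mult[symmetric] by (simp only: mult_1_right mult_minus_left mult_minus_right)
    also have "\<dots> = - (fps_const (of_nat m * z i) * L i) * f i ^ m"
      unfolding Suc power_Suc by (simp only: mult_minus_left mult_minus_right mult_ac)
    finally show ?thesis .
  qed simp
  define Pf where "Pf J = (\<Sum>i\<in>J. fps_const (of_nat (\<mu> i) * z i) * L i)" for J
  have dQ: "fps_deriv (\<Prod>i\<in>J. f i ^ \<mu> i) = - Pf J * (\<Prod>i\<in>J. f i ^ \<mu> i)" if "finite J" for J
    using that
  proof (induction J rule: finite_induct)
    case (insert x J)
    then show ?case by (simp add: Pf_def df algebra_simps)
  qed (simp add: Pf_def)
  have dH: "fps_deriv (Abs_fps h) = Pf I * Abs_fps h"
  proof (rule fps_ext)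
    fix k
    have "fps_nth (Pf I) j = P (Suc j)" for j
      by (simp add: Pf_def L_def P fps_sum_nth mult_ac)
    then show "fps_nth (fps_deriv (Abs_fps h)) k = fps_nth (Pf I * Abs_fps h) k"
      using rec[of k] by (simp add: fps_mult_nth atLeast0AtMost del: of_nat_Suc)
  qed
  let ?Q = "\<Prod>i\<in>I. f i ^ \<mu> i"
  have "fps_deriv (Abs_fps h * ?Q) = 0"
    using dQ[OF I] dH by (simp add: algebra_simps)
  then have "Abs_fps h * ?Q = fps_const (fps_nth (Abs_fps h * ?Q) 0)"
    by (simp only: fps_deriv_eq_0_iff)
  also have "fps_nth (Abs_fps h * ?Q) 0 = 1"
  proof -
    have "fps_nth ?Q 0 = 1" using I by (induction I rule: finite_induct) (auto simp: f_def fps_power_zeroth)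
    then show ?thesis by (simp add: h0)
  qed
  finally show ?thesis by (simp add: f_def)
qed

text \<open>Two sums of reciprocals of products are multiplied by the common denominator in which
  every factor has exponent \<open>n\<close>. The result is an identity of polynomials, which can be
  evaluated at a pole.\<close>

lemma sum_linear_factors_eq:
  fixes h :: "'g \<Rightarrow> nat \<Rightarrow> complex" and h' :: "'h \<Rightarrow> nat \<Rightarrow> complex"
  assumes I: "finite I"
    and h: "\<And>g. g \<in> G \<Longrightarrow> Abs_fps (h g) * (\<Prod>i\<in>I. (1 - fps_const (z i) * fps_X) ^ \<mu> g i) = 1"
    and h': "\<And>g. g \<in> G' \<Longrightarrow> Abs_fps (h' g) * (\<Prod>i\<in>I. (1 - fps_const (z i) * fps_X) ^ \<mu>' g i) = 1"
    and le: "\<And>g i. g \<in> G \<Longrightarrow> i \<in> I \<Longrightarrow> \<mu> g i \<le> n" "\<And>g i. g \<in> G' \<Longrightarrow> i \<in> I \<Longrightarrow> \<mu>' g i \<le> n"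
    and eq: "\<And>k. (\<Sum>g\<in>G. h g k) = (\<Sum>g\<in>G'. h' g k)"
  shows "(\<Sum>g\<in>G. \<Prod>i\<in>I. [:1, - z i:] ^ (n - \<mu> g i)) = (\<Sum>g\<in>G'. \<Prod>i\<in>I. [:1, - z i:] ^ (n - \<mu>' g i))"
proof -
  define f where "f i = (1 - fps_const (z i) * fps_X)" for i
  have fp: "fps_of_poly [:1, - z i:] = f i" for i
    by (simp add: f_def fps_of_poly_linear' flip: fps_const_neg)
  have *: "Abs_fps h * (\<Prod>i\<in>I. f i ^ n) = fps_of_poly (\<Prod>i\<in>I. [:1, - z i:] ^ (n - m i))"
    if "Abs_fps h * (\<Prod>i\<in>I. f i ^ m i) = 1" "\<And>i. i \<in> I \<Longrightarrow> m i \<le> n" for h m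
  proof -
    have "(\<Prod>i\<in>I. f i ^ n) = (\<Prod>i\<in>I. f i ^ m i) * (\<Prod>i\<in>I. f i ^ (n - m i))"
      unfolding prod.distrib[symmetric] using that(2) by (intro prod.cong refl) (simp flip: power_add)
    then have "Abs_fps h * (\<Prod>i\<in>I. f i ^ n) = (Abs_fps h * (\<Prod>i\<in>I. f i ^ m i)) * (\<Prod>i\<in>I. f i ^ (n - m i))"
      by (simp only: mult.assoc)
    then show ?thesis unfolding that(1) by (simp add: fps_of_poly_prod fps_of_poly_power fp)
  qed
  have sumh: "(\<Sum>g\<in>A. Abs_fps (k g)) = Abs_fps (\<lambda>j. \<Sum>g\<in>A. k g j)" for A and k :: "'x \<Rightarrow> nat \<Rightarrow> complex"
    by (rule fps_ext) (simp add: fps_sum_nth)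
  have "fps_of_poly (\<Sum>g\<in>G. \<Prod>i\<in>I. [:1, - z i:] ^ (n - \<mu> g i)) = (\<Sum>g\<in>G. Abs_fps (h g)) * (\<Prod>i\<in>I. f i ^ n)"
    unfolding fps_of_poly_sum sum_distrib_right
    by (intro sum.cong refl *[symmetric] le) (use h in \<open>auto simp: f_def\<close>)
  also have "(\<Sum>g\<in>G. Abs_fps (h g)) = (\<Sum>g\<in>G'. Abs_fps (h' g))" unfolding sumh eq ..
  also have "\<dots> * (\<Prod>i\<in>I. f i ^ n) = fps_of_poly (\<Sum>g\<in>G'. \<Prod>i\<in>I. [:1, - z i:] ^ (n - \<mu>' g i))"
    unfolding fps_of_poly_sum sum_distrib_right
    by (intro sum.cong refl * le) (use h' in \<open>auto simp: f_def\<close>)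
  finally show ?thesis by (simp only: fps_of_poly_eq_iff)
qed

text \<open>The leading coefficient at the pole \<open>1 / z k\<close>, up to the common denominator \<open>\<Prod>i\<in>I. (1 - z i x)\<^sup>n\<close>.\<close>

definition pole_coeff :: "(nat \<Rightarrow> complex) \<Rightarrow> nat set \<Rightarrow> nat \<Rightarrow> nat \<Rightarrow> (nat \<Rightarrow> nat) \<Rightarrow> complex" where
  "pole_coeff z I k n m = (\<Prod>i\<in>I - {k}. (1 - z i / z k) ^ (n - m i))"

text \<open>The common power of the factor belonging to \<open>k\<close>, with exponent n - M, is
  cancelled. At 1 / z_k every term of multiplicity below \<open>M\<close> then vanishes, and on the
  side of \<open>G'\<close> these are all terms.\<close>

lemma pole_coeff_sum_eq_0:
  fixes z :: "nat \<Rightarrow> complex"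
  assumes I: "finite I" "k \<in> I" and z: "z k \<noteq> 0"
    and eq: "(\<Sum>g\<in>G. \<Prod>i\<in>I. [:1, - z i:] ^ (n - \<mu> g i)) = (\<Sum>g\<in>G'. \<Prod>i\<in>I. [:1, - z i:] ^ (n - \<mu>' g i))"
    and M: "M \<le> n" "\<And>g. g \<in> G \<Longrightarrow> \<mu> g k \<le> M" "\<And>g. g \<in> G' \<Longrightarrow> \<mu>' g k < M"
  shows "(\<Sum>g\<in>G. if \<mu> g k = M then pole_coeff z I k n (\<mu> g) else 0) = 0"
proof -
  define l where "l = [:1, - z k:]"
  define C where "C m = (\<Prod>i\<in>I - {k}. [:1, - z i:] ^ (n - m i))" for m :: "nat \<Rightarrow> nat"
  have "l \<noteq> 0" by (simp add: l_def)
  have split: "(\<Prod>i\<in>I. [:1, - z i:] ^ (n - m i)) = l ^ (n - M) * (l ^ (M - m k) * C m)" if "m k \<le> M" for m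
  proof -
    have "n - m k = (n - M) + (M - m k)" using M(1) that by simp
    then show ?thesis using I by (simp add: prod.remove[of I k] C_def l_def power_add mult.assoc)
  qed
  have "l ^ (n - M) * (\<Sum>g\<in>G. l ^ (M - \<mu> g k) * C (\<mu> g)) = l ^ (n - M) * (\<Sum>g\<in>G'. l ^ (M - \<mu>' g k) * C (\<mu>' g))"
    using eq split M(2,3) by (simp add: sum_distrib_left less_imp_le)
  then have "(\<Sum>g\<in>G. l ^ (M - \<mu> g k) * C (\<mu> g)) = (\<Sum>g\<in>G'. l ^ (M - \<mu>' g k) * C (\<mu>' g))"
    using \<open>l \<noteq> 0\<close> by simp
  then have "(\<Sum>g\<in>G. poly l (1 / z k) ^ (M - \<mu> g k) * poly (C (\<mu> g)) (1 / z k)) =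
      (\<Sum>g\<in>G'. poly l (1 / z k) ^ (M - \<mu>' g k) * poly (C (\<mu>' g)) (1 / z k))"
    unfolding poly_power[symmetric] poly_mult[symmetric] poly_sum[symmetric] by (rule arg_cong)
  moreover have "poly l (1 / z k) = 0" using z by (simp add: l_def)
  moreover have "poly (C m) (1 / z k) = pole_coeff z I k n m" for m
    by (simp add: C_def pole_coeff_def poly_prod)
  \<comment> \<open>Powers of 0 select the terms: 0^0 = 1 exactly where the multiplicity is
    \<open>M\<close>.\<close>
  ultimately have "(\<Sum>g\<in>G. 0 ^ (M - \<mu> g k) * pole_coeff z I k n (\<mu> g)) =
      (\<Sum>g\<in>G'. 0 ^ (M - \<mu>' g k) * pole_coeff z I k n (\<mu>' g))"
    by simp
  also have "\<dots> = 0" using M(3) by (intro sum.neutral) auto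
  also have "(\<Sum>g\<in>G. 0 ^ (M - \<mu> g k) * pole_coeff z I k n (\<mu> g)) =
      (\<Sum>g\<in>G. if \<mu> g k = M then pole_coeff z I k n (\<mu> g) else 0)"
    using M(2) by (intro sum.cong refl) (auto simp: power_0_left dest: le_antisym)
  finally show ?thesis .
qed

section \<open>Sixth roots of unity\<close>

definition root6 :: "nat \<Rightarrow> complex" where
  "root6 k = cis (2 * pi * k / 6)"

text \<open>The inverse of \<open>root6 1\<close> in Cartesian form; computations with it reduce to
  y^2 = y - 1.\<close>

definition y6 :: complex where "y6 = Complex (1/2) (- sqrt 3 / 2)"

lemma y6: "y6\<^sup>2 = y6 - 1" "y6 \<noteq> 0" "y6 ^ 3 = - 1"
proof -
  show *: "y6\<^sup>2 = y6 - 1" by (simp add: y6_def complex_eq_iff power2_eq_square)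
  show "y6 \<noteq> 0" by (simp add: y6_def complex_eq_iff)
  have "y6 ^ 3 = y6 * y6\<^sup>2" by (simp add: power2_eq_square power3_eq_cube)
  also have "\<dots> = y6\<^sup>2 - y6" unfolding * by (simp add: power2_eq_square[symmetric] right_diff_distrib *)
  also have "\<dots> = - 1" unfolding * by simp
  finally show "y6 ^ 3 = - 1" .
qed

lemma inverse_root6: "inverse (root6 k) = y6 ^ k"
proof -
  have y: "y6 = cis (- (pi / 3))"
    by (simp add: y6_def complex_eq_iff cos_60 sin_60)
  have "y6 ^ k = cis (real k * (- (pi / 3)))" unfolding y Complex.DeMoivre ..
  moreover have "inverse (root6 k) = cis (- (2 * pi * k / 6))" by (simp only: root6_def cis_inverse)
  ultimately show ?thesis by (simp add: mult.commute)
qed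

lemma root6_neq_0: "root6 k \<noteq> 0"
  by (simp add: root6_def)

text \<open>The inverse of an orthogonal matrix is its transpose, which has the same trace. So half
  a period of traces determines the other half.\<close>

lemma trace_mpow_reflect:
  fixes g :: "real^'n^'n"
  assumes g: "orthogonal_matrix g" and N: "mpow g N = mat 1" and i: "i \<le> N"
  shows "trace (mpow g (N - i)) = trace (mpow g i)"
proof -
  have "mpow g (N - i) ** mpow g i = mat 1" using N i by (simp flip: mpow_add)
  moreover have "orthogonal_matrix (mpow g i)"
    using g by (induction i) (auto simp: orthogonal_matrix_mul orthogonal_matrix_id)
  then have "mpow g i ** transpose (mpow g i) = mat 1" by (simp add: orthogonal_matrix_def)
  ultimately have "mpow g (N - i) = transpose (mpow g i)"
    by (metis matrix_mul_assoc matrix_mul_lid matrix_mul_rid)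
  then show ?thesis by (simp add: trace_def transpose_def)
qed

abbreviation tr_pow :: "real^'n^'n \<Rightarrow> nat \<Rightarrow> real" where
  "tr_pow g i \<equiv> trace (mpow g i)"

text \<open>As tr g^(6 - i) = tr g^i, the Fourier sums of \<open>of_nat_unity_mult\<close> are real.
  In the formula for index \<open>k\<close> the coefficients are 2 cos(\<pi> j k / 3) at tr g^j for
  j = 1, 2, and (-1)^k at tr g^3.\<close>

lemma unity_mult6:
  fixes g :: "real^'n^'n"
  assumes g: "orthogonal_matrix g" and N: "mpow g 6 = mat 1"
  shows "6 * real (unity_mult 6 g 0) = tr_pow g 0 + 2 * tr_pow g 1 + 2 * tr_pow g 2 + tr_pow g 3"
    "6 * real (unity_mult 6 g 1) = tr_pow g 0 + tr_pow g 1 - tr_pow g 2 - tr_pow g 3"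
    "6 * real (unity_mult 6 g 2) = tr_pow g 0 - tr_pow g 1 - tr_pow g 2 + tr_pow g 3"
    "6 * real (unity_mult 6 g 3) = tr_pow g 0 - 2 * tr_pow g 1 + 2 * tr_pow g 2 - tr_pow g 3"
    "6 * real (unity_mult 6 g 4) = tr_pow g 0 - tr_pow g 1 - tr_pow g 2 + tr_pow g 3"
    "6 * real (unity_mult 6 g 5) = tr_pow g 0 + tr_pow g 1 - tr_pow g 2 - tr_pow g 3"
proof -
  have t: "tr_pow g 4 = tr_pow g 2" "tr_pow g 5 = tr_pow g 1"
    using trace_mpow_reflect[OF g N, of 2] trace_mpow_reflect[OF g N, of 1] by simp_all
  have p: "y6 ^ 6 = 1" "y6 ^ 4 = - y6" "y6 ^ 5 = 1 - y6"
  proof -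
    have "y6 ^ 6 = (y6 ^ 3) ^ 2" "y6 ^ 4 = y6 ^ 3 * y6" "y6 ^ 5 = y6 ^ 3 * y6\<^sup>2"
      by (simp_all flip: power_mult power_add power_Suc2)
    then show "y6 ^ 6 = 1" "y6 ^ 4 = - y6" "y6 ^ 5 = 1 - y6" using y6 by simp_all
  qed
  have q: "y6 ^ j = y6 ^ (j mod 6)" for j
  proof -
    have "y6 ^ j = y6 ^ (6 * (j div 6) + j mod 6)" by simp
    then show ?thesis by (simp only: power_add power_mult p power_one mult_1_left)
  qed
  have main: "complex_of_real (6 * real (unity_mult 6 g k)) =
      of_real (tr_pow g 0) + y6 ^ k * of_real (tr_pow g 1) + y6 ^ (2 * k) * of_real (tr_pow g 2)
      + y6 ^ (3 * k) * of_real (tr_pow g 3) + y6 ^ (4 * k) * of_real (tr_pow g 2) + y6 ^ (5 * k) * of_real (tr_pow g 1)" for k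
  proof -
    have "of_nat (unity_mult 6 g k) = (\<Sum>i<6. (y6 ^ k) ^ i * of_real (tr_pow g i)) / 6"
      using of_nat_unity_mult[OF _ N, of k] inverse_root6[of k] by (simp add: root6_def)
    also have "(\<Sum>i<6. (y6 ^ k) ^ i * of_real (tr_pow g i)) = of_real (tr_pow g 0) + y6 ^ k * of_real (tr_pow g 1) + y6 ^ (2 * k) * of_real (tr_pow g 2)
      + y6 ^ (3 * k) * of_real (tr_pow g 3) + y6 ^ (4 * k) * of_real (tr_pow g 4) + y6 ^ (5 * k) * of_real (tr_pow g 5)"
      by (simp add: numeral_eq_Suc flip: power_mult)
    finally show ?thesis unfolding t by (simp add: mult.commute)
  qed
  \<comment> \<open>These rules, from y^2 = y - 1, bring every expression to the form p + q
    y.\<close>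
  have s: "y6 * y6 = y6 - 1" "y6 * (y6 * x) = y6 * x - x" for x
    using y6(1) by (simp_all add: power2_eq_square left_diff_distrib flip: mult.assoc)
  note r = s q[of 6] q[of 8] q[of 9] q[of 10] q[of 12] q[of 15] q[of 16] q[of 20] q[of 25]
  show "6 * real (unity_mult 6 g 0) = tr_pow g 0 + 2 * tr_pow g 1 + 2 * tr_pow g 2 + tr_pow g 3"
    using main[of 0] by (simp flip: of_real_eq_iff[where 'a = complex])
  show "6 * real (unity_mult 6 g 1) = tr_pow g 0 + tr_pow g 1 - tr_pow g 2 - tr_pow g 3"
    unfolding of_real_eq_iff[where 'a = complex, symmetric] main by (simp add: p r y6 algebra_simps)
  show "6 * real (unity_mult 6 g 2) = tr_pow g 0 - tr_pow g 1 - tr_pow g 2 + tr_pow g 3"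
    unfolding of_real_eq_iff[where 'a = complex, symmetric] main by (simp add: p r y6 algebra_simps)
  show "6 * real (unity_mult 6 g 3) = tr_pow g 0 - 2 * tr_pow g 1 + 2 * tr_pow g 2 - tr_pow g 3"
    unfolding of_real_eq_iff[where 'a = complex, symmetric] main by (simp add: p r y6 algebra_simps)
  show "6 * real (unity_mult 6 g 4) = tr_pow g 0 - tr_pow g 1 - tr_pow g 2 + tr_pow g 3"
    unfolding of_real_eq_iff[where 'a = complex, symmetric] main by (simp add: p r y6 algebra_simps)
  show "6 * real (unity_mult 6 g 5) = tr_pow g 0 + tr_pow g 1 - tr_pow g 2 - tr_pow g 3"
    unfolding of_real_eq_iff[where 'a = complex, symmetric] main by (simp add: p r y6 algebra_simps)
qed

lemma newton_fps_unity_mult: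
  fixes g :: "real^'n^'n"
  assumes "N > 0" "mpow g N = mat 1"
  shows "Abs_fps (\<lambda>k. of_real (newton (tr_pow g) k)) *
    (\<Prod>i<N. (1 - fps_const (cis (2 * pi * i / N)) * fps_X) ^ unity_mult N g i) = 1"
proof (rule newton_fps[where P = "\<lambda>j. of_real (tr_pow g j)"])
  show "of_nat (Suc k) * complex_of_real (newton (tr_pow g) (Suc k)) =
      (\<Sum>j\<le>k. of_real (tr_pow g (Suc j)) * of_real (newton (tr_pow g) (k - j)))" for k
    using poly_char_Suc[of k g] unfolding poly_char_eq_newton .
qed (auto simp: trace_eq_sum_unity_mult[OF assms] simp del: mpow.simps)

lemma unity_mult_le:
  fixes g :: "real^'n^'n"
  assumes "N > 0" "mpow g N = mat 1" "k < N"
  shows "unity_mult N g k \<le> CARD('n)"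
proof -
  have "of_nat CARD('n) = (of_nat (\<Sum>k<N. unity_mult N g k) :: complex)"
    using trace_eq_sum_unity_mult[OF assms(1,2), of 0] by (simp add: trace_I)
  then have "CARD('n) = (\<Sum>k<N. unity_mult N g k)" by (simp only: of_nat_eq_iff)
  then show ?thesis using member_le_sum[of k "{..<N}" "unity_mult N g"] assms(3) by simp
qed

text \<open>\<open>has_pole \<Gamma> M\<close>: the Molien series of \<open>\<Gamma>\<close> has a pole of exact order \<open>M\<close> at a primitive cube root of unity.\<close>

definition has_pole :: "(real^'n^'n) set \<Rightarrow> nat \<Rightarrow> bool" where
  "has_pole \<Gamma> M \<longleftrightarrow> M \<le> CARD('n) \<and> (\<forall>g\<in>\<Gamma>. unity_mult 6 g 2 \<le> M) \<and>
    (\<Sum>g\<in>\<Gamma>. if unity_mult 6 g 2 = M then pole_coeff root6 {..<6} 2 CARD('n) (unity_mult 6 g) else 0) \<noteq> 0"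

text \<open>If \<open>M\<close> exceeded \<open>M'\<close>, all multiplicities in the second group
  would lie below \<open>M\<close>, and \<open>pole_coeff_sum_eq_0\<close> would annihilate the
  coefficient that \<open>has_pole\<close> declares nonzero. Exchanging the groups gives the other
  inequality.\<close>

lemma pole_unique:
  fixes \<Gamma> \<Gamma>' :: "(real^'n^'n) set"
  assumes "\<And>g. g \<in> \<Gamma> \<Longrightarrow> mpow g 6 = mat 1" "\<And>g. g \<in> \<Gamma>' \<Longrightarrow> mpow g 6 = mat 1"
    and eq: "\<And>k. (\<Sum>g\<in>\<Gamma>. newton (tr_pow g) k) = (\<Sum>g\<in>\<Gamma>'. newton (tr_pow g) k)"
    and "has_pole \<Gamma> M" "has_pole \<Gamma>' M'"
  shows "M = M'"
proof -
  have le: "M \<le> M'" if G: "\<And>g. g \<in> \<Gamma> \<Longrightarrow> mpow g 6 = mat 1" "\<And>g. g \<in> \<Gamma>' \<Longrightarrow> mpow g 6 = mat 1"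
    and eq: "\<And>k. (\<Sum>g\<in>\<Gamma>. newton (tr_pow g) k) = (\<Sum>g\<in>\<Gamma>'. newton (tr_pow g) k)"
    and pole: "has_pole \<Gamma> M" "has_pole \<Gamma>' M'" for \<Gamma> \<Gamma>' :: "(real^'n^'n) set" and M M'
  proof (rule ccontr)
    assume "\<not> M \<le> M'"
    have nf: "Abs_fps (\<lambda>k. complex_of_real (newton (tr_pow g) k)) *
        (\<Prod>i<6. (1 - fps_const (root6 i) * fps_X) ^ unity_mult 6 g i) = 1"
      if "mpow g 6 = mat 1" for g :: "real^'n^'n"
      using newton_fps_unity_mult[OF _ that] by (simp add: root6_def)
    have "(\<Sum>g\<in>\<Gamma>. \<Prod>i<6. [:1, - root6 i:] ^ (CARD('n) - unity_mult 6 g i)) =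
        (\<Sum>g\<in>\<Gamma>'. \<Prod>i<6. [:1, - root6 i:] ^ (CARD('n) - unity_mult 6 g i))"
    proof (rule sum_linear_factors_eq[where h = "\<lambda>g k. of_real (newton (tr_pow g) k)"
          and h' = "\<lambda>g k. of_real (newton (tr_pow g) k)"])
      show "(\<Sum>g\<in>\<Gamma>. complex_of_real (newton (tr_pow g) k)) = (\<Sum>g\<in>\<Gamma>'. complex_of_real (newton (tr_pow g) k))" for k
        using eq[of k] by (simp flip: of_real_sum)
    qed (auto intro: nf unity_mult_le G)
    then have "(\<Sum>g\<in>\<Gamma>. if unity_mult 6 g 2 = M then pole_coeff root6 {..<6} 2 CARD('n) (unity_mult 6 g) else 0) = 0"
      by (rule pole_coeff_sum_eq_0[rotated 3])
        (use pole \<open>\<not> M \<le> M'\<close> root6_neq_0 in \<open>auto simp: has_pole_def intro: order_le_less_trans\<close>)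
    then show False using pole(1) by (simp add: has_pole_def)
  qed
  show ?thesis using le[of \<Gamma> \<Gamma>' M M'] le[of \<Gamma>' \<Gamma> M' M] assms by (simp add: le_antisym)
qed

section \<open>Arithmetic of traces\<close>

text \<open>Order 7: \<open>a\<close>, \<open>b\<close>, \<open>c\<close> are the traces of \<open>g\<close>, \<open>g\<^sup>2\<close>, \<open>g\<^sup>4\<close>. The cyclic expression
  tells the two cyclic orders of a multiset of traces apart.\<close>

lemma eq_set3_of_power_sums:
  fixes a b c a' b' c' :: real
  assumes "a + b + c = a' + b' + c'" "a\<^sup>2 + b\<^sup>2 + c\<^sup>2 = a'\<^sup>2 + b'\<^sup>2 + c'\<^sup>2"
    "a^3 + b^3 + c^3 = a'^3 + b'^3 + c'^3"
  shows "a' = a \<and> (b' = b \<and> c' = c \<or> b' = c \<and> c' = b) \<or> a' = b \<and> (b' = c \<and> c' = a \<or> b' = a \<and> c' = c)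
    \<or> a' = c \<and> (b' = a \<and> c' = b \<or> b' = b \<and> c' = a)"
proof -
  have e2: "a*b + b*c + c*a = a'*b' + b'*c' + c'*a'"
  proof -
    have "(a + b + c)\<^sup>2 = (a' + b' + c')\<^sup>2" using assms(1) by simp
    then show ?thesis using assms(2) by (simp add: power2_eq_square algebra_simps)
  qed
  have e3: "a*b*c = a'*b'*c'"
  proof -
    have "3 * (x*y*z) = x^3 + y^3 + z^3 - (x + y + z) * (x\<^sup>2 + y\<^sup>2 + z\<^sup>2 - (x*y + y*z + z*x))" for x y z :: real
      by (simp add: power2_eq_square power3_eq_cube algebra_simps)
    then have "3 * (a*b*c) = 3 * (a'*b'*c')" using assms e2 by metis
    then show ?thesis by simp
  qed
  \<comment> \<open>Equal power sums give equal elementary symmetric functions, so \<open>a'\<close>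
    is a root of the cubic with roots a, b, c.\<close>
  have "(a' - a) * (a' - b) * (a' - c) = a'^3 - (a + b + c) * a'\<^sup>2 + (a*b + b*c + c*a) * a' - a*b*c"
    by (simp add: power2_eq_square power3_eq_cube algebra_simps)
  also have "\<dots> = 0"
    unfolding assms(1) e2 e3 by (simp add: power2_eq_square power3_eq_cube algebra_simps)
  finally consider "a' = a" | "a' = b" | "a' = c" by auto
  moreover have two: "z = x \<and> w = y \<or> z = y \<and> w = x" if "x + y = z + w" "x\<^sup>2 + y\<^sup>2 = z\<^sup>2 + w\<^sup>2" for x y z w :: real
  proof -
    have "(z - x) * (z - y) = 0" using that by algebra
    then show ?thesis using that(1) by auto
  qed
  ultimately show ?thesis
  proof cases
    case 1
    then show ?thesis using two[of b c b' c'] assms(1,2) by auto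
  next
    case 2
    then show ?thesis using two[of c a b' c'] assms(1,2) by (auto simp: algebra_simps)
  next
    case 3
    then show ?thesis using two[of a b b' c'] assms(1,2) by (auto simp: algebra_simps)
  qed
qed

text \<open>An odd permutation changes the cyclic expression by (a - b)(b - c)(c - a) up to sign. If
  this is 0, two entries coincide, and the odd permutation has the same effect as a
  rotation.\<close>

lemma cyclic_triple_of_invariants:
  fixes a b c a' b' c' :: real
  assumes "a + b + c = a' + b' + c'" "a\<^sup>2 + b\<^sup>2 + c\<^sup>2 = a'\<^sup>2 + b'\<^sup>2 + c'\<^sup>2"
    "a^3 + b^3 + c^3 = a'^3 + b'^3 + c'^3"
    "a\<^sup>2*b + b\<^sup>2*c + c\<^sup>2*a = a'\<^sup>2*b' + b'\<^sup>2*c' + c'\<^sup>2*a'"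
  shows "a' = a \<and> b' = b \<and> c' = c \<or> a' = b \<and> b' = c \<and> c' = a \<or> a' = c \<and> b' = a \<and> c' = b"
proof -
  have "(a - b) * (b - c) * (c - a) = 0" if "a\<^sup>2*b + b\<^sup>2*c + c\<^sup>2*a = a\<^sup>2*c + c\<^sup>2*b + b\<^sup>2*a"
    using that by (simp add: power2_eq_square algebra_simps)
  then have eq: "a = b \<or> b = c \<or> c = a" if "a\<^sup>2*b + b\<^sup>2*c + c\<^sup>2*a = a\<^sup>2*c + c\<^sup>2*b + b\<^sup>2*a"
    using that by auto
  show ?thesis
    using eq_set3_of_power_sums[OF assms(1-3)] eq assms(4) by (auto simp: algebra_simps)
qed

text \<open>Order 4, cyclic: \<open>a\<close> and \<open>b\<close> are the traces of \<open>g\<close> and \<open>g\<^sup>2\<close>.\<close>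

lemma cyclic4_traces:
  fixes a b a' b' n :: real
  assumes "2*a + b = 2*a' + b'"
    "2*a\<^sup>2 + b\<^sup>2 + 2*b = 2*a'\<^sup>2 + b'\<^sup>2 + 2*b'"
    "2*a^3 + b^3 + 6*a*b + 3*b*n + 4*a + 2*b = 2*a'^3 + b'^3 + 6*a'*b' + 3*b'*n + 4*a' + 2*b'"
    and "b < n" "b' < n"
  shows "a = a' \<and> b = b'"
proof (rule ccontr)
  assume ne: "\<not> ?thesis"
  define d where "d = a - a'"
  have b': "b' = b + 2*d" and a': "a' = a - d" using assms(1) by (auto simp: d_def)
  have d0: "d \<noteq> 0" using ne b' a' by auto
  have "2 * d * (2*(b + 1 - a) + 3 * d) = 0"
    using assms(2) unfolding a' b' by (simp add: power2_eq_square algebra_simps)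
  then have a: "a = b + 1 + 3*d/2" using d0 by simp
  have "6 * d * (b + d - 1 - d\<^sup>2/4 - n) = 0"
    using assms(3) unfolding a' b' unfolding a
    by (simp add: power2_eq_square power3_eq_cube field_simps)
  then have "b + d - 1 - d\<^sup>2/4 - n = 0" using d0 by simp
  \<comment> \<open>A second solution would make n - b the negative of a square, against b <
    n.\<close>
  then have "n - b = - ((d/2 - 1)\<^sup>2)" by (simp add: power2_eq_square algebra_simps)
  moreover have "(d/2 - 1)\<^sup>2 \<ge> 0" by simp
  ultimately show False using assms(4) by linarith
qed

text \<open>Here \<open>x\<close>, \<open>y\<close>, \<open>z\<close> are the traces of the three
  involutions of a Klein group. With c = n - b the equations make them the roots of (u - b)((u -
  a)^2 + c), whose only real root is b as c > 0. Then x = y = z = b, so a = b, and the sum of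
  squares gives c = 0.\<close>

lemma klein4_neq_cyclic4:
  fixes x y z a b n :: real
  assumes "x + y + z = 2*a + b"
    "x\<^sup>2 + y\<^sup>2 + z\<^sup>2 + 3*n = 2*a\<^sup>2 + b\<^sup>2 + 2*b + n"
    "x^3 + y^3 + z^3 + 3*n*(x + y + z) + 2*(x + y + z) = 2*a^3 + b^3 + 6*a*b + 3*b*n + 4*a + 2*b"
    and "b < n"
  shows False
proof -
  define c where "c = n - b"
  have n: "n = b + c" and c: "c > 0" using assms(4) by (auto simp: c_def)
  have *: "u = b" if uvw: "u + v + w = 2*a + b" "u\<^sup>2 + v\<^sup>2 + w\<^sup>2 = 2*a\<^sup>2 + b\<^sup>2 - 2*c"
    "u^3 + v^3 + w^3 = 2*a^3 + b^3 - 6*a*c" for u v w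
  proof -
    have e2: "u * v + v * w + w * u = a\<^sup>2 + 2*a*b + c"
    proof -
      have "2 * (u * v + v * w + w * u) = (u + v + w)\<^sup>2 - (u\<^sup>2 + v\<^sup>2 + w\<^sup>2)"
        by (simp add: power2_eq_square algebra_simps)
      then show ?thesis unfolding uvw by (simp add: power2_eq_square algebra_simps)
    qed
    have e3: "u * v * w = a\<^sup>2*b + c*b"
    proof -
      have "3 * (u * v * w) = u^3 + v^3 + w^3 - (u + v + w) * (u\<^sup>2 + v\<^sup>2 + w\<^sup>2 - (u * v + v * w + w * u))"
        by (simp add: power2_eq_square power3_eq_cube algebra_simps)
      then show ?thesis unfolding uvw e2 by (simp add: power2_eq_square power3_eq_cube algebra_simps)
    qed
    have "(u - b) * ((u - a)\<^sup>2 + c) = u^3 - (2*a + b) * u\<^sup>2 + (a\<^sup>2 + 2*a*b + c) * u - (a\<^sup>2*b + c*b)"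
      by (simp add: power2_eq_square power3_eq_cube algebra_simps)
    also have "\<dots> = 0"
      unfolding uvw(1)[symmetric] e2[symmetric] e3[symmetric]
      by (simp add: power2_eq_square power3_eq_cube algebra_simps)
    finally have "u = b \<or> (u - a)\<^sup>2 + c = 0" by simp
    moreover have "(u - a)\<^sup>2 + c > 0" using c by (simp add: add_nonneg_pos)
    ultimately show ?thesis by auto
  qed
  have p2: "x\<^sup>2 + y\<^sup>2 + z\<^sup>2 = 2*a\<^sup>2 + b\<^sup>2 - 2*c" using assms(2) n by simp
  have p3: "x^3 + y^3 + z^3 = 2*a^3 + b^3 - 6*a*c"
    using assms(3) unfolding assms(1) n by (simp add: algebra_simps)
  have "x = b" "y = b" "z = b"
    using *[of x y z] *[of y z x] *[of z x y] assms(1) p2 p3 by (simp_all add: ac_simps)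
  then show False using assms(1) p2 c by simp
qed

text \<open>The multiplicities of the eigenvalues 1 and -1 of a generator are \<open>m0\<close> and
  \<open>m\<close>; those of each primitive sixth and each primitive cube root are \<open>a\<close>
  and \<open>b\<close>. With e = a + b known, the unknown is d = a - b: degree 2 leaves its sign
  open, and degree 3 yields d (d^2 + 3e + 2) = 0 if the signs differ.\<close>

lemma cyclic6_multiplicities:
  fixes a b a' b' m n m0 :: real
  defines "t1 \<equiv> m0 - m + a - b" and "t2 \<equiv> m0 + m - a - b" and "t3 \<equiv> m0 - m - 2*a + 2*b"
    and "u1 \<equiv> m0 - m + a' - b'" and "u2 \<equiv> m0 + m - a' - b'" and "u3 \<equiv> m0 - m - 2*a' + 2*b'"
  assumes "a + b = a' + b'" "a \<ge> 0" "b \<ge> 0"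
    "2*t1\<^sup>2 + 2*t2\<^sup>2 + t3\<^sup>2 + 4*t2 = 2*u1\<^sup>2 + 2*u2\<^sup>2 + u3\<^sup>2 + 4*u2"
    "2*t1^3 + 2*t2^3 + t3^3 + 6*t1*t2 + 6*t2\<^sup>2 + 3*n*t3 + 6*t3
      = 2*u1^3 + 2*u2^3 + u3^3 + 6*u1*u2 + 6*u2\<^sup>2 + 3*n*u3 + 6*u3"
    "n = m0 + m + 2*a + 2*b"
  shows "a = a' \<and> b = b'"
proof -
  define e d d' where "e = a + b" and "d = a - b" and "d' = a' - b'"
  have ab: "a = (e + d)/2" "b = (e - d)/2" "a' = (e + d')/2" "b' = (e - d')/2"
    using assms(7) by (auto simp: e_def d_def d'_def field_simps)
  have e: "e \<ge> 0" using assms(8,9) by (simp add: e_def)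
  have tt: "t1 = m0 - m + d" "t2 = m0 + m - e" "t3 = m0 - m - 2*d"
    "u1 = m0 - m + d'" "u2 = m0 + m - e" "u3 = m0 - m - 2*d'"
    unfolding assms(1-6) ab by (auto simp: field_simps)
  have n: "n = m0 + m + 2*e" using assms(12) by (simp add: e_def)
  have "6 * ((d - d') * (d + d')) = 0"
    using assms(10) unfolding tt by (simp add: power2_eq_square algebra_simps)
  then consider "d = d'" | "d' = - d" by auto
  then show ?thesis
  proof cases
    case 2
    have "12 * d * (d\<^sup>2 + 3*e + 2) = 0"
      using assms(11) unfolding tt n 2 by (simp add: power2_eq_square power3_eq_cube algebra_simps)
    moreover have "d\<^sup>2 + 3*e + 2 > 0" using e by (simp add: add_nonneg_pos)
    ultimately have "d = 0" by simp
    then show ?thesis using 2 ab by simp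
  qed (simp add: ab)
qed

text \<open>\<tau> and \<rho> are the traces of the elements of order 2 and 3 of
  \<open>S\<^sub>3\<close>; their values come from degree 1 and from the pole. For e = a + b and d =
  a - b, degree 2 gives e = d^2 and degree 3 gives d (2 d^2 + 1) = 0, so e = 0.\<close>

lemma symmetric3_neq_cyclic6:
  fixes a b m n m0 :: real
  defines "t1 \<equiv> m0 - m + a - b" and "t2 \<equiv> m0 + m - a - b" and "t3 \<equiv> m0 - m - 2*a + 2*b"
  assumes "a + b > 0" "n = m0 + m + 2*a + 2*b"
    "2*t1\<^sup>2 + 2*t2\<^sup>2 + t3\<^sup>2 + 4*t2 + n = 3*\<tau>\<^sup>2 + 2*\<rho>\<^sup>2 + 3*n + 2*\<rho>"
    "2*t1^3 + 2*t2^3 + t3^3 + 6*t1*t2 + 6*t2\<^sup>2 + 3*n*t3 + 6*t3 + 4*n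
      = 3*\<tau>^3 + 2*\<rho>^3 + 9*\<tau>*n + 6*\<rho>\<^sup>2 + 6*\<tau> + 4*n"
    "\<tau> = m0 - m" "\<rho> = m0 + m - (a + b)"
  shows False
proof -
  define e d where "e = a + b" and "d = a - b"
  have tt: "t1 = m0 - m + d" "t2 = m0 + m - e" "t3 = m0 - m - 2*d"
    unfolding assms(1-3) e_def d_def by auto
  have n: "n = m0 + m + 2*e" using assms(5) by (simp add: e_def)
  have ed: "e = d\<^sup>2"
    using assms(6) unfolding assms(8,9) tt n e_def[symmetric]
    by (simp add: power2_eq_square algebra_simps)
  have "d * (2 * d\<^sup>2 + 1) = 0"
    using assms(7) unfolding assms(8,9) tt n e_def[symmetric] unfolding ed
    by (simp add: power2_eq_square power3_eq_cube algebra_simps)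
  moreover have "2 * d\<^sup>2 + 1 > 0" by (simp add: add_nonneg_pos)
  ultimately have "d = 0" by simp
  then show False using ed assms(4) by (simp add: e_def)
qed

section \<open>Finite groups of orthogonal matrices\<close>

text \<open>This predicate avoids carrying the record of the orthogonal group around.\<close>

definition mat_group :: "(real^'n^'n) set \<Rightarrow> bool" where
  "mat_group \<Gamma> \<longleftrightarrow> finite \<Gamma> \<and> mat 1 \<in> \<Gamma> \<and> (\<forall>g\<in>\<Gamma>. orthogonal_matrix g \<and> transpose g \<in> \<Gamma>) \<and>
    (\<forall>g\<in>\<Gamma>. \<forall>h\<in>\<Gamma>. g ** h \<in> \<Gamma>)"

lemma subgroup_imp_mat_group:
  assumes "subgroup \<Gamma> orthogonal_group" "finite \<Gamma>"
  shows "mat_group \<Gamma>"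
proof -
  interpret subgroup \<Gamma> orthogonal_group by fact
  have o: "orthogonal_matrix g" if "g \<in> \<Gamma>" for g
    using subset that by (auto simp: carrier_orthogonal_group)
  show ?thesis unfolding mat_group_def
  proof (intro conjI ballI)
    show "finite \<Gamma>" by fact
    show "mat 1 \<in> \<Gamma>" using one_closed by (simp add: one_orthogonal_group)
    show "transpose g \<in> \<Gamma>" if "g \<in> \<Gamma>" for g
      using m_inv_closed[OF that] by (simp add: inv_orthogonal_group[OF o[OF that]])
    show "g ** h \<in> \<Gamma>" if "g \<in> \<Gamma>" "h \<in> \<Gamma>" for g h
      using m_closed[OF that] by (simp add: mult_orthogonal_group)
  qed (rule o)
qed

definition mat_order :: "real^'n^'n \<Rightarrow> nat" where
  "mat_order g = (LEAST k. k > 0 \<and> mpow g k = mat 1)"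

context
  fixes \<Gamma> :: "(real^'n^'n) set"
  assumes G: "mat_group \<Gamma>"
begin

lemma mat_group_simps:
  "finite \<Gamma>" "mat 1 \<in> \<Gamma>" "g \<in> \<Gamma> \<Longrightarrow> orthogonal_matrix g" "g \<in> \<Gamma> \<Longrightarrow> transpose g \<in> \<Gamma>"
  "g \<in> \<Gamma> \<Longrightarrow> h \<in> \<Gamma> \<Longrightarrow> g ** h \<in> \<Gamma>"
  "g \<in> \<Gamma> \<Longrightarrow> g ** transpose g = mat 1" "g \<in> \<Gamma> \<Longrightarrow> transpose g ** g = mat 1"
  using G by (auto simp: mat_group_def orthogonal_matrix_def)

lemma mpow_in: "g \<in> \<Gamma> \<Longrightarrow> mpow g k \<in> \<Gamma>"
  by (induction k) (auto simp: mat_group_simps)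

lemma mat_group_cancel_left: "g \<in> \<Gamma> \<Longrightarrow> g ** x = g ** y \<Longrightarrow> x = y"
  by (metis mat_group_simps(7) matrix_mul_assoc matrix_mul_lid)

lemma mat_group_cancel_right: "g \<in> \<Gamma> \<Longrightarrow> x ** g = y ** g \<Longrightarrow> x = y"
  by (metis mat_group_simps(6) matrix_mul_assoc matrix_mul_rid)

lemma card_dvd:
  assumes H: "H \<subseteq> \<Gamma>" "H \<noteq> {}" "\<And>x y. x \<in> H \<Longrightarrow> y \<in> H \<Longrightarrow> x ** y \<in> H" "\<And>x. x \<in> H \<Longrightarrow> transpose x \<in> H"
  shows "card H dvd card \<Gamma>"
proof -
  define M :: "(real^'n^'n) monoid" where "M = \<lparr>carrier = \<Gamma>, monoid.mult = (**), one = mat 1\<rparr>"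
  have "group M"
  proof (rule groupI)
    show "\<exists>y\<in>carrier M. y \<otimes>\<^bsub>M\<^esub> x = \<one>\<^bsub>M\<^esub>" if "x \<in> carrier M" for x
      using that mat_group_simps by (intro bexI[of _ "transpose x"]) (auto simp: M_def)
  qed (auto simp: M_def mat_group_simps matrix_mul_assoc)
  then interpret M: group M .
  have inv: "inv\<^bsub>M\<^esub> x = transpose x" if "x \<in> \<Gamma>" for x
    using that mat_group_simps by (intro M.inv_equality) (auto simp: M_def)
  have "subgroup H M"
    using H inv by (intro M.subgroupI) (auto simp: M_def)
  from M.lagrange[OF this] have "card (rcosets\<^bsub>M\<^esub> H) * card H = card \<Gamma>"
    by (simp add: order_def M_def)
  then show ?thesis by (metis dvd_triv_right)
qed

lemma mat_order:
  assumes g: "g \<in> \<Gamma>"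
  shows "mat_order g > 0" "mpow g (mat_order g) = mat 1"
    "\<And>i j. i < mat_order g \<Longrightarrow> j < mat_order g \<Longrightarrow> mpow g i = mpow g j \<Longrightarrow> i = j"
    "mat_order g dvd card \<Gamma>" "\<And>k. mpow g k = mat 1 \<longleftrightarrow> mat_order g dvd k"
proof -
  let ?m = "mat_order g"
  have diff: "mpow g (j - i) = mat 1" if "mpow g i = mpow g j" "i \<le> j" for i j
  proof (rule mat_group_cancel_left[OF mpow_in[OF g]])
    have "mpow g i ** mpow g (j - i) = mpow g j" using that(2) by (simp flip: mpow_add)
    then show "mpow g i ** mpow g (j - i) = mpow g i ** mat 1" using that(1) by simp
  qed
  have "\<not> inj (mpow g)"
    using finite_subset[of "range (mpow g)" \<Gamma>] mpow_in[OF g] mat_group_simps(1) range_inj_infinite by blast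
  then obtain i j where "mpow g i = mpow g j" "i < j" unfolding inj_def by (metis linorder_neqE_nat)
  then have "\<exists>k>0. mpow g k = mat 1" using diff[of i j] by (intro exI[of _ "j - i"]) auto
  then have m: "?m > 0 \<and> mpow g ?m = mat 1" unfolding mat_order_def by (rule LeastI_ex)
  then show m1: "?m > 0" "mpow g ?m = mat 1" by auto
  have min: "?m \<le> k" if "k > 0" "mpow g k = mat 1" for k
    unfolding mat_order_def using that by (intro Least_le) auto
  have lt: "i = j" if "i < ?m" "j < ?m" "mpow g i = mpow g j" "i \<le> j" for i j
    using diff[OF that(3,4)] min[of "j - i"] that by force
  show inj: "i = j" if "i < ?m" "j < ?m" "mpow g i = mpow g j" for i j
    using lt[of i j] lt[of j i] that by (cases "i \<le> j") auto
  define H where "H = mpow g ` {..<?m}"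
  have H: "mpow g k \<in> H" for k
    using mpow_mod[OF m1(2), of k] m1(1) by (auto simp: H_def intro!: image_eqI[of _ _ "k mod ?m"])
  have tr: "transpose (mpow g i) \<in> H" if "i < ?m" for i
  proof -
    have "mpow g i ** mpow g (?m - i) = mpow g i ** transpose (mpow g i)"
      using that m1(2) mat_group_simps(6)[OF mpow_in[OF g]] by (simp flip: mpow_add)
    then have "transpose (mpow g i) = mpow g (?m - i)" using mat_group_cancel_left mpow_in[OF g] by metis
    then show ?thesis using H by simp
  qed
  have "card H dvd card \<Gamma>"
    by (rule card_dvd) (use m1(1) mpow_in[OF g] H tr in \<open>auto simp: H_def simp flip: mpow_add\<close>)
  moreover have "card H = ?m" unfolding H_def using inj by (subst card_image) (auto intro: inj_onI)
  ultimately show "?m dvd card \<Gamma>" by simp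
  show "mpow g k = mat 1 \<longleftrightarrow> ?m dvd k" for k
  proof
    assume "mpow g k = mat 1"
    then have "mpow g (k mod ?m) = mpow g 0" using mpow_mod[OF m1(2)] by simp
    then show "?m dvd k" using inj[of "k mod ?m" 0] m1(1) by auto
  next
    assume "?m dvd k"
    then show "mpow g k = mat 1" using m1(2) by (auto simp: mpow_mult mpow_one)
  qed
qed

lemma cyclic_eq:
  assumes g: "g \<in> \<Gamma>" "mat_order g = card \<Gamma>"
  shows "\<Gamma> = mpow g ` {..<card \<Gamma>}" "inj_on (mpow g) {..<card \<Gamma>}"
proof -
  show inj: "inj_on (mpow g) {..<card \<Gamma>}" using mat_order(3)[OF g(1)] g(2) by (auto intro: inj_onI)
  have "mpow g ` {..<card \<Gamma>} \<subseteq> \<Gamma>" using mpow_in[OF g(1)] by auto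
  then show "\<Gamma> = mpow g ` {..<card \<Gamma>}"
    using card_image[OF inj] mat_group_simps(1) by (intro card_subset_eq[symmetric]) auto
qed

text \<open>The squared Frobenius norm of g - 1 is 2n - 2 tr g.\<close>

lemma trace_eq_card_iff:
  assumes "g \<in> \<Gamma>"
  shows "trace g \<le> real CARD('n)" "trace g = real CARD('n) \<longleftrightarrow> g = mat 1"
proof -
  have *: "trace (transpose (g - mat 1) ** (g - mat 1)) = 2 * real CARD('n) - 2 * trace g"
    unfolding transpose_diff transpose_mat matrix_mult_diff_left matrix_mult_diff_right
      mat_group_simps(7)[OF assms] matrix_mul_lid matrix_mul_rid trace_sub trace_transpose trace_I by simp
  show "trace g \<le> real CARD('n)" using * trace_transpose_mult_self_nonneg[of "g - mat 1"] by simp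
  show "trace g = real CARD('n) \<longleftrightarrow> g = mat 1"
    using * trace_transpose_mult_self_eq_0[of "g - mat 1"] by auto
qed

lemma tr_pow_reflect:
  assumes "g \<in> \<Gamma>" "i \<le> mat_order g"
  shows "tr_pow g (mat_order g - i) = tr_pow g i"
  using trace_mpow_reflect[OF _ mat_order(2)[OF assms(1)] assms(2)] mat_group_simps(3)[OF assms(1)] by simp

end

text \<open>Group elements are named by exponents or pairs of exponents, with repetitions, and one
  function \<open>m\<close> describes multiplication in both groups. The implication between
  equalities makes the induced map well defined.\<close>

lemma character_isomorphic_param:
  fixes e e' :: "'k \<Rightarrow> real^'n^'n"
  assumes "\<Gamma> = range e" "\<Gamma>' = range e'" and "\<And>x y. e x = e y \<Longrightarrow> e' x = e' y"
    and "\<And>x y. e x ** e y = e (m x y)" "\<And>x y. e' x ** e' y = e' (m x y)"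
    and "\<And>x. trace (e x) = trace (e' x)"
  shows "character_isomorphic \<Gamma> \<Gamma>'"
proof -
  define \<phi> where "\<phi> z = e' (SOME x. e x = z)" for z
  have \<phi>: "\<phi> (e x) = e' x" for x
    unfolding \<phi>_def by (rule assms(3)) (rule someI[of "\<lambda>y. e y = e x" x], rule refl)
  show ?thesis
    unfolding character_isomorphic_def
  proof (intro exI[of _ \<phi>] conjI ballI)
    show "\<phi> ` \<Gamma> = \<Gamma>'" unfolding assms(1,2) image_image \<phi> ..
    show "\<phi> (g ** h) = \<phi> g ** \<phi> h" if gh: "g \<in> \<Gamma>" "h \<in> \<Gamma>" for g h
    proof -
      obtain x y where "g = e x" "h = e y" using gh unfolding assms(1) by blast
      then show ?thesis by (simp only: assms(4,5) \<phi>)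
    qed
    show "trace (\<phi> g) = trace g" if g: "g \<in> \<Gamma>" for g
    proof -
      obtain x where "g = e x" using g unfolding assms(1) by blast
      then show ?thesis by (simp only: assms(6) \<phi>)
    qed
  qed
qed

lemma mpow_eq_iff:
  assumes "mat_group \<Gamma>" "g \<in> \<Gamma>"
  shows "mpow g i = mpow g j \<longleftrightarrow> i mod mat_order g = j mod mat_order g"
proof
  have m: "mpow g (k mod mat_order g) = mpow g k" for k
    by (rule mpow_mod[OF mat_order(2)[OF assms]])
  show "i mod mat_order g = j mod mat_order g" if "mpow g i = mpow g j"
    using mat_order(3)[OF assms, of "i mod mat_order g" "j mod mat_order g"] mat_order(1)[OF assms] that m by simp
  show "mpow g i = mpow g j" if "i mod mat_order g = j mod mat_order g"
    using m[of i] m[of j] that by simp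
qed

lemma cyclic_range:
  assumes "mat_group \<Gamma>" "g \<in> \<Gamma>" "mat_order g = card \<Gamma>"
  shows "\<Gamma> = range (mpow g)"
proof
  show "\<Gamma> \<subseteq> range (mpow g)" by (subst cyclic_eq(1)[OF assms]) auto
qed (use mpow_in[OF assms(1,2)] in auto)

lemma cyclic_character_isomorphic:
  fixes \<Gamma> \<Gamma>' :: "(real^'n^'n) set"
  assumes G: "mat_group \<Gamma>" "mat_group \<Gamma>'" and g: "g \<in> \<Gamma>" "mat_order g = card \<Gamma>"
    and g': "g' \<in> \<Gamma>'" "mat_order g' = card \<Gamma>'" and card: "card \<Gamma> = card \<Gamma>'"
    and tr: "\<And>i. tr_pow g i = tr_pow g' i"
  shows "character_isomorphic \<Gamma> \<Gamma>'"
proof (rule character_isomorphic_param[where m = "(+)"])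
  show "\<Gamma> = range (mpow g)" "\<Gamma>' = range (mpow g')" using cyclic_range G g g' by blast+
  show "mpow g' x = mpow g' y" if "mpow g x = mpow g y" for x y
    using that mpow_eq_iff[OF G(1) g(1)] mpow_eq_iff[OF G(2) g'(1)] g(2) g'(2) card by simp
qed (auto simp: tr mpow_add)

lemma tr_pow_mod:
  assumes "mat_group \<Gamma>" "g \<in> \<Gamma>"
  shows "tr_pow g k = tr_pow g (k mod mat_order g)"
  using mpow_mod[OF mat_order(2)[OF assms]] by simp

lemma sum_cyclic:
  assumes "mat_group \<Gamma>" "g \<in> \<Gamma>" "mat_order g = card \<Gamma>"
  shows "(\<Sum>h\<in>\<Gamma>. f h) = (\<Sum>i<card \<Gamma>. f (mpow g i))"
proof -
  have "(\<Sum>h\<in>mpow g ` {..<card \<Gamma>}. f h) = (\<Sum>i<card \<Gamma>. f (mpow g i))"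
    using sum.reindex[OF cyclic_eq(2)[OF assms]] by simp
  then show ?thesis using cyclic_eq(1)[OF assms] by simp
qed

text \<open>The Klein four-group is the case of a rotation subgroup of order 2, \<open>S\<^sub>3\<close> that of order 3.\<close>

definition dihedral :: "(real^'n^'n) set \<Rightarrow> real^'n^'n \<Rightarrow> real^'n^'n \<Rightarrow> bool" where
  "dihedral \<Gamma> r t \<longleftrightarrow> r \<in> \<Gamma> \<and> t \<in> \<Gamma> \<and> t \<notin> range (mpow r) \<and> mat_order t = 2 \<and>
    mat_order (r ** t) = 2 \<and> card \<Gamma> = 2 * mat_order r"

definition dihedral_elem :: "real^'n^'n \<Rightarrow> real^'n^'n \<Rightarrow> nat \<times> nat \<Rightarrow> real^'n^'n" where
  "dihedral_elem r t = (\<lambda>(i, j). mpow r i ** mpow t j)"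

text \<open>Stated for any \<open>t\<close> outside a cyclic subgroup of index 2, because
  \<open>order6_cases\<close> uses it before such elements are known to be involutions.\<close>

lemma coset_decomposition:
  assumes G: "mat_group \<Gamma>" and rt: "r \<in> \<Gamma>" "t \<in> \<Gamma>" "t \<notin> range (mpow r)" and card: "card \<Gamma> = 2 * mat_order r"
  shows "inj_on (dihedral_elem r t) ({..<mat_order r} \<times> {..<2})"
    "\<Gamma> = dihedral_elem r t ` ({..<mat_order r} \<times> {..<2})"
proof -
  let ?p = "mat_order r"
  have no: "mpow r i \<noteq> mpow r k ** t" if "k < ?p" for i k
  proof
    assume *: "mpow r i = mpow r k ** t"
    have "mpow r k ** mpow r (?p - k + i) = mpow r (?p + i)"
      using that by (simp flip: mpow_add)
    also have "\<dots> = mpow r k ** t" using * mat_order(2)[OF G rt(1)] by (simp add: mpow_add)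
    finally have "mpow r (?p - k + i) = t" using mat_group_cancel_left[OF G mpow_in[OF G rt(1)]] by blast
    then show False using rt(3) by blast
  qed
  show inj: "inj_on (dihedral_elem r t) ({..<?p} \<times> {..<2})"
  proof (rule inj_onI, clarify)
    fix i j k l assume ij: "i < ?p" "j < (2::nat)" "k < ?p" "l < (2::nat)"
      and eq: "dihedral_elem r t (i, j) = dihedral_elem r t (k, l)"
    from ij consider "j = 0" "l = 0" | "j = 0" "l = 1" | "j = 1" "l = 0" | "j = 1" "l = 1" by linarith
    then show "i = k \<and> j = l"
    proof cases
      case 1
      then show ?thesis using eq ij mat_order(3)[OF G rt(1)] by (simp add: dihedral_elem_def)
    next
      case 2
      then show ?thesis using eq ij no by (simp add: dihedral_elem_def)
    next
      case 3
      then show ?thesis using eq ij no by (simp add: dihedral_elem_def) metis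
    next
      case 4
      then have "mpow r i = mpow r k" using eq mat_group_cancel_right[OF G rt(2)] by (simp add: dihedral_elem_def)
      then show ?thesis using 4 ij mat_order(3)[OF G rt(1)] by simp
    qed
  qed
  have "dihedral_elem r t ` ({..<?p} \<times> {..<2}) \<subseteq> \<Gamma>"
    using rt mpow_in[OF G] mat_group_simps(5)[OF G] by (auto simp: dihedral_elem_def)
  then show "\<Gamma> = dihedral_elem r t ` ({..<?p} \<times> {..<2})"
    using card_image[OF inj] card mat_group_simps(1)[OF G]
    by (intro card_subset_eq[symmetric]) (auto simp: card_cartesian_product)
qed

text \<open>From t^2 = 1 and (r t)^2 = 1 one gets t r = r^(-1) t. With natural exponents r^(-1) is
  r^(p - 1), so the power of p - 1 plays the part of (-1)^j.\<close>

lemma dihedral_mult: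
  assumes G: "mat_group \<Gamma>" and D: "dihedral \<Gamma> r t"
  shows "dihedral_elem r t (i, j) ** dihedral_elem r t (k, l) =
    dihedral_elem r t (i + (mat_order r - 1) ^ j * k, j + l)"
proof -
  let ?p = "mat_order r"
  have rt: "r \<in> \<Gamma>" "t \<in> \<Gamma>" using D by (auto simp: dihedral_def)
  have t2: "t ** t = mat 1" and rt2: "r ** t ** (r ** t) = mat 1"
    using D mat_order(2)[OF G rt(2)] mat_order(2)[OF G mat_group_simps(5)[OF G rt]]
    by (auto simp: dihedral_def numeral_2_eq_2)
  have p: "?p > 0" "mpow r ?p = mat 1" using mat_order[OF G rt(1)] by auto
  have 1: "t ** r = mpow r (?p - 1) ** t"
  proof -
    have "r ** (t ** r) = r ** (mpow r (?p - 1) ** t)"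
    proof -
      have "r ** (t ** r) = r ** t ** r ** (t ** t)" by (simp add: t2 matrix_mul_assoc)
      also have "\<dots> = r ** t ** (r ** t) ** t" by (simp add: matrix_mul_assoc)
      also have "\<dots> = mpow r (Suc (?p - 1)) ** t" using rt2 p by simp
      finally show ?thesis by (simp add: matrix_mul_assoc)
    qed
    then show ?thesis using mat_group_cancel_left[OF G rt(1)] by blast
  qed
  have 2: "t ** mpow r k = mpow r ((?p - 1) * k) ** t" for k
  proof (induction k)
    case (Suc k)
    have "t ** mpow r (Suc k) = mpow r (?p - 1) ** (t ** mpow r k)"
      by (simp add: matrix_mul_assoc 1)
    then show ?case unfolding Suc by (simp add: mpow_add matrix_mul_assoc)
  qed simp
  have 3: "mpow t j ** mpow r k = mpow r ((?p - 1) ^ j * k) ** mpow t j" for j k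
  proof (induction j arbitrary: k)
    case (Suc j)
    have "mpow t (Suc j) ** mpow r k = t ** (mpow t j ** mpow r k)" by (simp add: matrix_mul_assoc)
    also have "\<dots> = t ** mpow r ((?p - 1) ^ j * k) ** mpow t j" unfolding Suc by (simp add: matrix_mul_assoc)
    finally show ?case unfolding 2 by (simp add: matrix_mul_assoc mult.assoc)
  qed simp
  have "mpow r i ** mpow t j ** (mpow r k ** mpow t l) = mpow r i ** (mpow t j ** mpow r k) ** mpow t l"
    by (simp add: matrix_mul_assoc)
  then show ?thesis unfolding dihedral_elem_def 3 by (simp add: mpow_add matrix_mul_assoc)
qed

lemma dihedral_elem_mod:
  assumes "mat_group \<Gamma>" "r \<in> \<Gamma>" "t \<in> \<Gamma>"
  shows "dihedral_elem r t (i, j) = dihedral_elem r t (i mod mat_order r, j mod mat_order t)"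
  using mpow_mod[OF mat_order(2)[OF assms(1,2)]] mpow_mod[OF mat_order(2)[OF assms(1,3)]]
  by (simp add: dihedral_elem_def)

lemma dihedral_range:
  assumes G: "mat_group \<Gamma>" and D: "dihedral \<Gamma> r t"
  shows "\<Gamma> = range (dihedral_elem r t)"
proof -
  have rt: "r \<in> \<Gamma>" "t \<in> \<Gamma>" using D by (auto simp: dihedral_def)
  have "dihedral_elem r t x \<in> \<Gamma>" for x
    using rt mpow_in[OF G] mat_group_simps(5)[OF G] by (cases x) (auto simp: dihedral_elem_def)
  moreover have "\<Gamma> \<subseteq> range (dihedral_elem r t)"
    using coset_decomposition(2)[OF G rt] D by (auto simp: dihedral_def)
  ultimately show ?thesis by blast
qed

lemma dihedral_character_isomorphic:
  fixes \<Gamma> \<Gamma>' :: "(real^'n^'n) set"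
  assumes G: "mat_group \<Gamma>" "mat_group \<Gamma>'" and D: "dihedral \<Gamma> r t" and D': "dihedral \<Gamma>' r' t'"
    and card: "card \<Gamma> = card \<Gamma>'"
    and tr: "\<And>i j. trace (dihedral_elem r t (i, j)) = trace (dihedral_elem r' t' (i, j))"
  shows "character_isomorphic \<Gamma> \<Gamma>'"
proof (rule character_isomorphic_param[where m = "\<lambda>(i, j) (k, l). (i + (mat_order r - 1) ^ j * k, j + l)"])
  show "\<Gamma> = range (dihedral_elem r t)" by (rule dihedral_range[OF G(1) D])
  show "\<Gamma>' = range (dihedral_elem r' t')" by (rule dihedral_range[OF G(2) D'])
  have rt: "r \<in> \<Gamma>" "t \<in> \<Gamma>" "t \<notin> range (mpow r)" "mat_order t = 2" and rt': "r' \<in> \<Gamma>'" "t' \<in> \<Gamma>'" "mat_order t' = 2"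
    using D D' by (auto simp: dihedral_def)
  have p: "mat_order r' = mat_order r" "card \<Gamma> = 2 * mat_order r" using D D' card by (auto simp: dihedral_def)
  show "dihedral_elem r' t' x = dihedral_elem r' t' y" if "dihedral_elem r t x = dihedral_elem r t y" for x y
  proof -
    obtain i j k l where xy: "x = (i, j)" "y = (k, l)" by fastforce
    let ?p = "mat_order r"
    have "dihedral_elem r t (i mod ?p, j mod 2) = dihedral_elem r t (k mod ?p, l mod 2)"
      using that dihedral_elem_mod[OF G(1) rt(1,2)] rt(4) xy by metis
    then have "i mod ?p = k mod ?p \<and> j mod 2 = l mod 2"
      using inj_onD[OF coset_decomposition(1)[OF G(1) rt(1-3) p(2)],
          of "(i mod ?p, j mod 2)" "(k mod ?p, l mod 2)"] mat_order(1)[OF G(1) rt(1)] by simp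
    then show ?thesis
      unfolding xy using dihedral_elem_mod[OF G(2) rt'(1,2), of i j] dihedral_elem_mod[OF G(2) rt'(1,2), of k l]
        p(1) rt'(3) by simp
  qed
  show "dihedral_elem r t x ** dihedral_elem r t y =
      dihedral_elem r t ((\<lambda>(i, j) (k, l). (i + (mat_order r - 1) ^ j * k, j + l)) x y)" for x y
    using dihedral_mult[OF G(1) D] by (cases x; cases y) simp
  show "dihedral_elem r' t' x ** dihedral_elem r' t' y =
      dihedral_elem r' t' ((\<lambda>(i, j) (k, l). (i + (mat_order r - 1) ^ j * k, j + l)) x y)" for x y
    using dihedral_mult[OF G(2) D'] p(1) by (cases x; cases y) simp
  show "trace (dihedral_elem r t x) = trace (dihedral_elem r' t' x)" for x
    using tr by (cases x) simp
qed

lemma sum_dihedral: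
  assumes G: "mat_group \<Gamma>" and D: "dihedral \<Gamma> r t"
  shows "(\<Sum>h\<in>\<Gamma>. f h) = (\<Sum>i<mat_order r. f (mpow r i)) + (\<Sum>i<mat_order r. f (mpow r i ** t))"
proof -
  have rt: "r \<in> \<Gamma>" "t \<in> \<Gamma>" "t \<notin> range (mpow r)" "card \<Gamma> = 2 * mat_order r"
    using D by (auto simp: dihedral_def)
  have "(\<Sum>h\<in>\<Gamma>. f h) = (\<Sum>x\<in>{..<mat_order r} \<times> {..<2}. f (dihedral_elem r t x))"
    by (subst coset_decomposition(2)[OF G rt]) (simp add: sum.reindex[OF coset_decomposition(1)[OF G rt]])
  also have "\<dots> = (\<Sum>i<mat_order r. \<Sum>j<2. f (dihedral_elem r t (i, j)))"
    by (simp add: sum.cartesian_product)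
  also have "\<dots> = (\<Sum>i<mat_order r. f (mpow r i) + f (mpow r i ** t))"
    by (simp add: dihedral_elem_def numeral_2_eq_2)
  finally show ?thesis by (simp add: sum.distrib)
qed

lemma mat_order_eq_1: "mat_group \<Gamma> \<Longrightarrow> g \<in> \<Gamma> \<Longrightarrow> mat_order g = 1 \<longleftrightarrow> g = mat 1"
  using mat_order(5)[of \<Gamma> g 1] by simp

lemma order4_cases:
  assumes G: "mat_group \<Gamma>" and card: "card \<Gamma> = 4"
  obtains g where "g \<in> \<Gamma>" "mat_order g = 4" | r t where "dihedral \<Gamma> r t" "mat_order r = 2"
proof (cases "\<exists>g\<in>\<Gamma>. mat_order g = 4")
  case False
  have o2: "mat_order g = 2" if "g \<in> \<Gamma>" "g \<noteq> mat 1" for g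
  proof -
    have "mat_order g dvd 2 ^ 2" using mat_order(4)[OF G that(1)] card by simp
    then obtain i where "i \<le> 2" "mat_order g = 2 ^ i" using divides_primepow_nat[of 2 "mat_order g" 2] by auto
    moreover have "mat_order g \<noteq> 4" "mat_order g \<noteq> 1" using False that mat_order_eq_1[OF G] by auto
    ultimately show ?thesis by (auto simp: le_Suc_eq numeral_2_eq_2)
  qed
  have "\<not> \<Gamma> \<subseteq> {mat 1}" using card card_mono[of "{mat 1 :: real^'a^'a}" \<Gamma>] by auto
  then obtain r where r: "r \<in> \<Gamma>" "r \<noteq> mat 1" by blast
  have "card {mat 1, r} \<le> 2" by (simp add: card_insert_if)
  then have "\<not> \<Gamma> \<subseteq> {mat 1, r}" using card card_mono[of "{mat 1, r}" \<Gamma>] by auto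
  then obtain t where t: "t \<in> \<Gamma>" "t \<noteq> mat 1" "t \<noteq> r" by blast
  have rr: "r ** r = mat 1" using mat_order(2)[OF G r(1)] o2[OF r] by (simp add: numeral_2_eq_2)
  have "mpow r k \<in> {mat 1, r}" for k
    by (induction k) (auto simp: rr)
  then have "t \<notin> range (mpow r)" using t by force
  moreover have "r ** t \<noteq> mat 1" using mat_group_cancel_left[OF G r(1), of t r] rr t(3) by metis
  ultimately have "dihedral \<Gamma> r t"
    using r t o2 mat_group_simps(5)[OF G] card by (simp add: dihedral_def)
  then show ?thesis using that(2) o2[OF r] by blast
qed (use that in blast)

section \<open>Groups of order at most seven, except six\<close>

text \<open>The sums are not divided by the group order, as the groups to be compared have the same
  order.\<close>

definition same_molien :: "(real^'n^'n) set \<Rightarrow> (real^'n^'n) set \<Rightarrow> bool" where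
  "same_molien \<Gamma> \<Gamma>' \<longleftrightarrow> (\<forall>k. (\<Sum>g\<in>\<Gamma>. newton (tr_pow g) k) = (\<Sum>g\<in>\<Gamma>'. newton (tr_pow g) k))"

lemma same_molien_power_sums:
  assumes "same_molien \<Gamma> \<Gamma>'"
  shows "(\<Sum>g\<in>\<Gamma>. tr_pow g 1) = (\<Sum>g\<in>\<Gamma>'. tr_pow g 1)"
    "(\<Sum>g\<in>\<Gamma>. (tr_pow g 1)\<^sup>2 + tr_pow g 2) = (\<Sum>g\<in>\<Gamma>'. (tr_pow g 1)\<^sup>2 + tr_pow g 2)"
    "(\<Sum>g\<in>\<Gamma>. (tr_pow g 1)^3 + 3 * tr_pow g 1 * tr_pow g 2 + 2 * tr_pow g 3) =
     (\<Sum>g\<in>\<Gamma>'. (tr_pow g 1)^3 + 3 * tr_pow g 1 * tr_pow g 2 + 2 * tr_pow g 3)"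
    "(\<Sum>g\<in>\<Gamma>. (tr_pow g 1)^4 + 6 * (tr_pow g 1)\<^sup>2 * tr_pow g 2 + 3 * (tr_pow g 2)\<^sup>2
        + 8 * tr_pow g 1 * tr_pow g 3 + 6 * tr_pow g 4) =
     (\<Sum>g\<in>\<Gamma>'. (tr_pow g 1)^4 + 6 * (tr_pow g 1)\<^sup>2 * tr_pow g 2 + 3 * (tr_pow g 2)\<^sup>2
        + 8 * tr_pow g 1 * tr_pow g 3 + 6 * tr_pow g 4)"
proof -
  have eq: "(\<Sum>g\<in>\<Gamma>. newton (tr_pow g) k) = (\<Sum>g\<in>\<Gamma>'. newton (tr_pow g) k)" for k
    using assms by (simp add: same_molien_def)
  show "(\<Sum>g\<in>\<Gamma>. tr_pow g 1) = (\<Sum>g\<in>\<Gamma>'. tr_pow g 1)"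
    using eq[of "Suc 0"] unfolding newton_1 .
  show "(\<Sum>g\<in>\<Gamma>. (tr_pow g 1)\<^sup>2 + tr_pow g 2) = (\<Sum>g\<in>\<Gamma>'. (tr_pow g 1)\<^sup>2 + tr_pow g 2)"
    using eq[of 2] unfolding newton_2 sum_divide_distrib[symmetric] by simp
  show "(\<Sum>g\<in>\<Gamma>. (tr_pow g 1)^3 + 3 * tr_pow g 1 * tr_pow g 2 + 2 * tr_pow g 3) =
     (\<Sum>g\<in>\<Gamma>'. (tr_pow g 1)^3 + 3 * tr_pow g 1 * tr_pow g 2 + 2 * tr_pow g 3)"
    using eq[of 3] unfolding newton_3 sum_divide_distrib[symmetric] by simp
  show "(\<Sum>g\<in>\<Gamma>. (tr_pow g 1)^4 + 6 * (tr_pow g 1)\<^sup>2 * tr_pow g 2 + 3 * (tr_pow g 2)\<^sup>2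
        + 8 * tr_pow g 1 * tr_pow g 3 + 6 * tr_pow g 4) =
     (\<Sum>g\<in>\<Gamma>'. (tr_pow g 1)^4 + 6 * (tr_pow g 1)\<^sup>2 * tr_pow g 2 + 3 * (tr_pow g 2)\<^sup>2
        + 8 * tr_pow g 1 * tr_pow g 3 + 6 * tr_pow g 4)"
    using eq[of 4] unfolding newton_4 sum_divide_distrib[symmetric] by simp
qed

text \<open>The sequence \<open>T\<close> is a separate argument so that passing to another
  generator merely reindexes it, as in \<open>cyclic_traces_power\<close>.\<close>

definition cyclic_traces :: "(real^'n^'n) set \<Rightarrow> real^'n^'n \<Rightarrow> nat \<Rightarrow> (nat \<Rightarrow> real) \<Rightarrow> bool" where
  "cyclic_traces \<Gamma> g N T \<longleftrightarrow> mat_group \<Gamma> \<and> g \<in> \<Gamma> \<and> mat_order g = N \<and> card \<Gamma> = N \<and> T = tr_pow g"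

lemma cyclic_traces_props:
  fixes \<Gamma> :: "(real^'n^'n) set"
  assumes "cyclic_traces \<Gamma> g N T"
  shows "T 0 = real CARD('n)" "T k = T (k mod N)" "i \<le> N \<Longrightarrow> T (N - i) = T i"
    "(\<Sum>h\<in>\<Gamma>. f (tr_pow h)) = (\<Sum>i<N. f (\<lambda>j. T (i * j)))"
    "0 < i \<Longrightarrow> i < N \<Longrightarrow> T i < real CARD('n)" "N > 0"
proof -
  have G: "mat_group \<Gamma>" "g \<in> \<Gamma>" "mat_order g = N" "card \<Gamma> = N" "mat_order g = card \<Gamma>" "T = tr_pow g"
    using assms by (auto simp: cyclic_traces_def)
  show "T 0 = real CARD('n)" by (simp add: G(6) trace_I)
  show "T k = T (k mod N)" using tr_pow_mod[OF G(1,2), of k] unfolding G(3,6) .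
  show "i \<le> N \<Longrightarrow> T (N - i) = T i" using tr_pow_reflect[OF G(1,2), of i] unfolding G(3,6) .
  show "(\<Sum>h\<in>\<Gamma>. f (tr_pow h)) = (\<Sum>i<N. f (\<lambda>j. T (i * j)))"
    unfolding sum_cyclic[OF G(1,2,5), of "\<lambda>h. f (tr_pow h)"] G(4,6) mpow_mult ..
  show "N > 0" using mat_order(1)[OF G(1,2)] G(3) by simp
  show "T i < real CARD('n)" if "0 < i" "i < N"
  proof -
    have "mpow g i \<noteq> mat 1" using mat_order(5)[OF G(1,2), of i] that G(3) by (auto dest: dvd_imp_le)
    then show ?thesis using trace_eq_card_iff[OF G(1) mpow_in[OF G(1,2)], of i] G(6) by simp
  qed
qed

lemma cyclic_traces_power:
  assumes "cyclic_traces \<Gamma> g N T" "coprime N m"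
  shows "cyclic_traces \<Gamma> (mpow g m) N (\<lambda>k. T (m * k))"
proof -
  have G: "mat_group \<Gamma>" "g \<in> \<Gamma>" "mat_order g = N" "card \<Gamma> = N" "T = tr_pow g"
    using assms by (auto simp: cyclic_traces_def)
  note gm = mpow_in[OF G(1,2), of m]
  have "mpow (mpow g m) k = mat 1 \<longleftrightarrow> N dvd k" for k
    unfolding mpow_mult[symmetric] mat_order(5)[OF G(1,2)] G(3)
    using assms(2) by (simp add: coprime_dvd_mult_right_iff)
  then have "mat_order (mpow g m) = N"
    using mat_order(5)[OF G(1) gm] by (metis dvd_antisym dvd_refl)
  then show ?thesis using G gm by (simp add: cyclic_traces_def mpow_mult)
qed

text \<open>Half a period is enough because T (N - i) = T i.\<close>

lemma cyclic_traces_isomorphic: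
  assumes "cyclic_traces \<Gamma> g N T" "cyclic_traces \<Gamma>' g' N T'"
    and "\<And>i. i \<le> N div 2 \<Longrightarrow> T i = T' i"
  shows "character_isomorphic \<Gamma> \<Gamma>'"
proof -
  have "T i = T' i" for i
  proof -
    have "T j = T' j" if "j < N" for j
    proof (cases "j \<le> N div 2")
      case False
      then have "T (N - (N - j)) = T' (N - (N - j))"
        using cyclic_traces_props(3)[OF assms(1), of "N - j"] cyclic_traces_props(3)[OF assms(2), of "N - j"]
          assms(3)[of "N - j"] by simp
      then show ?thesis using that by simp
    qed (rule assms(3))
    then show ?thesis
      using cyclic_traces_props(6)[OF assms(1)] cyclic_traces_props(2)[OF assms(1), of i] cyclic_traces_props(2)[OF assms(2), of i] by simp
  qed
  then show ?thesis
    using assms(1,2) by (intro cyclic_character_isomorphic[of \<Gamma> \<Gamma>' g g']) (auto simp: cyclic_traces_def)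
qed

lemma prime_order_cyclic:
  assumes "mat_group \<Gamma>" "prime (card \<Gamma>)"
  obtains g where "cyclic_traces \<Gamma> g (card \<Gamma>) (tr_pow g)"
proof -
  have "\<not> \<Gamma> \<subseteq> {mat 1}"
  proof
    assume "\<Gamma> \<subseteq> {mat 1}"
    from card_mono[OF _ this] have "card \<Gamma> \<le> 1" by simp
    then show False using prime_gt_1_nat[OF assms(2)] by simp
  qed
  then obtain g where g: "g \<in> \<Gamma>" "g \<noteq> mat 1" by blast
  have "mat_order g = card \<Gamma>"
  proof -
    have "mat_order g = 1 \<or> mat_order g = card \<Gamma>"
      using mat_order(4)[OF assms(1) g(1)] assms(2) by (simp add: prime_nat_iff)
    then show ?thesis using mat_order_eq_1[OF assms(1) g(1)] g(2) by simp
  qed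
  then show ?thesis using that g assms(1) by (simp add: cyclic_traces_def)
qed

lemma sum_lessThan_numerals:
  "(\<Sum>i<2. f i) = f 0 + f 1" "(\<Sum>i<3. f i) = f 0 + f 1 + f 2" "(\<Sum>i<4. f i) = f 0 + f 1 + f 2 + f 3"
  "(\<Sum>i<5. f i) = f 0 + f 1 + f 2 + f 3 + f 4" "(\<Sum>i<6. f i) = f 0 + f 1 + f 2 + f 3 + f 4 + f 5"
  "(\<Sum>i<7. f i) = f 0 + f 1 + f 2 + f 3 + f 4 + f 5 + f 6"
  for f :: "nat \<Rightarrow> 'a :: comm_monoid_add"
  by (simp_all add: eval_nat_numeral add.assoc)

section \<open>Orders two, three and five\<close>

lemma isomorphic_order_2_3:
  fixes \<Gamma> \<Gamma>' :: "(real^'n^'n) set"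
  assumes C: "cyclic_traces \<Gamma> g N T" "cyclic_traces \<Gamma>' g' N T'" and N: "N = 2 \<or> N = 3"
    and S: "same_molien \<Gamma> \<Gamma>'"
  shows "character_isomorphic \<Gamma> \<Gamma>'"
proof -
  note p = cyclic_traces_props[OF C(1)] and p' = cyclic_traces_props[OF C(2)]
  have "(\<Sum>i<N. T i) = (\<Sum>i<N. T' i)"
    using same_molien_power_sums(1)[OF S] p(4)[of "\<lambda>u. u 1"] p'(4)[of "\<lambda>u. u 1"] by simp
  then have "T 1 = T' 1"
    using N p(1) p'(1) p(3)[of 1] p'(3)[of 1] by (auto simp: sum_lessThan_numerals)
  moreover have "i = 0 \<or> i = 1" if "i \<le> N div 2" for i using N that by auto
  ultimately have "T i = T' i" if "i \<le> N div 2" for i using p(1) p'(1) that by metis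
  then show ?thesis by (rule cyclic_traces_isomorphic[OF C])
qed

text \<open>Degrees 1 and 2 determine the traces of g and g^2 up to exchange, and replacing the
  generator by its square exchanges them.\<close>

lemma isomorphic_order_5:
  fixes \<Gamma> \<Gamma>' :: "(real^'n^'n) set"
  assumes C: "cyclic_traces \<Gamma> g 5 T" "cyclic_traces \<Gamma>' g' 5 T'"
    and S: "same_molien \<Gamma> \<Gamma>'"
  shows "character_isomorphic \<Gamma> \<Gamma>'"
proof -
  note p = cyclic_traces_props[OF C(1)] and p' = cyclic_traces_props[OF C(2)]
  have v: "T 3 = T 2" "T 4 = T 1" "T 6 = T 1" "T 8 = T 2" using p(3)[of 2] p(3)[of 1] p(2)[of 6] p(2)[of 8] by simp_all
  have v': "T' 3 = T' 2" "T' 4 = T' 1" "T' 6 = T' 1" "T' 8 = T' 2"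
    using p'(3)[of 2] p'(3)[of 1] p'(2)[of 6] p'(2)[of 8] by simp_all
  have 1: "T 1 + T 2 = T' 1 + T' 2"
    using same_molien_power_sums(1)[OF S] p(4)[of "\<lambda>u. u 1"] p'(4)[of "\<lambda>u. u 1"]
    by (simp add: sum_lessThan_numerals p(1) p'(1) v v')
  have 2: "(T 1)\<^sup>2 + (T 2)\<^sup>2 = (T' 1)\<^sup>2 + (T' 2)\<^sup>2"
    using same_molien_power_sums(2)[OF S] p(4)[of "\<lambda>u. (u 1)\<^sup>2 + u 2"] p'(4)[of "\<lambda>u. (u 1)\<^sup>2 + u 2"] 1
    by (simp add: sum_lessThan_numerals p(1) p'(1) v v')
  have "(T' 1 - T 1) * (T' 1 - T 2) = 0" using 1 2 by algebra
  then consider "T' 1 = T 1" "T' 2 = T 2" | "T' 1 = T 2" "T' 2 = T 1" using 1 by auto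
  then show ?thesis
  proof cases
    case 1
    have "i \<le> 5 div 2 \<Longrightarrow> i = 0 \<or> i = 1 \<or> i = 2" for i :: nat by auto
    then show ?thesis using 1 p(1) p'(1) by (intro cyclic_traces_isomorphic[OF C]) metis
  next
    case 2
    have "cyclic_traces \<Gamma>' (mpow g' 2) 5 (\<lambda>k. T' (2 * k))"
      by (rule cyclic_traces_power[OF C(2)]) (simp add: coprime_iff_gcd_eq_1 gcd_red_nat[of 5 2])
    moreover have "T i = T' (2 * i)" if "i \<le> 5 div 2" for i
    proof -
      have "i = 0 \<or> i = 1 \<or> i = 2" using that by auto
      then show ?thesis using 2 v' p(1) p'(1) by auto
    qed
    ultimately show ?thesis by (rule cyclic_traces_isomorphic[OF C(1)])
  qed
qed

section \<open>Order seven\<close>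

lemma cyclic7_values:
  fixes \<Gamma> :: "(real^'n^'n) set"
  assumes C: "cyclic_traces \<Gamma> g 7 T" and abc: "T 1 = a" "T 2 = b" "T 4 = c" and n: "n = real CARD('n)"
  shows "(\<Sum>h\<in>\<Gamma>. tr_pow h 1) = n + 2*(a + b + c)"
    "(\<Sum>h\<in>\<Gamma>. (tr_pow h 1)\<^sup>2 + tr_pow h 2) = n\<^sup>2 + n + 2*(a\<^sup>2 + b\<^sup>2 + c\<^sup>2) + 2*(a + b + c)"
    "(\<Sum>h\<in>\<Gamma>. (tr_pow h 1)^3 + 3 * tr_pow h 1 * tr_pow h 2 + 2 * tr_pow h 3) =
      n^3 + 3*n\<^sup>2 + 2*n + 2*(a^3 + b^3 + c^3) + 6*(a*b + b*c + c*a) + 4*(a + b + c)"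
    "(\<Sum>h\<in>\<Gamma>. (tr_pow h 1)^4 + 6 * (tr_pow h 1)\<^sup>2 * tr_pow h 2 + 3 * (tr_pow h 2)\<^sup>2
        + 8 * tr_pow h 1 * tr_pow h 3 + 6 * tr_pow h 4) =
      n^4 + 6*n^3 + 11*n\<^sup>2 + 6*n + 2*(a^4 + b^4 + c^4) + 12*(a\<^sup>2*b + b\<^sup>2*c + c\<^sup>2*a)
      + 6*(a\<^sup>2 + b\<^sup>2 + c\<^sup>2) + 16*(a*b + b*c + c*a) + 12*(a + b + c)"
    "T 3 = c"
proof -
  note p = cyclic_traces_props(2)[OF C] and q = cyclic_traces_props(4)[OF C]
  have v: "T 0 = n" "T (Suc 0) = a" "T 2 = b" "T (Suc (Suc 0)) = b" "T 3 = c" "T 4 = c" "T 5 = b" "T 6 = a" "T 8 = a" "T 9 = b"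
    "T 10 = c" "T 12 = b" "T 15 = a" "T 16 = b" "T 18 = c" "T 20 = a" "T 24 = c"
    using n abc cyclic_traces_props(1)[OF C] cyclic_traces_props(3)[OF C, of 1] cyclic_traces_props(3)[OF C, of 2]
      cyclic_traces_props(3)[OF C, of 3] p[of 8] p[of 9] p[of 10] p[of 12] p[of 15] p[of 16] p[of 18]
      p[of 20] p[of 24] by (simp_all add: numeral_2_eq_2[symmetric])
  show "T 3 = c" by (rule v)
  show "(\<Sum>h\<in>\<Gamma>. tr_pow h 1) = n + 2*(a + b + c)"
    unfolding q[of "\<lambda>u. u 1"] sum_lessThan_numerals by (simp add: v)
  show "(\<Sum>h\<in>\<Gamma>. (tr_pow h 1)\<^sup>2 + tr_pow h 2) = n\<^sup>2 + n + 2*(a\<^sup>2 + b\<^sup>2 + c\<^sup>2) + 2*(a + b + c)"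
    unfolding q[of "\<lambda>u. (u 1)\<^sup>2 + u 2"] sum_lessThan_numerals by (simp add: v)
  show "(\<Sum>h\<in>\<Gamma>. (tr_pow h 1)^3 + 3 * tr_pow h 1 * tr_pow h 2 + 2 * tr_pow h 3) =
      n^3 + 3*n\<^sup>2 + 2*n + 2*(a^3 + b^3 + c^3) + 6*(a*b + b*c + c*a) + 4*(a + b + c)"
    unfolding q[of "\<lambda>u. (u 1)^3 + 3 * u 1 * u 2 + 2 * u 3"] sum_lessThan_numerals
    by (simp add: v) (simp add: algebra_simps power2_eq_square)
  show "(\<Sum>h\<in>\<Gamma>. (tr_pow h 1)^4 + 6 * (tr_pow h 1)\<^sup>2 * tr_pow h 2 + 3 * (tr_pow h 2)\<^sup>2
        + 8 * tr_pow h 1 * tr_pow h 3 + 6 * tr_pow h 4) =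
      n^4 + 6*n^3 + 11*n\<^sup>2 + 6*n + 2*(a^4 + b^4 + c^4) + 12*(a\<^sup>2*b + b\<^sup>2*c + c\<^sup>2*a)
      + 6*(a\<^sup>2 + b\<^sup>2 + c\<^sup>2) + 16*(a*b + b*c + c*a) + 12*(a + b + c)"
    unfolding q[of "\<lambda>u. (u 1)^4 + 6 * (u 1)\<^sup>2 * u 2 + 3 * (u 2)\<^sup>2 + 8 * u 1 * u 3 + 6 * u 4"] sum_lessThan_numerals
    by (simp add: v) (simp add: algebra_simps power2_eq_square power3_eq_cube)
qed

text \<open>Replacing the generator by its square rotates (a, b, c), since g^8 = g. So it suffices
  to know the triple up to rotation, which \<open>cyclic_triple_of_invariants\<close>
  provides.\<close>

lemma isomorphic_order_7:
  fixes \<Gamma> \<Gamma>' :: "(real^'n^'n) set"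
  assumes C: "cyclic_traces \<Gamma> g 7 T" "cyclic_traces \<Gamma>' g' 7 T'"
    and S: "same_molien \<Gamma> \<Gamma>'"
  shows "character_isomorphic \<Gamma> \<Gamma>'"
proof -
  define a b c a' b' c' n where abc: "a = T 1" "b = T 2" "c = T 4" "a' = T' 1" "b' = T' 2" "c' = T' 4"
    and n: "n = real CARD('n)"
  note v = cyclic7_values[OF C(1) abc(1-3)[symmetric] n] and v' = cyclic7_values[OF C(2) abc(4-6)[symmetric] n]
  have 1: "a + b + c = a' + b' + c'"
    using same_molien_power_sums(1)[OF S] unfolding v v' by algebra
  have 2: "(a)\<^sup>2 + (b)\<^sup>2 + (c)\<^sup>2 = (a')\<^sup>2 + (b')\<^sup>2 + (c')\<^sup>2"
    using same_molien_power_sums(2)[OF S] 1 unfolding v v' by algebra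
  have e2: "a * b + b * c + c * a = a' * b' + b' * c' + c' * a'"
    using arg_cong[OF 1, of "\<lambda>x. x\<^sup>2"] 2 by (simp add: power2_eq_square algebra_simps)
  have 3: "(a)^3 + (b)^3 + (c)^3 = (a')^3 + (b')^3 + (c')^3"
    using same_molien_power_sums(3)[OF S] 1 e2 unfolding v v' by algebra
  \<comment> \<open>The fourth power sum is already fixed by the unordered triple, so degree 4
    isolates the cyclic expression.\<close>
  have p4: "(a)^4 + (b)^4 + (c)^4 = (a')^4 + (b')^4 + (c')^4"
    using eq_set3_of_power_sums[OF 1 2 3] by auto
  have 4: "(a)\<^sup>2 * b + (b)\<^sup>2 * c + (c)\<^sup>2 * a = (a')\<^sup>2 * b' + (b')\<^sup>2 * c' + (c')\<^sup>2 * a'"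
    using same_molien_power_sums(4)[OF S] 1 e2 2 p4 unfolding v v' by algebra
  have iso: ?thesis if m: "coprime 7 m" "a = T' m" "b = T' (2 * m)" "c = T' (4 * m)" for m
  proof -
    have cm: "cyclic_traces \<Gamma>' (mpow g' m) 7 (\<lambda>k. T' (m * k))" by (rule cyclic_traces_power[OF C(2) m(1)])
    have "T i = T' (m * i)" if "i \<le> 7 div 2" for i
    proof -
      have "i = 0 \<or> i = 1 \<or> i = 2 \<or> i = 3" using that by auto
      then show ?thesis
        using m v(5) cyclic7_values(5)[OF cm refl refl refl refl]
          cyclic_traces_props(1)[OF C(1)] cyclic_traces_props(1)[OF cm] by (auto simp: mult.commute abc)
    qed
    then show ?thesis by (rule cyclic_traces_isomorphic[OF C(1) cm])
  qed
  have co: "coprime 7 (1::nat)" "coprime 7 (2::nat)" "coprime 7 (4::nat)"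
    by (simp_all add: coprime_iff_gcd_eq_1 gcd_red_nat[of 7 2] gcd_red_nat[of 7 4] gcd_red_nat[of 4 3])
  have "T' 8 = T' 1" "T' 16 = T' 2"
    using cyclic_traces_props(2)[OF C(2), of 8] cyclic_traces_props(2)[OF C(2), of 16] by simp_all
  with cyclic_triple_of_invariants[OF 1 2 3 4]
  show ?thesis using iso[OF co(1)] iso[OF co(2)] iso[OF co(3)] by (auto simp: abc)
qed

section \<open>Order four\<close>

lemma cyclic4_values:
  fixes \<Gamma> :: "(real^'n^'n) set"
  assumes "cyclic_traces \<Gamma> g 4 T"
  shows "(\<Sum>h\<in>\<Gamma>. tr_pow h 1) = real CARD('n) + 2 * T 1 + T 2"
    "(\<Sum>h\<in>\<Gamma>. (tr_pow h 1)\<^sup>2 + tr_pow h 2) = (real CARD('n))\<^sup>2 + 2 * real CARD('n) + 2 * (T 1)\<^sup>2 + (T 2)\<^sup>2 + 2 * T 2"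
    "(\<Sum>h\<in>\<Gamma>. (tr_pow h 1)^3 + 3 * tr_pow h 1 * tr_pow h 2 + 2 * tr_pow h 3) =
      (real CARD('n))^3 + 3 * (real CARD('n))\<^sup>2 + 2 * real CARD('n)
      + 2 * (T 1)^3 + (T 2)^3 + 6 * T 1 * T 2 + 3 * T 2 * real CARD('n) + 4 * T 1 + 2 * T 2"
    "T 2 < real CARD('n)"
proof -
  note q = cyclic_traces_props(4)[OF assms]
  have v: "T 0 = real CARD('n)" "T 3 = T 1" "T 4 = T 0" "T 6 = T 2" "T 9 = T 1"
    using cyclic_traces_props(1)[OF assms] cyclic_traces_props(3)[OF assms, of 1] cyclic_traces_props(2)[OF assms, of 4]
      cyclic_traces_props(2)[OF assms, of 6] cyclic_traces_props(2)[OF assms, of 9] by simp_all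
  show "(\<Sum>h\<in>\<Gamma>. tr_pow h 1) = real CARD('n) + 2 * T 1 + T 2"
    using q[of "\<lambda>u. u 1"] by (simp add: sum_lessThan_numerals v)
  show "(\<Sum>h\<in>\<Gamma>. (tr_pow h 1)\<^sup>2 + tr_pow h 2) = (real CARD('n))\<^sup>2 + 2 * real CARD('n) + 2 * (T 1)\<^sup>2 + (T 2)\<^sup>2 + 2 * T 2"
    using q[of "\<lambda>u. (u 1)\<^sup>2 + u 2"] by (simp add: sum_lessThan_numerals v)
  show "(\<Sum>h\<in>\<Gamma>. (tr_pow h 1)^3 + 3 * tr_pow h 1 * tr_pow h 2 + 2 * tr_pow h 3) =
      (real CARD('n))^3 + 3 * (real CARD('n))\<^sup>2 + 2 * real CARD('n)
      + 2 * (T 1)^3 + (T 2)^3 + 6 * T 1 * T 2 + 3 * T 2 * real CARD('n) + 4 * T 1 + 2 * T 2"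
    using q[of "\<lambda>u. (u 1)^3 + 3 * u 1 * u 2 + 2 * u 3"]
    by (simp add: sum_lessThan_numerals v) (simp add: power2_eq_square)
  show "T 2 < real CARD('n)" using cyclic_traces_props(5)[OF assms, of 2] by simp
qed

text \<open>Names all three involutions, so that \<open>klein_swap\<close> can permute their traces;
  \<open>dihedral\<close> would single out one of them.\<close>

definition klein :: "(real^'n^'n) set \<Rightarrow> real^'n^'n \<Rightarrow> real^'n^'n \<Rightarrow> real^'n^'n \<Rightarrow> bool" where
  "klein \<Gamma> a b c \<longleftrightarrow> a \<in> \<Gamma> \<and> b \<in> \<Gamma> \<and> a \<noteq> b \<and> mat_order a = 2 \<and> mat_order b = 2 \<and> mat_order c = 2 \<and>
    a ** b = c \<and> card \<Gamma> = 4"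

lemma mat_order_2D: "mat_group \<Gamma> \<Longrightarrow> g \<in> \<Gamma> \<Longrightarrow> mat_order g = 2 \<Longrightarrow> g ** g = mat 1"
  using mat_order(2)[of \<Gamma> g] by (simp add: numeral_2_eq_2)

lemma klein_swap:
  assumes G: "mat_group \<Gamma>" and K: "klein \<Gamma> a b c"
  shows "klein \<Gamma> b a c" "klein \<Gamma> a c b"
proof -
  have k: "a \<in> \<Gamma>" "b \<in> \<Gamma>" "c \<in> \<Gamma>" "a ** b = c" using K mat_group_simps(5)[OF G] by (auto simp: klein_def)
  have o: "a ** a = mat 1" "b ** b = mat 1" "c ** c = mat 1"
    using K k mat_order_2D[OF G] by (auto simp: klein_def)
  have ac: "a ** c = b" using k(4) o(1) by (metis matrix_mul_assoc matrix_mul_lid)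
  have "b ** a = c"
  proof -
    have "a ** (b ** a) = a ** c"
      using o k(4) ac by (metis matrix_mul_assoc matrix_mul_lid matrix_mul_rid)
    then show ?thesis using mat_group_cancel_left[OF G k(1)] by blast
  qed
  then show "klein \<Gamma> b a c" using K by (auto simp: klein_def)
  have "a \<noteq> c"
  proof
    assume "a = c"
    then have "a ** b = a ** mat 1" using k(4) by simp
    then have "b = mat 1" using mat_group_cancel_left[OF G k(1)] by blast
    then show False using K mat_order_eq_1[OF G k(2)] by (simp add: klein_def)
  qed
  then show "klein \<Gamma> a c b" using K k ac by (auto simp: klein_def)
qed

lemma klein_dihedral:
  assumes G: "mat_group \<Gamma>" and K: "klein \<Gamma> a b c"
  shows "dihedral \<Gamma> a b"
proof -
  have k: "a \<in> \<Gamma>" "b \<in> \<Gamma>" "a \<noteq> b" using K by (auto simp: klein_def)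
  have aa: "a ** a = mat 1" using mat_order_2D[OF G k(1)] K by (simp add: klein_def)
  have "mpow a i \<in> {mat 1, a}" for i by (induction i) (auto simp: aa)
  moreover have "b \<noteq> mat 1" using K mat_order_eq_1[OF G k(2)] by (auto simp: klein_def)
  ultimately have "b \<notin> range (mpow a)" using k(3) by force
  then show ?thesis using K by (auto simp: klein_def dihedral_def)
qed

lemma klein_character_isomorphic:
  fixes \<Gamma> \<Gamma>' :: "(real^'n^'n) set"
  assumes G: "mat_group \<Gamma>" "mat_group \<Gamma>'" and K: "klein \<Gamma> a b c" "klein \<Gamma>' a' b' c'"
    and tr: "trace a = trace a'" "trace b = trace b'" "trace c = trace c'"
  shows "character_isomorphic \<Gamma> \<Gamma>'"
proof (rule dihedral_character_isomorphic[OF G klein_dihedral[OF G(1) K(1)] klein_dihedral[OF G(2) K(2)]])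
  show "card \<Gamma> = card \<Gamma>'" using K by (simp add: klein_def)
  fix i j :: nat
  have o: "a \<in> \<Gamma>" "b \<in> \<Gamma>" "a' \<in> \<Gamma>'" "b' \<in> \<Gamma>'" "mat_order a = 2" "mat_order b = 2" "mat_order a' = 2" "mat_order b' = 2"
    "a ** b = c" "a' ** b' = c'" using K by (auto simp: klein_def)
  have "i mod 2 < 2" "j mod 2 < 2" by auto
  then have "trace (dihedral_elem a b (i mod 2, j mod 2)) = trace (dihedral_elem a' b' (i mod 2, j mod 2))"
    using tr o by (auto simp: less_2_cases_iff dihedral_elem_def)
  then show "trace (dihedral_elem a b (i, j)) = trace (dihedral_elem a' b' (i, j))"
    using dihedral_elem_mod[OF G(1) o(1,2)] dihedral_elem_mod[OF G(2) o(3,4)] o by metis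
qed

lemma tr_pow_involution:
  fixes h :: "real^'n^'n"
  assumes "h ** h = mat 1"
  shows "tr_pow h 2 = real CARD('n)" "tr_pow h 3 = trace h"
  using assms by (simp_all add: numeral_2_eq_2 numeral_3_eq_3 trace_I)

lemma tr_pow_mat_1: "tr_pow (mat 1 :: real^'n^'n) k = real CARD('n)"
  by (simp add: mpow_one trace_I)

lemma klein_values:
  fixes \<Gamma> :: "(real^'n^'n) set"
  assumes G: "mat_group \<Gamma>" and K: "klein \<Gamma> a b c"
  defines "x \<equiv> trace a" and "y \<equiv> trace b" and "z \<equiv> trace c" and "n \<equiv> real CARD('n)"
  shows "(\<Sum>h\<in>\<Gamma>. tr_pow h 1) = n + x + y + z"
    "(\<Sum>h\<in>\<Gamma>. (tr_pow h 1)\<^sup>2 + tr_pow h 2) = n\<^sup>2 + n + x\<^sup>2 + y\<^sup>2 + z\<^sup>2 + 3*n"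
    "(\<Sum>h\<in>\<Gamma>. (tr_pow h 1)^3 + 3 * tr_pow h 1 * tr_pow h 2 + 2 * tr_pow h 3) =
      n^3 + 3*n\<^sup>2 + 2*n + x^3 + y^3 + z^3 + 3*n*(x + y + z) + 2*(x + y + z)"
proof -
  have k: "a \<in> \<Gamma>" "b \<in> \<Gamma>" "c \<in> \<Gamma>" "a ** b = c" "mat_order a = 2"
    using K mat_group_simps(5)[OF G] by (auto simp: klein_def)
  have o: "a ** a = mat 1" "b ** b = mat 1" "c ** c = mat 1"
    using K k mat_order_2D[OF G] by (auto simp: klein_def)
  note s = sum_dihedral[OF G klein_dihedral[OF G K], unfolded k(5) sum_lessThan_numerals]
  note inv = tr_pow_involution[OF o(1)] tr_pow_involution[OF o(2)] tr_pow_involution[OF o(3)]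
  show "(\<Sum>h\<in>\<Gamma>. tr_pow h 1) = n + x + y + z"
    unfolding s by (simp add: k(4) x_def y_def z_def n_def trace_I)
  show "(\<Sum>h\<in>\<Gamma>. (tr_pow h 1)\<^sup>2 + tr_pow h 2) = n\<^sup>2 + n + x\<^sup>2 + y\<^sup>2 + z\<^sup>2 + 3*n"
    unfolding s by (simp add: k(4) x_def y_def z_def n_def trace_I inv tr_pow_mat_1)
  show "(\<Sum>h\<in>\<Gamma>. (tr_pow h 1)^3 + 3 * tr_pow h 1 * tr_pow h 2 + 2 * tr_pow h 3) =
      n^3 + 3*n\<^sup>2 + 2*n + x^3 + y^3 + z^3 + 3*n*(x + y + z) + 2*(x + y + z)"
    unfolding s by (simp add: k(4) x_def y_def z_def n_def trace_I inv tr_pow_mat_1 algebra_simps power2_eq_square)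
qed

lemma order4_klein_or_cyclic:
  assumes "mat_group \<Gamma>" "card \<Gamma> = 4"
  obtains g T where "cyclic_traces \<Gamma> g 4 T" | a b c where "klein \<Gamma> a b c"
  using assms
proof (cases rule: order4_cases)
  case (1 g)
  then show ?thesis using that(1) assms by (simp add: cyclic_traces_def)
next
  case (2 r t)
  then have "r \<noteq> t" unfolding dihedral_def using rangeI[of "mpow r" 1] by auto
  then have "klein \<Gamma> r t (r ** t)" using 2 assms(2) by (auto simp: klein_def dihedral_def)
  then show ?thesis by (rule that(2))
qed

text \<open>Degrees 1 to 3 determine the traces when both groups are of the same type, up to a
  permutation in the Klein case, and are contradictory when the types differ.\<close>

lemma isomorphic_order_4:
  fixes \<Gamma> \<Gamma>' :: "(real^'n^'n) set"
  assumes G: "mat_group \<Gamma>" "mat_group \<Gamma>'" and card: "card \<Gamma> = 4" "card \<Gamma>' = 4" and S: "same_molien \<Gamma> \<Gamma>'"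
  shows "character_isomorphic \<Gamma> \<Gamma>'"
proof -
  note S1 = same_molien_power_sums(1)[OF S] and S2 = same_molien_power_sums(2)[OF S]
    and S3 = same_molien_power_sums(3)[OF S]
  consider (cc) g T g' T' where "cyclic_traces \<Gamma> g 4 T" "cyclic_traces \<Gamma>' g' 4 T'"
    | (ck) g T a' b' c' where "cyclic_traces \<Gamma> g 4 T" "klein \<Gamma>' a' b' c'"
    | (kc) a b c g' T' where "klein \<Gamma> a b c" "cyclic_traces \<Gamma>' g' 4 T'"
    | (kk) a b c a' b' c' where "klein \<Gamma> a b c" "klein \<Gamma>' a' b' c'"
    using order4_klein_or_cyclic[OF G(1) card(1)] order4_klein_or_cyclic[OF G(2) card(2)] by metis
  then show ?thesis
  proof cases
    case cc
    note v = cyclic4_values[OF cc(1)] and v' = cyclic4_values[OF cc(2)]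
    note vv = v(1-3) v'(1-3)
    have "T 1 = T' 1 \<and> T 2 = T' 2"
      by (rule cyclic4_traces[where n = "real CARD('n)"])
        (use S1[unfolded vv] S2[unfolded vv] S3[unfolded vv] v(4) v'(4) in simp_all)
    moreover have "i \<le> 4 div 2 \<Longrightarrow> i = 0 \<or> i = 1 \<or> i = 2" for i :: nat by auto
    ultimately show ?thesis
      using cyclic_traces_props(1)[OF cc(1)] cyclic_traces_props(1)[OF cc(2)]
      by (intro cyclic_traces_isomorphic[OF cc]) metis
  next
    case ck
    note v = cyclic4_values[OF ck(1)] and v' = klein_values[OF G(2) ck(2)]
    note vv = v(1-3) v'
    have False
      by (rule klein4_neq_cyclic4[of "trace a'" "trace b'" "trace c'" "T 1" "T 2" "real CARD('n)"])
        (use S1[unfolded vv] S2[unfolded vv] S3[unfolded vv] v(4) in simp_all)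
    then show ?thesis ..
  next
    case kc
    note v = klein_values[OF G(1) kc(1)] and v' = cyclic4_values[OF kc(2)]
    note vv = v v'(1-3)
    have False
      by (rule klein4_neq_cyclic4[of "trace a" "trace b" "trace c" "T' 1" "T' 2" "real CARD('n)"])
        (use S1[unfolded vv] S2[unfolded vv] S3[unfolded vv] v'(4) in simp_all)
    then show ?thesis ..
  next
    case kk
    note v = klein_values[OF G(1) kk(1)] and v' = klein_values[OF G(2) kk(2)]
    have 1: "trace a + trace b + trace c = trace a' + trace b' + trace c'"
      using S1 unfolding v v' by simp
    have "(trace a)\<^sup>2 + (trace b)\<^sup>2 + (trace c)\<^sup>2 = (trace a')\<^sup>2 + (trace b')\<^sup>2 + (trace c')\<^sup>2"
      using S2 unfolding v v' by simp
    moreover have "(trace a)^3 + (trace b)^3 + (trace c)^3 = (trace a')^3 + (trace b')^3 + (trace c')^3"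
      using S3 unfolding v v' 1 by simp
    ultimately have set: "trace a' = trace a \<and> (trace b' = trace b \<and> trace c' = trace c \<or> trace b' = trace c \<and> trace c' = trace b)
      \<or> trace a' = trace b \<and> (trace b' = trace c \<and> trace c' = trace a \<or> trace b' = trace a \<and> trace c' = trace c)
      \<or> trace a' = trace c \<and> (trace b' = trace a \<and> trace c' = trace b \<or> trace b' = trace b \<and> trace c' = trace a)"
      by (rule eq_set3_of_power_sums[OF 1])
    \<comment> \<open>The traces match only up to a permutation, but every permutation of the three
      involutions is again a \<open>klein\<close> description of the same group.\<close>
    note sw = klein_swap[OF G(1)]
    have K: "klein \<Gamma> a b c" "klein \<Gamma> a c b" "klein \<Gamma> b c a" "klein \<Gamma> b a c" "klein \<Gamma> c a b" "klein \<Gamma> c b a"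
      using kk(1) sw by blast+
    show ?thesis using set K[THEN klein_character_isomorphic[OF G _ kk(2)]] by auto
  qed
qed

section \<open>Groups of order six\<close>

lemma mat_order_dvd_cases:
  assumes "mat_group \<Gamma>" "g \<in> \<Gamma>" "card \<Gamma> = 6"
  shows "mat_order g \<in> {1, 2, 3, 6}"
proof -
  have dvd: "mat_order g dvd 6" using mat_order(4)[OF assms(1,2)] assms(3) by simp
  then have "mat_order g \<le> 6" by (auto dest: dvd_imp_le)
  moreover have "mat_order g > 0" using mat_order(1)[OF assms(1,2)] .
  moreover have "mat_order g \<noteq> 4" "mat_order g \<noteq> 5" using dvd by auto
  ultimately show ?thesis by auto
qed

text \<open>Without elements of order 3 or 6 all squares are 1, the group is commutative, and two
  involutions span a subgroup whose order 4 does not divide 6. Given \<open>r\<close> of order 3, an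
  element \<open>u\<close> outside its powers has u^2 among them; order 3 would make u = u^4 =
  (u^2)^2 a power of \<open>r\<close>, so without elements of order 6 it has order 2.\<close>

lemma order6_cases:
  assumes G: "mat_group \<Gamma>" and card: "card \<Gamma> = 6"
  obtains g T where "cyclic_traces \<Gamma> g 6 T" | r t where "dihedral \<Gamma> r t" "mat_order r = 3"
proof (cases "\<exists>g\<in>\<Gamma>. mat_order g = 6")
  case True
  then show ?thesis using that(1) G card by (auto simp: cyclic_traces_def)
next
  case no6: False
  have ex: "\<exists>x\<in>\<Gamma>. x \<notin> A" if "finite A" "card A < 6" for A
    using card_mono[OF that(1), of \<Gamma>] that(2) card by auto
  have "\<exists>r\<in>\<Gamma>. mat_order r = 3"
  proof (rule ccontr)
    assume "\<not> ?thesis"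
    then have o2: "x ** x = mat 1" if "x \<in> \<Gamma>" for x
      using mat_order_dvd_cases[OF G that card] no6 that mat_order_2D[OF G that] mat_order_eq_1[OF G that] by auto
    have com: "x ** y = y ** x" if "x \<in> \<Gamma>" "y \<in> \<Gamma>" for x y
    proof -
      have "x ** (y ** (x ** y)) = x ** (y ** (y ** x))"
        using o2[OF that(1)] o2[OF that(2)] o2[OF mat_group_simps(5)[OF G that]]
        by (metis matrix_mul_assoc matrix_mul_rid)
      then show ?thesis using mat_group_cancel_left[OF G] that by blast
    qed
    obtain r where r: "r \<in> \<Gamma>" "r \<noteq> mat 1" using ex[of "{mat 1}"] by auto
    have "card {mat 1, r} < 6" by (simp add: card_insert_if)
    then obtain t where t: "t \<in> \<Gamma>" "t \<noteq> mat 1" "t \<noteq> r" using ex[of "{mat 1, r}"] by auto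
    have rr: "r ** r = mat 1" "t ** t = mat 1" "t ** r = r ** t" using o2 r t com by auto
    have rt: "r ** t \<noteq> mat 1" using mat_group_cancel_left[OF G r(1), of t r] rr(1) t(3) by metis
    have rt2: "r ** t \<noteq> r" using mat_group_cancel_left[OF G r(1), of t "mat 1"] t(2) by auto
    have rt3: "r ** t \<noteq> t" using mat_group_cancel_right[OF G t(1), of r "mat 1"] r(2) by auto
    have a: "r ** (r ** t) = t" "t ** (r ** t) = r" "r ** t ** r = t" "r ** t ** t = r" "r ** t ** (r ** t) = mat 1"
      using rr o2[OF mat_group_simps(5)[OF G r(1) t(1)]] by (metis matrix_mul_assoc matrix_mul_lid matrix_mul_rid)+
    have tr: "transpose x = x" if "x \<in> \<Gamma>" for x
      using mat_group_cancel_left[OF G that, of "transpose x" x] mat_group_simps(6)[OF G that] o2[OF that] by simp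
    have "card {mat 1, r, t, r ** t} dvd card \<Gamma>"
    proof (rule card_dvd[OF G])
      show "{mat 1, r, t, r ** t} \<subseteq> \<Gamma>" using r t mat_group_simps(2,5)[OF G] by auto
      then show "transpose x \<in> {mat 1, r, t, r ** t}" if "x \<in> {mat 1, r, t, r ** t}" for x
        using tr[of x] that by auto
      show "x ** y \<in> {mat 1, r, t, r ** t}" if "x \<in> {mat 1, r, t, r ** t}" "y \<in> {mat 1, r, t, r ** t}" for x y
        using that rr a by auto
    qed auto
    moreover have "card {mat 1, r, t, r ** t} = 4"
      using r(2) t(2,3) rt rt2 rt3 by (simp add: card_insert_if)
    ultimately show False using card by simp
  qed
  then obtain r where r: "r \<in> \<Gamma>" "mat_order r = 3" by blast
  have rng: "range (mpow r) = mpow r ` {..<3}"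
  proof
    show "range (mpow r) \<subseteq> mpow r ` {..<3}"
      using mpow_eq_iff[OF G r(1)] r(2) by (auto intro!: image_eqI[of _ _ "_ mod 3"])
  qed auto
  have "card (range (mpow r)) \<le> 3" unfolding rng using card_image_le[of "{..<3::nat}" "mpow r"] by simp
  then obtain t where t: "t \<in> \<Gamma>" "t \<notin> range (mpow r)"
    using ex[of "range (mpow r)"] rng by auto
  have card2: "card \<Gamma> = 2 * mat_order r" using card r(2) by simp
  have o2: "mat_order u = 2" if u: "u \<in> \<Gamma>" "u \<notin> range (mpow r)" for u
  proof -
    have "u ** u \<in> \<Gamma>" using mat_group_simps(5)[OF G u(1) u(1)] .
    then obtain i j where ij: "u ** u = mpow r i ** mpow u j" "j < 2"
      using coset_decomposition(2)[OF G r(1) u card2] by (force simp: dihedral_elem_def)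
    have "j = 0"
    proof (rule ccontr)
      assume "j \<noteq> 0"
      then have "u ** u = mpow r i ** u" using ij by (simp add: less_2_cases_iff)
      then have "u = mpow r i" using mat_group_cancel_right[OF G u(1)] by blast
      then show False using u(2) by blast
    qed
    then have uu: "u ** u = mpow r i" using ij by simp
    have "mat_order u \<noteq> 3"
    proof
      assume "mat_order u = 3"
      then have "mpow u 3 = mat 1" using mat_order(2)[OF G u(1)] by simp
      then have "u = mpow u 3 ** u" by simp
      also have "\<dots> = (u ** u) ** (u ** u)" by (simp add: numeral_3_eq_3 matrix_mul_assoc)
      also have "\<dots> = mpow r (i + i)" by (simp add: uu mpow_add)
      finally show False using u(2) by blast
    qed
    moreover have "mat_order u \<noteq> 1"
    proof
      assume "mat_order u = 1"
      then have "u = mpow r 0" using mat_order_eq_1[OF G u(1)] by simp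
      then show False using u(2) by blast
    qed
    ultimately show ?thesis using mat_order_dvd_cases[OF G u(1) card] no6 u(1) by auto
  qed
  have "r ** t \<notin> range (mpow r)"
  proof
    assume "r ** t \<in> range (mpow r)"
    then obtain i where "r ** t = mpow r i" by blast
    then have "mpow r 2 ** (r ** t) = mpow r (2 + i)" by (simp only: mpow_add)
    moreover have "mpow r 2 ** (r ** t) = mpow r 3 ** t" by (simp add: eval_nat_numeral matrix_mul_assoc)
    ultimately have "t = mpow r (2 + i)" using mat_order(2)[OF G r(1)] r(2) by simp
    then show False using t(2) by blast
  qed
  then have "dihedral \<Gamma> r t"
    using r t o2 card2 mat_group_simps(5)[OF G r(1) t(1)] by (simp add: dihedral_def)
  then show ?thesis using that(2) r(2) by blast
qed

lemma mpow_6: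
  assumes "mat_group \<Gamma>" "card \<Gamma> = 6" "g \<in> \<Gamma>"
  shows "mpow g 6 = mat 1"
  using mat_order(4,5)[OF assms(1,3)] assms(2) by simp

lemma root6_eq: "root6 i / root6 2 = inverse (y6 ^ i) * y6\<^sup>2"
  using inverse_root6[of i] inverse_root6[of 2] by (metis divide_inverse inverse_inverse_eq)

lemma root6_ratio:
  "root6 0 / root6 2 = y6 - 1" "root6 1 / root6 2 = y6" "root6 3 / root6 2 = 1 - y6"
  "root6 4 / root6 2 = - y6" "root6 5 / root6 2 = - 1"
proof -
  have ne: "y6 ^ k \<noteq> 0" for k using y6(2) by simp
  have p: "y6 ^ 4 = - y6" "y6 ^ 5 = 1 - y6"
  proof -
    have "y6 ^ 4 = y6 ^ 3 * y6" "y6 ^ 5 = y6 ^ 3 * y6\<^sup>2" by (simp_all flip: power_add power_Suc2)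
    then show "y6 ^ 4 = - y6" "y6 ^ 5 = 1 - y6" using y6 by simp_all
  qed
  have eq: "root6 i / root6 2 = x" if "x * y6 ^ i = y6\<^sup>2" for i x
    unfolding root6_eq that[symmetric] using ne[of i] by simp
  have ss: "y6 * y6 = y6 - 1" using y6(1) by (simp add: power2_eq_square)
  show "root6 0 / root6 2 = y6 - 1" by (rule eq) (simp add: y6)
  show "root6 1 / root6 2 = y6" by (rule eq) (simp add: y6 ss)
  show "root6 3 / root6 2 = 1 - y6" by (rule eq) (simp add: y6)
  show "root6 4 / root6 2 = - y6" by (rule eq) (simp add: p y6 ss)
  show "root6 5 / root6 2 = - 1" by (rule eq) (simp add: p y6)
qed

lemma pole_coeff_6:
  "pole_coeff root6 {..<6} 2 n m =
    (2 - y6) ^ (n - m 0) * (1 - y6) ^ (n - m 1) * y6 ^ (n - m 3) * (1 + y6) ^ (n - m 4) * 2 ^ (n - m 5)"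
proof -
  have "{..<6} - {2} = {0, 1, 3, 4, 5::nat}" by auto
  then show ?thesis by (simp add: pole_coeff_def root6_ratio[unfolded One_nat_def] mult.assoc)
qed

lemma norm_y6: "norm y6 = 1" "norm (2 - y6) = sqrt 3"
  by (simp_all add: y6_def cmod_def power_divide)

lemma y6_factors_neq_0: "2 - y6 \<noteq> 0" "1 - y6 \<noteq> 0" "1 + y6 \<noteq> 0"
  by (simp_all add: y6_def complex_eq_iff)

lemma pole_coeff_6_neq_0: "pole_coeff root6 {..<6} 2 n m \<noteq> 0"
  unfolding pole_coeff_6 using y6(2) y6_factors_neq_0 by simp

lemma pole_coeff_6_cong:
  assumes "\<And>k. k < 6 \<Longrightarrow> m k = m' k"
  shows "pole_coeff root6 {..<6} 2 n m = pole_coeff root6 {..<6} 2 n m'"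
  unfolding pole_coeff_6 using assms by simp

text \<open>The only case in which contributions of elements of different order to the pole meet;
  they do not cancel because \<open>|y6| = 1\<close> but \<open>|2 - y6| = sqrt 3\<close>.\<close>

lemma pole_coeff_6_sum_neq_0:
  assumes "m 0 + q \<le> n" "m 3 = q" "q > 0" "m' 0 = m 0 + q" "m' 3 = 0" "m 1 = 0" "m' 1 = 0"
    "m 4 = m' 4" "m 5 = 0" "m' 5 = 0"
  shows "pole_coeff root6 {..<6} 2 n m + pole_coeff root6 {..<6} 2 n m' \<noteq> 0"
proof
  assume "pole_coeff root6 {..<6} 2 n m + pole_coeff root6 {..<6} 2 n m' = 0"
  then have eq: "pole_coeff root6 {..<6} 2 n m = - pole_coeff root6 {..<6} 2 n m'"
    by (simp add: eq_neg_iff_add_eq_0)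
  define D where "D = (1 - y6) ^ n * (1 + y6) ^ (n - m 4) * 2 ^ n"
  have D: "D \<noteq> 0" using y6_factors_neq_0 by (simp add: D_def)
  have "(2 - y6) ^ (n - m 0) * y6 ^ (n - q) * D = - ((2 - y6) ^ (n - (m 0 + q)) * y6 ^ n * D)"
    using eq assms unfolding pole_coeff_6 D_def by (simp add: mult_ac)
  then have "(2 - y6) ^ (n - m 0) * y6 ^ (n - q) = - ((2 - y6) ^ (n - (m 0 + q)) * y6 ^ n)"
    using D by (metis mult_cancel_right mult_minus_left)
  then have "norm ((2 - y6) ^ (n - m 0) * y6 ^ (n - q)) = norm ((2 - y6) ^ (n - (m 0 + q)) * y6 ^ n)"
    by (metis norm_minus_cancel)
  then have "sqrt 3 ^ (n - m 0) = sqrt 3 ^ (n - (m 0 + q))"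
    by (simp add: norm_mult norm_power norm_y6)
  then have "n - m 0 = n - (m 0 + q)" by (subst (asm) power_inject_exp) auto
  then show False using assms(1,3) by simp
qed

lemma unity_mult6_eqI:
  fixes g h :: "real^'n^'n"
  assumes g: "orthogonal_matrix g" "mpow g 6 = mat 1" and h: "orthogonal_matrix h" "mpow h 6 = mat 1"
    and "\<And>i. i \<le> 3 \<Longrightarrow> tr_pow g i = tr_pow h i" and "k < 6"
  shows "unity_mult 6 g k = unity_mult 6 h k"
proof -
  have t: "tr_pow g 0 = tr_pow h 0" "tr_pow g 1 = tr_pow h 1" "tr_pow g 2 = tr_pow h 2" "tr_pow g 3 = tr_pow h 3"
    using assms(5)[of 0] assms(5)[of 1] assms(5)[of 2] assms(5)[of 3] by simp_all
  have "6 * real (unity_mult 6 g k) = 6 * real (unity_mult 6 h k)"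
  proof -
    have "k = 0 \<or> k = 1 \<or> k = 2 \<or> k = 3 \<or> k = 4 \<or> k = 5" using assms(6) by auto
    then show ?thesis by (elim disjE) (simp_all only: unity_mult6[OF g] unity_mult6[OF h] t)
  qed
  then show ?thesis by simp
qed

lemma cyclic6_values:
  fixes \<Gamma> :: "(real^'n^'n) set"
  assumes C: "cyclic_traces \<Gamma> g 6 T" and n: "n = real CARD('n)" and t: "T 1 = t1" "T 2 = t2" "T 3 = t3"
  shows "(\<Sum>h\<in>\<Gamma>. tr_pow h 1) = n + 2*t1 + 2*t2 + t3"
    "(\<Sum>h\<in>\<Gamma>. (tr_pow h 1)\<^sup>2 + tr_pow h 2) = n\<^sup>2 + n + (2*t1\<^sup>2 + 2*t2\<^sup>2 + t3\<^sup>2 + 4*t2 + n)"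
    "(\<Sum>h\<in>\<Gamma>. (tr_pow h 1)^3 + 3 * tr_pow h 1 * tr_pow h 2 + 2 * tr_pow h 3) = n^3 + 3*n\<^sup>2 + 2*n
      + (2*t1^3 + 2*t2^3 + t3^3 + 6*t1*t2 + 6*t2\<^sup>2 + 3*n*t3 + 6*t3 + 4*n)"
proof -
  note p = cyclic_traces_props(2)[OF C] and q = cyclic_traces_props(4)[OF C]
  have v: "T 0 = n" "T (Suc 0) = t1" "T 2 = t2" "T (Suc (Suc 0)) = t2" "T 3 = t3" "T 4 = t2" "T 5 = t1"
    "T 6 = n" "T 8 = t2" "T 9 = t3" "T 10 = t2" "T 12 = n" "T 15 = t3"
    using n t cyclic_traces_props(1)[OF C] cyclic_traces_props(3)[OF C, of 1] cyclic_traces_props(3)[OF C, of 2]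
      p[of 6] p[of 8] p[of 9] p[of 10] p[of 12] p[of 15] by (simp_all add: numeral_2_eq_2[symmetric])
  show "(\<Sum>h\<in>\<Gamma>. tr_pow h 1) = n + 2*t1 + 2*t2 + t3"
    unfolding q[of "\<lambda>u. u 1"] sum_lessThan_numerals by (simp add: v)
  show "(\<Sum>h\<in>\<Gamma>. (tr_pow h 1)\<^sup>2 + tr_pow h 2) = n\<^sup>2 + n + (2*t1\<^sup>2 + 2*t2\<^sup>2 + t3\<^sup>2 + 4*t2 + n)"
    unfolding q[of "\<lambda>u. (u 1)\<^sup>2 + u 2"] sum_lessThan_numerals by (simp add: v)
  show "(\<Sum>h\<in>\<Gamma>. (tr_pow h 1)^3 + 3 * tr_pow h 1 * tr_pow h 2 + 2 * tr_pow h 3) = n^3 + 3*n\<^sup>2 + 2*n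
      + (2*t1^3 + 2*t2^3 + t3^3 + 6*t1*t2 + 6*t2\<^sup>2 + 3*n*t3 + 6*t3 + 4*n)"
    unfolding q[of "\<lambda>u. (u 1)^3 + 3 * u 1 * u 2 + 2 * u 3"] sum_lessThan_numerals
    by (simp add: v) (simp add: algebra_simps power2_eq_square)
qed

text \<open>The numbers m0, a, b, m are the multiplicities of \<open>root6\<close> 0, 1, 2, 3 for
  \<open>g\<close>. The cube root \<open>root6 2\<close> has multiplicity a + b in g^2 and g^4, b in
  g and g^5, and 0 in 1 and g^3. So a + b is the largest; it is positive since g^2 is not 1. For a =
  0 all four elements contribute, and \<open>pole_coeff_6_sum_neq_0\<close> applies with q = m,
  positive since g^3 is not 1.\<close>

lemma cyclic6_pole:
  fixes \<Gamma> :: "(real^'n^'n) set"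
  assumes C: "cyclic_traces \<Gamma> g 6 T"
  obtains a b m m0 :: nat where
    "CARD('n) = m0 + m + 2*a + 2*b" "T 1 = real m0 - m + a - b" "T 2 = real m0 + m - a - b"
    "T 3 = real m0 - m - 2 * real a + 2 * real b" "a + b > 0" "has_pole \<Gamma> (a + b)"
proof -
  have G: "mat_group \<Gamma>" "g \<in> \<Gamma>" "card \<Gamma> = 6" "mat_order g = card \<Gamma>" "T = tr_pow g"
    using C by (auto simp: cyclic_traces_def)
  note p = cyclic_traces_props[OF C]
  have el: "orthogonal_matrix (mpow g i)" "mpow (mpow g i) 6 = mat 1" for i
    using mpow_in[OF G(1,2), of i] mat_group_simps(3)[OF G(1)] mpow_6[OF G(1,3)] by auto
  have tr: "tr_pow (mpow g i) j = T (i * j)" for i j by (simp add: G(5) mpow_mult)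
  define V where "V i = unity_mult 6 (mpow g i)" for i
  note u = unity_mult6[OF el, folded V_def, unfolded tr]
  have T: "T 0 = real CARD('n)" "T 4 = T 2" "T 6 = T 0" "T 9 = T 3" "T 12 = T 0"
    using p(1) p(3)[of 2] p(2)[of 6] p(2)[of 9] p(2)[of 12] by simp_all
  define m0 a b m where "m0 = V 1 0" and "a = V 1 1" and "b = V 1 2" and "m = V 1 3"
  have V1: "6 * real m0 = T 0 + 2 * T 1 + 2 * T 2 + T 3" "6 * real a = T 0 + T 1 - T 2 - T 3"
    "6 * real b = T 0 - T 1 - T 2 + T 3" "6 * real m = T 0 - 2 * T 1 + 2 * T 2 - T 3"
    using u(1-4)[of 1] by (simp_all add: m0_def a_def b_def m_def)
  have T0: "T 0 = real m0 + m + 2*a + 2*b" using V1 by simp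
  have T1: "T 1 = real m0 - m + a - b" using V1 by simp
  have T2: "T 2 = real m0 + m - a - b" using V1 by simp
  have T3: "T 3 = real m0 - m - 2 * real a + 2 * real b" using V1 by simp
  have "real CARD('n) = real (m0 + m + 2*a + 2*b)" using T0 T(1) by simp
  then have card: "CARD('n) = m0 + m + 2*a + 2*b" by (simp only: of_nat_eq_iff)
  have V1': "V 1 4 = b" "V 1 5 = a" using u(3,5)[of 1] u(2,6)[of 1] by (simp_all add: a_def b_def)
  have V2: "V 2 0 = m0 + m" "V 2 1 = 0" "V 2 2 = a + b" "V 2 3 = 0" "V 2 4 = a + b" "V 2 5 = 0"
  proof -
    have "6 * real (V 2 0) = 6 * real (m0 + m)" "6 * real (V 2 2) = 6 * real (a + b)" "6 * real (V 2 4) = 6 * real (a + b)"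
      "6 * real (V 2 1) = 6 * real 0" "6 * real (V 2 3) = 6 * real 0" "6 * real (V 2 5) = 6 * real 0"
      using u[of 2] by (simp_all add: T(2,3) T0 T2)
    then show "V 2 0 = m0 + m" "V 2 1 = 0" "V 2 2 = a + b" "V 2 3 = 0" "V 2 4 = a + b" "V 2 5 = 0"
      by (simp_all only: mult_cancel_left of_nat_eq_iff) simp_all
  qed
  have V03: "V 0 2 = 0" "V 3 2 = 0"
    using u(3)[of 0] u(3)[of 3] by (simp_all add: T(3,4))
  have V5: "V 5 k = V 1 k" if "k < 6" for k
    unfolding V_def
  proof (rule unity_mult6_eqI[OF el el _ that], unfold tr)
    fix i :: nat assume "i \<le> 3"
    then have "i \<le> 6" by simp
    have "i = 0 \<or> i = 1 \<or> i = 2 \<or> i = 3" using \<open>i \<le> 3\<close> by auto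
    then have "(5 * i) mod 6 = (6 - i) mod 6" by auto
    then have "T (5 * i) = T (6 - i)" using p(2)[of "5 * i"] p(2)[of "6 - i"] by simp
    then show "T (5 * i) = T (1 * i)" using p(3)[OF \<open>i \<le> 6\<close>] by simp
  qed
  have V4: "V 4 k = V 2 k" if "k < 6" for k
    unfolding V_def
  proof (rule unity_mult6_eqI[OF el el _ that], unfold tr)
    fix i :: nat assume "i \<le> 3"
    then have "i = 0 \<or> i = 1 \<or> i = 2 \<or> i = 3" by auto
    then have "(4 * i) mod 6 = (6 - 2 * i) mod 6" by auto
    then have "T (4 * i) = T (6 - 2 * i)" using p(2)[of "4 * i"] p(2)[of "6 - 2 * i"] by simp
    then show "T (4 * i) = T (2 * i)" using p(3)[of "2 * i"] \<open>i \<le> 3\<close> by simp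
  qed
  have pos: "a + b > 0"
  proof (rule ccontr)
    assume "\<not> a + b > 0"
    then have "T 2 = T 0" using T0 T2 by simp
    then show False using p(5)[of 2] T(1) by simp
  qed
  let ?pc = "pole_coeff root6 {..<6} 2 CARD('n)"
  define F where "F h = (if unity_mult 6 h 2 = a + b then ?pc (unity_mult 6 h) else 0)" for h :: "real^'n^'n"
  have F: "F (mpow g 0) = 0" "F (mpow g 3) = 0" "F (mpow g 2) = ?pc (V 2)" "F (mpow g 4) = ?pc (V 2)"
    "F (mpow g 1) = (if a = 0 then ?pc (V 1) else 0)" "F (mpow g 5) = (if a = 0 then ?pc (V 1) else 0)"
    using V03 V2 V4[of 2] V5[of 2] pos b_def pole_coeff_6_cong[OF V4] pole_coeff_6_cong[OF V5]
    by (simp_all only: F_def V_def[symmetric]) auto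
  have "(\<Sum>h\<in>\<Gamma>. F h) = 2 * (if a = 0 then ?pc (V 1) + ?pc (V 2) else ?pc (V 2))"
    unfolding sum_cyclic[OF G(1,2,4)] G(3) sum_lessThan_numerals F by simp
  moreover have "?pc (V 1) + ?pc (V 2) \<noteq> 0" if "a = 0"
  proof (rule pole_coeff_6_sum_neq_0[where q = m])
    show "m > 0"
    proof (rule ccontr)
      assume "\<not> m > 0"
      then have "T 3 = T 0" using T0 T3 that by simp
      then show False using p(5)[of 3] T(1) by simp
    qed
  qed (use that V1' V2 card in \<open>auto simp: m0_def a_def b_def m_def\<close>)
  ultimately have "(\<Sum>h\<in>\<Gamma>. F h) \<noteq> 0" using pole_coeff_6_neq_0 by auto
  moreover have "unity_mult 6 h 2 \<le> a + b" if "h \<in> \<Gamma>" for h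
  proof -
    have "h \<in> mpow g ` {..<6}" using that cyclic_eq(1)[OF G(1,2,4)] G(3) by simp
    then obtain i where i: "i < 6" "h = mpow g i" by blast
    then have "i = 0 \<or> i = 1 \<or> i = 2 \<or> i = 3 \<or> i = 4 \<or> i = 5" by auto
    then have "V i 2 \<le> a + b" using V03 V2 V4[of 2] V5[of 2] b_def by auto
    then show ?thesis by (simp add: i(2) V_def)
  qed
  ultimately have "has_pole \<Gamma> (a + b)" using card by (simp add: has_pole_def F_def)
  then show ?thesis using that[OF card T1 T2 T3 pos] by blast
qed

lemma dihedral6_facts:
  fixes \<Gamma> :: "(real^'n^'n) set"
  assumes G: "mat_group \<Gamma>" and D: "dihedral \<Gamma> r t" and r3: "mat_order r = 3"
  shows "(mpow r i ** t) ** (mpow r i ** t) = mat 1" "trace (mpow r i ** t) = trace t"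
    "tr_pow r 2 = trace r" "card \<Gamma> = 6" "r \<in> \<Gamma>" "t \<in> \<Gamma>" "mpow r i ** t \<in> \<Gamma>"
proof -
  show rt: "r \<in> \<Gamma>" "t \<in> \<Gamma>" and "card \<Gamma> = 6" using D r3 by (auto simp: dihedral_def)
  show "mpow r i ** t \<in> \<Gamma>" using rt mpow_in[OF G] mat_group_simps(5)[OF G] by blast
  note mult = dihedral_mult[OF G D, unfolded r3]
  have t2: "mpow t 2 = mat 1" using D mat_order(2)[OF G rt(2)] by (simp add: dihedral_def)
  have eq: "3 * i = i + (i + i)" by simp
  have "(mpow r i ** t) ** (mpow r i ** t) = mpow r (3 * i) ** mpow t 2"
    using mult[of i 1 i 1] unfolding eq by (simp add: dihedral_elem_def numeral_2_eq_2)
  then show "(mpow r i ** t) ** (mpow r i ** t) = mat 1"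
    using mat_order(2)[OF G rt(1)] r3 t2 by (simp add: mpow_mult mpow_one)
  \<comment> \<open>As 4 i and i agree mod 3, the exponent can be halved; cyclicity moves one half
    to the right of \<open>t\<close>, where r^(2i) t r^(2i) = t. So all the elements r^i t have the
    same trace.\<close>
  have "mpow r i ** t = mpow r (4 * i) ** t"
  proof -
    have "i mod 3 = (4 * i) mod 3" by presburger
    then show ?thesis using mpow_eq_iff[OF G rt(1), of i "4 * i"] r3 by simp
  qed
  also have "\<dots> = mpow r (2 * i) ** (mpow r (2 * i) ** t)" by (simp add: matrix_mul_assoc flip: mpow_add)
  finally have "trace (mpow r i ** t) = trace (mpow r (2 * i) ** t ** mpow r (2 * i))"
    using trace_mul_sym[of "mpow r (2 * i)" "mpow r (2 * i) ** t"] by simp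
  also have "mpow r (2 * i) ** t ** mpow r (2 * i) = mpow r (6 * i) ** t"
    using mult[of "2 * i" 1 "2 * i" 0] by (simp add: dihedral_elem_def)
  also have "mpow r (6 * i) = mat 1"
    using mat_order(5)[OF G rt(1), of "6 * i"] r3 by simp
  finally show "trace (mpow r i ** t) = trace t" by simp
  show "tr_pow r 2 = trace r" using tr_pow_reflect[OF G rt(1), of 1] r3 by simp
qed

lemma dihedral6_values:
  fixes \<Gamma> :: "(real^'n^'n) set"
  assumes G: "mat_group \<Gamma>" and D: "dihedral \<Gamma> r t" and r3: "mat_order r = 3"
    and n: "n = real CARD('n)" and \<rho>: "\<rho> = trace r" and \<tau>: "\<tau> = trace t"
  shows "(\<Sum>h\<in>\<Gamma>. tr_pow h 1) = n + 2*\<rho> + 3*\<tau>"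
    "(\<Sum>h\<in>\<Gamma>. (tr_pow h 1)\<^sup>2 + tr_pow h 2) = n\<^sup>2 + n + (3*\<tau>\<^sup>2 + 2*\<rho>\<^sup>2 + 3*n + 2*\<rho>)"
    "(\<Sum>h\<in>\<Gamma>. (tr_pow h 1)^3 + 3 * tr_pow h 1 * tr_pow h 2 + 2 * tr_pow h 3) = n^3 + 3*n\<^sup>2 + 2*n
      + (3*\<tau>^3 + 2*\<rho>^3 + 9*\<tau>*n + 6*\<rho>\<^sup>2 + 6*\<tau> + 4*n)"
proof -
  note f = dihedral6_facts[OF G D r3]
  have rr: "tr_pow (mpow r i) j = tr_pow r (i * j)" for i j by (simp add: mpow_mult)
  have R: "tr_pow r 0 = n" "tr_pow r (Suc 0) = \<rho>" "tr_pow r 2 = \<rho>" "tr_pow r (Suc (Suc 0)) = \<rho>" "tr_pow r 3 = n" "tr_pow r 4 = \<rho>" "tr_pow r 6 = n"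
    using tr_pow_mod[OF G f(5), of 3] tr_pow_mod[OF G f(5), of 4] tr_pow_mod[OF G f(5), of 6] f(3)
    by (simp_all add: r3 trace_I n \<rho> numeral_2_eq_2)
  have Q: "tr_pow (mpow r i ** t) (Suc 0) = \<tau>" "tr_pow (mpow r i ** t) 2 = n" "tr_pow (mpow r i ** t) 3 = \<tau>" for i
    using tr_pow_involution[OF f(1)] f(2) n \<tau> by simp_all
  note s = sum_dihedral[OF G D, unfolded r3 sum_lessThan_numerals One_nat_def]
  show "(\<Sum>h\<in>\<Gamma>. tr_pow h 1) = n + 2*\<rho> + 3*\<tau>"
    unfolding One_nat_def s rr Q by (simp add: R del: mpow.simps)
  show "(\<Sum>h\<in>\<Gamma>. (tr_pow h 1)\<^sup>2 + tr_pow h 2) = n\<^sup>2 + n + (3*\<tau>\<^sup>2 + 2*\<rho>\<^sup>2 + 3*n + 2*\<rho>)"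
    unfolding One_nat_def s rr Q by (simp add: R del: mpow.simps)
  show "(\<Sum>h\<in>\<Gamma>. (tr_pow h 1)^3 + 3 * tr_pow h 1 * tr_pow h 2 + 2 * tr_pow h 3) = n^3 + 3*n\<^sup>2 + 2*n
      + (3*\<tau>^3 + 2*\<rho>^3 + 9*\<tau>*n + 6*\<rho>\<^sup>2 + 6*\<tau> + 4*n)"
    unfolding One_nat_def s rr Q by (simp add: R algebra_simps power2_eq_square del: mpow.simps)
qed

text \<open>Only r and r^2 have primitive cube roots of unity as eigenvalues. They have the same
  multiplicities, so their contributions are equal and cannot cancel.\<close>

lemma dihedral6_pole:
  fixes \<Gamma> :: "(real^'n^'n) set"
  assumes G: "mat_group \<Gamma>" and D: "dihedral \<Gamma> r t" and r3: "mat_order r = 3"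
  obtains w where "3 * real w = real CARD('n) - trace r" "w > 0" "has_pole \<Gamma> w"
proof -
  note f = dihedral6_facts[OF G D r3]
  have el: "orthogonal_matrix h" "mpow h 6 = mat 1" if "h \<in> \<Gamma>" for h
    using mat_group_simps(3)[OF G that] mpow_6[OF G f(4) that] .
  have R: "tr_pow r 3 = real CARD('n)" using tr_pow_mod[OF G f(5), of 3] by (simp add: r3 trace_I)
  define w where "w = unity_mult 6 r 2"
  have w: "6 * real w = 2 * (real CARD('n) - trace r)"
    unfolding w_def unity_mult6(3)[OF el[OF f(5)]] using f(3) R by (simp add: trace_I)
  have "r \<noteq> mat 1" using mat_order_eq_1[OF G f(5)] r3 by auto
  then have "trace r < real CARD('n)" using trace_eq_card_iff[OF G f(5)] by simp
  then have pos: "w > 0" using w by simp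
  have 0: "unity_mult 6 (mat 1 :: real^'n^'n) 2 = 0"
    using unity_mult6(3)[OF el[OF mat_group_simps(2)[OF G]]] by (simp add: tr_pow_mat_1 del: mpow.simps)
  have t0: "unity_mult 6 (mpow r i ** t) 2 = 0" for i
    using unity_mult6(3)[OF el[OF f(7)], of i] tr_pow_involution[OF f(1), of i] by (simp add: trace_I)
  have r2: "unity_mult 6 (mpow r 2) k = unity_mult 6 r k" if "k < 6" for k
  proof (rule unity_mult6_eqI[OF el[OF mpow_in[OF G f(5)]] el[OF f(5)] _ that])
    fix i :: nat assume i: "i \<le> 3"
    have "tr_pow (mpow r 2) i = tr_pow r (2 * i)" by (simp add: mpow_mult)
    also have "\<dots> = tr_pow r (3 - i)"
    proof -
      have "i = 0 \<or> i = 1 \<or> i = 2 \<or> i = 3" using i by auto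
      then have "(2 * i) mod 3 = (3 - i) mod 3" by auto
      then show ?thesis using tr_pow_mod[OF G f(5), of "2 * i"] tr_pow_mod[OF G f(5), of "3 - i"] r3 by simp
    qed
    also have "\<dots> = tr_pow r i" using tr_pow_reflect[OF G f(5), of i] r3 i by simp
    finally show "tr_pow (mpow r 2) i = tr_pow r i" .
  qed
  let ?pc = "pole_coeff root6 {..<6} 2 CARD('n)"
  define F where "F h = (if unity_mult 6 h 2 = w then ?pc (unity_mult 6 h) else 0)" for h :: "real^'n^'n"
  have F: "F (mpow r 0) = 0" "F (mpow r (Suc 0)) = ?pc (unity_mult 6 r)" "F (mpow r 2) = ?pc (unity_mult 6 r)"
    "F (mpow r i ** t) = 0" for i
    using 0 t0 pos r2[of 2] pole_coeff_6_cong[OF r2] by (simp_all add: F_def w_def[symmetric])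
  note s = sum_dihedral[OF G D, unfolded r3 sum_lessThan_numerals One_nat_def]
  have "(\<Sum>h\<in>\<Gamma>. F h) = 2 * ?pc (unity_mult 6 r)"
    unfolding s F by simp
  then have "(\<Sum>h\<in>\<Gamma>. F h) \<noteq> 0" using pole_coeff_6_neq_0 by simp
  moreover have "unity_mult 6 h 2 \<le> w" if "h \<in> \<Gamma>" for h
  proof -
    have "h \<in> dihedral_elem r t ` ({..<mat_order r} \<times> {..<2})"
      using coset_decomposition(2)[OF G f(5,6)] D that by (auto simp: dihedral_def)
    then obtain i j where ij: "i < 3" "j < (2::nat)" "h = mpow r i ** mpow t j" by (auto simp: dihedral_elem_def r3)
    show ?thesis
    proof (cases "j = 0")
      case True
      have "i = 0 \<or> i = 1 \<or> i = 2" using ij(1) by auto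
      then show ?thesis using True 0 r2[of 2] ij(3) by (auto simp: w_def)
    next
      case False
      then show ?thesis using t0[of i] ij by (simp add: less_2_cases_iff)
    qed
  qed
  moreover have "w \<le> CARD('n)"
    unfolding w_def by (rule unity_mult_le) (use el[OF f(5)] in auto)
  ultimately have "has_pole \<Gamma> w" by (simp add: has_pole_def F_def)
  then show ?thesis using that[of w] w pos by simp
qed

text \<open>Equal pole orders give w = a + b, hence the trace of \<open>r\<close>; degree 1 gives
  the trace of \<open>t\<close>. Degrees 2 and 3 are then contradictory.\<close>

lemma cyclic6_dihedral6_False:
  fixes \<Gamma> \<Gamma>' :: "(real^'n^'n) set"
  assumes G: "mat_group \<Gamma>'" and C: "cyclic_traces \<Gamma> g 6 T" and D: "dihedral \<Gamma>' r t" "mat_order r = 3"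
    and S: "same_molien \<Gamma> \<Gamma>'"
  shows False
proof -
  have GG: "mat_group \<Gamma>" "card \<Gamma> = 6" "card \<Gamma>' = 6" using C D by (auto simp: cyclic_traces_def dihedral_def)
  obtain a b m m0 :: nat where c: "CARD('n) = m0 + m + 2*a + 2*b" "T 1 = real m0 - m + a - b" "T 2 = real m0 + m - a - b"
    "T 3 = real m0 - m - 2 * real a + 2 * real b" "a + b > 0" "has_pole \<Gamma> (a + b)" by (rule cyclic6_pole[OF C])
  obtain w where w: "3 * real w = real CARD('n) - trace r" "w > 0" "has_pole \<Gamma>' w" by (rule dihedral6_pole[OF G D])
  have "a + b = w"
    using pole_unique[OF mpow_6[OF GG(1,2)] mpow_6[OF G GG(3)] _ c(6) w(3)] S by (simp add: same_molien_def)
  define n \<rho> \<tau> where nrt: "n = real CARD('n)" "\<rho> = trace r" "\<tau> = trace t"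
  note v = cyclic6_values[OF C nrt(1) c(2-4)] and v' = dihedral6_values[OF G D nrt]
  have n: "n = real m0 + m + 2 * real a + 2 * real b" using nrt(1) c(1) by simp
  have \<rho>: "\<rho> = real m0 + m - (real a + real b)" using w(1) \<open>a + b = w\<close> nrt n by auto
  have "3 * \<tau> = 3 * (real m0 - m)"
    using same_molien_power_sums(1)[OF S] unfolding v v' by (simp add: \<rho> algebra_simps)
  then have \<tau>: "\<tau> = real m0 - m" by simp
  show False
  proof (rule symmetric3_neq_cyclic6[OF _ n _ _ \<tau> \<rho>])
    show "real a + real b > 0" using c(5) by (simp flip: of_nat_add)
  qed (use same_molien_power_sums(2,3)[OF S] in \<open>simp_all only: v v' add_left_cancel\<close>)
qed

text \<open>For two cyclic groups the pole fixes a + b, degree 1 fixes \<open>m0\<close>, the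
  dimension then fixes \<open>m\<close>, and degrees 2 and 3 separate \<open>a\<close> from
  \<open>b\<close>. For two copies of \<open>S\<^sub>3\<close> the pole and degree 1 already give
  both traces.\<close>

lemma isomorphic_order_6:
  fixes \<Gamma> \<Gamma>' :: "(real^'n^'n) set"
  assumes G: "mat_group \<Gamma>" "mat_group \<Gamma>'" and card: "card \<Gamma> = 6" "card \<Gamma>' = 6" and S: "same_molien \<Gamma> \<Gamma>'"
  shows "character_isomorphic \<Gamma> \<Gamma>'"
proof -
  note m6 = mpow_6[OF G(1) card(1)] mpow_6[OF G(2) card(2)]
  have eq: "(\<Sum>g\<in>\<Gamma>. newton (tr_pow g) k) = (\<Sum>g\<in>\<Gamma>'. newton (tr_pow g) k)" for k
    using S by (simp add: same_molien_def)
  have S': "same_molien \<Gamma>' \<Gamma>" using S by (simp add: same_molien_def)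
  consider (cc) g T g' T' where "cyclic_traces \<Gamma> g 6 T" "cyclic_traces \<Gamma>' g' 6 T'"
    | (cd) g T r' t' where "cyclic_traces \<Gamma> g 6 T" "dihedral \<Gamma>' r' t'" "mat_order r' = 3"
    | (dc) r t g' T' where "dihedral \<Gamma> r t" "mat_order r = 3" "cyclic_traces \<Gamma>' g' 6 T'"
    | (dd) r t r' t' where "dihedral \<Gamma> r t" "mat_order r = 3" "dihedral \<Gamma>' r' t'" "mat_order r' = 3"
    using order6_cases[OF G(1) card(1)] order6_cases[OF G(2) card(2)] by metis
  then show ?thesis
  proof cases
    case cc
    obtain a b m m0 :: nat where c: "CARD('n) = m0 + m + 2*a + 2*b" "T 1 = real m0 - m + a - b" "T 2 = real m0 + m - a - b"
      "T 3 = real m0 - m - 2 * real a + 2 * real b" "a + b > 0" "has_pole \<Gamma> (a + b)" by (rule cyclic6_pole[OF cc(1)])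
    obtain a' b' m' m0' :: nat where c': "CARD('n) = m0' + m' + 2*a' + 2*b'" "T' 1 = real m0' - m' + a' - b'"
      "T' 2 = real m0' + m' - a' - b'" "T' 3 = real m0' - m' - 2 * real a' + 2 * real b'" "a' + b' > 0" "has_pole \<Gamma>' (a' + b')"
      by (rule cyclic6_pole[OF cc(2)])
    have ab: "a + b = a' + b'" by (rule pole_unique[OF m6 eq c(6) c'(6)])
    define n where n: "n = real CARD('n)"
    note v = cyclic6_values[OF cc(1) n c(2-4)] and v' = cyclic6_values[OF cc(2) n c'(2-4)]
    have nn: "n = real m0 + m + 2 * real a + 2 * real b" using n c(1) by simp
    have nn': "n = real m0' + m' + 2 * real a' + 2 * real b'" using n c'(1) by simp
    have rab: "real a + real b = real a' + real b'" using ab by (simp flip: of_nat_add)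
    \<comment> \<open>The sum of the traces is the group order times the dimension of the fixed
      space, here 6 m0.\<close>
    have "6 * real m0 = 6 * real m0'"
      using same_molien_power_sums(1)[OF S] nn nn' unfolding v v' by simp
    then have m0: "m0' = m0" by simp
    have mm: "m' = m" using nn nn' rab m0 by simp
    note E2 = same_molien_power_sums(2)[OF S, unfolded v(2) v'(2) add_left_cancel add_right_cancel m0 mm]
    note E3 = same_molien_power_sums(3)[OF S, unfolded v(3) v'(3) add_left_cancel add_right_cancel m0 mm]
    have "real a = real a' \<and> real b = real b'"
      by (rule cyclic6_multiplicities[OF rab _ _ E2 E3 nn]) simp_all
    then have "T 1 = T' 1" "T 2 = T' 2" "T 3 = T' 3" using c c' m0 mm by simp_all
    moreover have "i \<le> 6 div 2 \<Longrightarrow> i = 0 \<or> i = 1 \<or> i = 2 \<or> i = 3" for i :: nat by auto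
    ultimately show ?thesis
      using cyclic_traces_props(1)[OF cc(1)] cyclic_traces_props(1)[OF cc(2)]
      by (intro cyclic_traces_isomorphic[OF cc]) metis
  next
    case cd
    then show ?thesis using cyclic6_dihedral6_False[OF G(2) _ _ _ S] by blast
  next
    case dc
    then show ?thesis using cyclic6_dihedral6_False[OF G(1) _ _ _ S'] by blast
  next
    case dd
    obtain w where w: "3 * real w = real CARD('n) - trace r" "has_pole \<Gamma> w" by (rule dihedral6_pole[OF G(1) dd(1,2)])
    obtain w' where w': "3 * real w' = real CARD('n) - trace r'" "has_pole \<Gamma>' w'" by (rule dihedral6_pole[OF G(2) dd(3,4)])
    have "w = w'" by (rule pole_unique[OF m6 eq w(2) w'(2)])
    then have r: "trace r = trace r'" using w(1) w'(1) by simp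
    have t: "trace t = trace t'"
      using same_molien_power_sums(1)[OF S] r
      unfolding dihedral6_values[OF G(1) dd(1,2) refl refl refl] dihedral6_values[OF G(2) dd(3,4) refl refl refl] by simp
    note f = dihedral6_facts[OF G(1) dd(1,2)] and f' = dihedral6_facts[OF G(2) dd(3,4)]
    have o: "mat_order t = 2" "mat_order t' = 2" using dd by (auto simp: dihedral_def)
    have "trace (dihedral_elem r t (i, j)) = trace (dihedral_elem r' t' (i, j))" for i j
    proof -
      have "i mod 3 = 0 \<or> i mod 3 = 1 \<or> i mod 3 = 2" "j mod 2 = 0 \<or> j mod 2 = 1" by auto
      then have "trace (dihedral_elem r t (i mod 3, j mod 2)) = trace (dihedral_elem r' t' (i mod 3, j mod 2))"
        using r t f(2)[of "i mod 3"] f'(2)[of "i mod 3"] f(3) f'(3) by (auto simp: dihedral_elem_def)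
      then show ?thesis
        using dihedral_elem_mod[OF G(1) f(5,6), of i j] dihedral_elem_mod[OF G(2) f'(5,6), of i j] dd(2,4) o by simp
    qed
    then show ?thesis using dd(1,3) card by (intro dihedral_character_isomorphic[OF G dd(1,3)]) auto
  qed
qed

section \<open>Assembly of the cases and the theorem\<close>

lemma same_molien_isomorphic:
  fixes \<Gamma> \<Gamma>' :: "(real^'n^'n) set"
  assumes G: "mat_group \<Gamma>" "mat_group \<Gamma>'" and card: "card \<Gamma> = card \<Gamma>'" "card \<Gamma>' \<le> 7"
    and S: "same_molien \<Gamma> \<Gamma>'"
  shows "character_isomorphic \<Gamma> \<Gamma>'"
proof -
  have "card \<Gamma>' > 0" using mat_group_simps(1,2)[OF G(2)] by (auto simp: card_gt_0_iff)
  with card(2) consider (one) "card \<Gamma>' = 1" | (prime) "card \<Gamma>' \<in> {2, 3, 5, 7}" | (four) "card \<Gamma>' = 4" | (six) "card \<Gamma>' = 6"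
    by force
  then show ?thesis
  proof cases
    case one
    then have "\<Gamma> = {mat 1}" "\<Gamma>' = {mat 1}"
      using card mat_group_simps(2)[OF G(1)] mat_group_simps(2)[OF G(2)] by (auto simp: card_1_singleton_iff)
    then show ?thesis by (auto simp: character_isomorphic_def)
  next
    case prime
    then have "prime (card \<Gamma>')" by auto
    then obtain g g' where c: "cyclic_traces \<Gamma> g (card \<Gamma>') (tr_pow g)" "cyclic_traces \<Gamma>' g' (card \<Gamma>') (tr_pow g')"
      using prime_order_cyclic[OF G(1)] prime_order_cyclic[OF G(2)] card(1) by metis
    consider "card \<Gamma>' = 2 \<or> card \<Gamma>' = 3" | "card \<Gamma>' = 5" | "card \<Gamma>' = 7" using prime by auto
    then show ?thesis
    proof cases
      case 1
      then show ?thesis by (rule isomorphic_order_2_3[OF c _ S])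
    next
      case 2
      then show ?thesis using isomorphic_order_5 c S by metis
    next
      case 3
      then show ?thesis using isomorphic_order_7 c S by metis
    qed
  next
    case four
    then show ?thesis using isomorphic_order_4[OF G] card S by simp
  next
    case six
    then show ?thesis using isomorphic_order_6[OF G] card S by simp
  qed
qed

lemma isospectral_same_molien:
  fixes \<Gamma> \<Gamma>' :: "(real^'n^'n) set"
  assumes G: "mat_group \<Gamma>" "mat_group \<Gamma>'" and card: "card \<Gamma> = card \<Gamma>'" and n: "CARD('n) \<ge> 2"
    and iso: "isospectral \<Gamma> \<Gamma>'"
  shows "same_molien \<Gamma> \<Gamma>'"
  unfolding same_molien_def
proof
  fix k
  have "(\<Sum>g\<in>\<Delta>. newton (tr_pow g) k) = real (card \<Delta>) * real (cf.dim (invariant_hpoly \<Delta> k))"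
    if "mat_group \<Delta>" for \<Delta> :: "(real^'n^'n) set"
    by (rule sum_newton_eq_dim) (use mat_group_simps[OF that] in auto)
  then show "(\<Sum>g\<in>\<Gamma>. newton (tr_pow g) k) = (\<Sum>g\<in>\<Gamma>'. newton (tr_pow g) k)"
    using isospectral_dim_invariant_hpoly[OF n mat_group_simps(3)[OF G(1)] mat_group_simps(3)[OF G(2)] iso, of k]
      G card by simp
qed

theorem theorem4p1:
  fixes d :: nat
    and \<Gamma> \<Gamma>' :: "(real^'n^'n) set"
  assumes "d \<ge> 1" and "CARD('n) = d + 1"
    and "subgroup \<Gamma> orthogonal_group" and "finite \<Gamma>"
    and "subgroup \<Gamma>' orthogonal_group" and "finite \<Gamma>'"
    and "isospectral \<Gamma> \<Gamma>'"
    and "card \<Gamma> = card \<Gamma>'" and "card \<Gamma>' \<le> 7"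
  shows "conjugate_in_orthogonal_group \<Gamma> \<Gamma>' \<and> isometric_orbifolds \<Gamma> \<Gamma>'"
proof -
  have n: "CARD('n) \<ge> 2" using assms(1,2) by simp
  note G = subgroup_imp_mat_group[OF assms(3,4)] subgroup_imp_mat_group[OF assms(5,6)]
  have "character_isomorphic \<Gamma> \<Gamma>'"
    by (rule same_molien_isomorphic[OF G assms(8,9) isospectral_same_molien[OF G assms(8) n assms(7)]])
  from character_isomorphic_imp_conjugate[OF assms(3,5,4) this] show ?thesis
    using conjugate_imp_isometric by blast
qed

end
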